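(* Assume the following conditions. (R0) For any $\theta\in\Theta$, $\pi_1(\theta)$ is integrable under $\mathbb{P}_{\theta^*}$. (R1) For all $x,y\in\mathbb{R}$ the function $\theta\mapsto p_\theta(x,y)$, $\Theta\to\mathbb{R}_+$, is three times differentiable, and $\nabla\int_{\mathbb{R}}p_\theta(x,y)\,dy=\int_{\mathbb{R}}\nabla p_\theta(x,y)\,dy$, $\mathsf{H}\int_{\mathbb{R}}p_\theta(x,y)\,dy=\int_{\mathbb{R}}\mathsf{H}p_\theta(x,y)\,dy$. (R2) For any $\theta\in\Theta$, $\psi_1(\theta)$ and $\Psi_1(\theta)$ are integrable under $\mathbb{P}_{\theta^*}$; the function $\theta\mapsto\mathbb{E}_{\theta^*}[\pi_1(\theta)]$ is twice differentiable, and $\nabla\mathbb{E}_{\theta^*}[\pi_1(\theta)]=\mathbb{E}_{\theta^*}[\psi_1(\theta)]$, $\mathsf{H}\,\mathbb{E}_{\theta^*}[\pi_1(\theta)]=\mathbb{E}_{\theta^*}[\Psi_1(\theta)]$. (R3) The projected differential equation $\frac{dx(t)}{dt}=\mathbb{E}_{\theta^*}[\psi_1(x(t))]+\zeta(t)$, where $\zeta(t)\in -C(x(t))$ is the minimum force needed to keep $x(\cdot)$ in $\Theta$, has no stationary point on $\partial\Theta$; and there exists a unique $\theta^\star\in\Theta$ such that $\mathbb{E}_{\theta^*}[\psi_1(\theta^\star)]=0$. (R4) There exist positive constants $K_1,K_2,K_3$ such that for any $\theta,\theta_1,\theta_2\in\Theta$ and $n\ge1$: $(\theta-\theta^* )^Tb_n(\theta)\le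 -K_1\|\theta-\theta^*\|^2$; $\|b_n(\theta_1)-b_n(\theta_2)\|\le K_2\|\theta_1-\theta_2\|$; $\mathbb{E}_{\theta^*}[\|\Psi_n(\theta_1)-\Psi_n(\theta_2)\|\mid\mathcal{F}_{n-1}]\le K_3\|\theta_1-\theta_2\|$. (R5) There exists a positive constant $K_4$ such that for any $\theta\in\Theta$ and $n\ge1$, $\mathbb{E}_{\theta^*}[\|\mathsf{H}\psi_n(\theta)\|\mid\mathcal{F}_{n-1}]\le K_4$. (R6) For any $n\ge1$, $\sup_{\theta\in\Theta}\mathbb{E}_{\theta^*}\|\psi_n(\theta)-b_n(\theta)\|^2<\infty$. (R7) For each $\theta\in\Theta$ the Fisher information matrix $I(\theta):=\mathbb{E}_\theta[\psi_1(\theta)\psi_1^T(\theta)]$ exists and is positive definite, and $I(\theta)$ is continuous in $\theta$. (R8) $\lim_{n\to\infty}\mathbb{E}_{\theta^*}\big[\sup_{1\le i\le n}\big|\tfrac{1}{\sqrt n}\psi_i(\theta^* )\big|\big]=0$. Fix $\alpha\in(0,1)$ and let $\kappa\in\mathbb{R}$ satisfy $\mathbb{P}_{\theta^*}(\chi_d^2<\kappa)=1-\alpha$, where $\chi^2_d$ is a chi-squared random variable with $d$ degrees of freedom. Let $\theta_{n,k}=(\theta^1_{n,k},\dots,\theta^d_{n,k})^T$, $k=1,\dots,2d$, be the extreme points of the ellipsoid $\mathcal{T}_n$. Then for any $k\in\{1,\dots,2d\}$, $\theta_{n,k}\to\theta^*$ in $\mathbb{P}_{\theta^*}$-probability as 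$n\to\infty$.
   Context: Setting. $\Theta\subset\mathbb{R}^d$ is a non-empty compact hyperrectangle. For $\theta\in\partial\Theta$, $C(\theta)$ is the infinite convex cone generated by the outer normals at $\theta$ of the faces on which $\theta$ lies; $C(\theta)=\{0\}$ for $\theta$ in the interior of $\Theta$. $Z=\{Z_n,n\ge0\}$ is a real-valued process, the canonical process on its canonical space $(\Omega,\mathcal{F})$, with natural filtration $(\mathcal{F}_n)_{n\ge0}$, and $\{\mathbb{P}_\theta,\theta\in\Theta\}$ is a family of probability measures on $(\Omega,\mathcal{F})$. The true parameter $\theta^*$ lies in the interior of $\Theta$. $\mathbb{E}_\theta$ is expectation under $\mathbb{P}_\theta$. All equalities and inequalities between random variables are understood $\mathbb{P}_{\theta^*}$-almost surely. Standing Assumption M: (i) $Z$ is a time-homogeneous Markov process under every $\mathbb{P}_\theta$, $\theta\in\Theta$; (ii) $Z$ is an ergodic Markov process under $\mathbb{P}_{\theta^*}$ (stationary, with trivial shift-invariant $\sigma$-field); (iii) for every $\theta\in\Theta$, $\mathbb{P}_\theta(Z_1\in A\mid Z_0=x)=\int_A p_\theta(x,y)\,dy$ for every Borel $A\subset\mathbb{R}$, with $p_\theta$ positive and measurable. Notation. $\nabla$ and $\mathsf{H}$ denote gradient and Hessian with respect to $\theta$. For $n\ge1$: $\pi_n(\theta)=\log p_\theta(Z_{n-1},Z_n)$, $\psi_n(\theta)=\nabla\pi_n(\theta)$, $\Psi_n(\theta)=\mathsf{H}\pi_n(\theta)$, $b_n(\theta)=\mathbb{E}_{\theta^*}[\psi_n(\theta)\mid\mathcal{F}_{n-1}]$;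 by the Markov property $b_n(\theta)$ is a function of $\theta$ and $Z_{n-1}$, postulated to be continuous in $Z_{n-1}$. $\mathsf{H}\psi_n$ is the array of second derivatives of the components of $\psi_n$. $\|\cdot\|$ is the Euclidean norm for vectors and a fixed norm for matrices/arrays; $|\cdot|$ is the sum of absolute values of entries. A stationary point on $\partial\Theta$ of the projected differential equation is a point $\theta\in\partial\Theta$ at which the right-hand side (drift plus the minimal projection force $\zeta\in -C(\theta)$) vanishes. Base estimator. Fix $\beta>0$ with $\beta K_1>\frac12$, where $K_1$ is the constant in the bound $(\theta-\theta^* )^Tb_n(\theta)\le -K_1\|\theta-\theta^*\|^2$. With $\tilde\theta_0\in\Theta$, set $\tilde\theta_n=\tilde\theta_{n-1}+\frac{\beta}{n}\psi_n(\tilde\theta_{n-1})+\frac{\beta}{n}J_n$, $n\ge1$, where $\frac{\beta}{n}J_n$ is the vector of shortest Euclidean length needed to take $\tilde\theta_{n-1}+\frac{\beta}{n}\psi_n(\tilde\theta_{n-1})$ back to $\Theta$. Estimator $\hat\theta$. With $\mathrm{Id}$ the identity matrix, $\Gamma_0=0$, $I_0=0$, for $n\ge1$: $I_n=\frac{n-1}{n}I_{n-1}+\frac1n\Psi_n(\tilde\theta_{n-1})$, $\Gamma_n=\frac{n-1}{n}\Gamma_{n-1}+\frac1n(\mathrm{Id}+\beta I_n)\psi_n(\tilde\theta_{n-1})+\frac{\beta}{n}I_nJ_n$, $\hat\theta_n=-I^{-1}(\tilde\theta_n)I_n\tilde\theta_n+I^{-1}(\tilde\theta_n)\Gamma_n$,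 where $I(\cdot)$ (with an argument) is the Fisher information matrix and $I_n$ the recursively defined matrix. Confidence region and its extreme points. $\mathcal{T}_n=\{\theta:\ n(\hat\theta_n-\theta)^TI(\tilde\theta_n)(\hat\theta_n-\theta)<\kappa\}$ is the interior of a $d$-dimensional ellipsoid. Let $I(\tilde\theta_n)=L_nL_n^T$ be the Cholesky decomposition ($L_n$ lower triangular with positive diagonal) and $e_1,\dots,e_d$ the standard basis of $\mathbb{R}^d$. The $2d$ extreme points of $\mathcal{T}_n$ are, for $j=1,\dots,d$, $\theta_{n,2j-1}=\hat\theta_n-\sqrt{\kappa/n}\,(L_n^T)^{-1}e_j$ and $\theta_{n,2j}=\hat\theta_n+\sqrt{\kappa/n}\,(L_n^T)^{-1}e_j$. *)

theory Defs
  imports "HOL-Probability.Probability"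
begin

section \<open>Derivatives relative to the parameter set\<close>

text \<open>All derivatives in the parameter are taken within the parameter set, so that they are also
  meaningful on its boundary (for a box with non-empty interior they are unique).\<close>

definition grad_on :: "(real^'d) set \<Rightarrow> (real^'d \<Rightarrow> real) \<Rightarrow> real^'d \<Rightarrow> real^'d" where
  "grad_on S f \<theta> = (\<chi> i. frechet_derivative f (at \<theta> within S) (axis i 1))"

definition hess_on :: "(real^'d) set \<Rightarrow> (real^'d \<Rightarrow> real) \<Rightarrow> real^'d \<Rightarrow> real^'d^'d" where
  "hess_on S f \<theta> = jacobian (grad_on S f) (at \<theta> within S)"

definition twice_differentiable_on :: "(real^'d \<Rightarrow> real) \<Rightarrow> (real^'d) set \<Rightarrow> bool" where
  "twice_differentiable_on f S \<longleftrightarrow> f differentiable_on S \<and> grad_on S f differentiable_on S"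

definition thrice_differentiable_on :: "(real^'d \<Rightarrow> real) \<Rightarrow> (real^'d) set \<Rightarrow> bool" where
  "thrice_differentiable_on f S \<longleftrightarrow> twice_differentiable_on f S \<and> hess_on S f differentiable_on S"


section \<open>The canonical process\<close>

definition path_space :: "(nat \<Rightarrow> real) measure" where
  "path_space = PiM UNIV (\<lambda>_. borel)"

definition obs :: "nat \<Rightarrow> (nat \<Rightarrow> real) \<Rightarrow> real" where
  "obs n \<omega> = \<omega> n"

definition history :: "nat \<Rightarrow> (nat \<Rightarrow> real) measure" where
  "history n = sigma UNIV {obs i -` A | i A. i \<le> n \<and> A \<in> sets borel}"

definition shift :: "(nat \<Rightarrow> real) \<Rightarrow> nat \<Rightarrow> real" where
  "shift \<omega> = (\<lambda>n. \<omega> (Suc n))"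

definition homogeneous_markov :: "(nat \<Rightarrow> real) measure \<Rightarrow> (real \<Rightarrow> real measure) \<Rightarrow> bool" where
  "homogeneous_markov M Q \<longleftrightarrow>
     Q \<in> borel \<rightarrow>\<^sub>M prob_algebra borel \<and>
     (\<forall>n. \<forall>A \<in> sets borel. AE \<omega> in M.
        real_cond_exp M (history n) (\<lambda>\<omega>. indicator A (obs (Suc n) \<omega>)) \<omega>
          = measure (Q (obs n \<omega>)) A)"

definition stationary_ergodic :: "(nat \<Rightarrow> real) measure \<Rightarrow> bool" where
  "stationary_ergodic M \<longleftrightarrow>
     distr M M shift = M \<and>
     (\<forall>A \<in> sets M. shift -` A = A \<longrightarrow> measure M A = 0 \<or> measure M A = 1)"

definition vec_cond_exp ::
    "'w measure \<Rightarrow> 'w measure \<Rightarrow> ('w \<Rightarrow> real^'d) \<Rightarrow> 'w \<Rightarrow> real^'d" where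
  "vec_cond_exp M F X \<omega> = (\<chi> i. real_cond_exp M F (\<lambda>\<omega>. X \<omega> $ i) \<omega>)"

text \<open>Requiring every \<open>X n\<close> to be measurable matters: \<^const>\<open>measure\<close> is \<open>0\<close> on
  non-measurable sets.\<close>

definition tendsto_in_probability ::
    "'w measure \<Rightarrow> (nat \<Rightarrow> 'w \<Rightarrow> 'b::metric_space) \<Rightarrow> 'b \<Rightarrow> bool" where
  "tendsto_in_probability M X c \<longleftrightarrow>
     (\<forall>n. X n \<in> borel_measurable M) \<and>
     (\<forall>\<epsilon>>0. (\<lambda>n. measure M {\<omega> \<in> space M. dist (X n \<omega>) c > \<epsilon>}) \<longlonglongrightarrow> 0)"

definition chi_squared :: "nat \<Rightarrow> real measure" where
  "chi_squared d =
     distr (PiM {..<d} (\<lambda>_. density lborel std_normal_density)) borel (\<lambda>x. \<Sum>i<d. (x i)\<^sup>2)"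


section \<open>Log-likelihood, score, Fisher information\<close>

text \<open>Throughout, \<open>p \<theta> x y\<close> is the transition density, \<open>T\<close> the parameter set, \<open>P \<theta>\<close> the law of
  the process under the parameter \<open>\<theta>\<close>; the time index \<open>n\<close> of \<open>\<pi>\<^sub>n\<close>, \<open>\<psi>\<^sub>n\<close>, \<open>\<Psi>\<^sub>n\<close>, \<open>b\<^sub>n\<close> is
  meant to be at least 1.\<close>

definition log_lik ::
    "(real^'d \<Rightarrow> real \<Rightarrow> real \<Rightarrow> real) \<Rightarrow> nat \<Rightarrow> real^'d \<Rightarrow> (nat \<Rightarrow> real) \<Rightarrow> real" where
  "log_lik p n \<theta> \<omega> = ln (p \<theta> (obs (n - 1) \<omega>) (obs n \<omega>))"

definition score ::
    "(real^'d) set \<Rightarrow> (real^'d \<Rightarrow> real \<Rightarrow> real \<Rightarrow> real) \<Rightarrow>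
     nat \<Rightarrow> real^'d \<Rightarrow> (nat \<Rightarrow> real) \<Rightarrow> real^'d" where
  "score T p n \<theta> \<omega> = grad_on T (\<lambda>t. log_lik p n t \<omega>) \<theta>"

definition score_jac ::
    "(real^'d) set \<Rightarrow> (real^'d \<Rightarrow> real \<Rightarrow> real \<Rightarrow> real) \<Rightarrow>
     nat \<Rightarrow> real^'d \<Rightarrow> (nat \<Rightarrow> real) \<Rightarrow> real^'d^'d" where
  "score_jac T p n \<theta> \<omega> = hess_on T (\<lambda>t. log_lik p n t \<omega>) \<theta>"

definition score_hess ::
    "(real^'d) set \<Rightarrow> (real^'d \<Rightarrow> real \<Rightarrow> real \<Rightarrow> real) \<Rightarrow>
     nat \<Rightarrow> real^'d \<Rightarrow> (nat \<Rightarrow> real) \<Rightarrow> real^'d^'d^'d" where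
  "score_hess T p n \<theta> \<omega> = (\<chi> i. hess_on T (\<lambda>t. score T p n t \<omega> $ i) \<theta>)"

definition cond_score ::
    "(nat \<Rightarrow> real) measure \<Rightarrow> (real^'d) set \<Rightarrow> (real^'d \<Rightarrow> real \<Rightarrow> real \<Rightarrow> real) \<Rightarrow>
     nat \<Rightarrow> real^'d \<Rightarrow> (nat \<Rightarrow> real) \<Rightarrow> real^'d" where
  "cond_score M T p n \<theta> = vec_cond_exp M (history (n - 1)) (score T p n \<theta>)"

definition outer :: "real^'d \<Rightarrow> real^'d^'d" where
  "outer v = (\<chi> i j. v $ i * v $ j)"

definition fisher ::
    "(real^'d \<Rightarrow> (nat \<Rightarrow> real) measure) \<Rightarrow> (real^'d) set \<Rightarrow>
     (real^'d \<Rightarrow> real \<Rightarrow> real \<Rightarrow> real) \<Rightarrow> real^'d \<Rightarrow> real^'d^'d" where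
  "fisher P T p \<theta> = (\<integral>\<omega>. outer (score T p 1 \<theta> \<omega>) \<partial>P \<theta>)"

definition positive_definite :: "real^'d^'d \<Rightarrow> bool" where
  "positive_definite A \<longleftrightarrow> transpose A = A \<and> (\<forall>v. v \<noteq> 0 \<longrightarrow> 0 < v \<bullet> (A *v v))"


section \<open>The projected differential equation on a box\<close>

definition normal_cone_box :: "real^'d \<Rightarrow> real^'d \<Rightarrow> real^'d \<Rightarrow> (real^'d) set" where
  "normal_cone_box l u \<theta> =
     convex_cone hull ({axis i 1 | i. \<theta> $ i = u $ i} \<union> {- axis i 1 | i. \<theta> $ i = l $ i})"

text \<open>The force \<open>\<zeta>\<close> keeps the solution of \<open>x' = v + \<zeta>\<close> passing through \<open>\<theta>\<close> in the box if
  \<open>v + \<zeta>\<close> is a feasible direction at \<open>\<theta>\<close>; among such \<open>\<zeta> \<in> - C(\<theta>)\<close> the shortest one is used.\<close>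

definition minimal_force :: "real^'d \<Rightarrow> real^'d \<Rightarrow> real^'d \<Rightarrow> real^'d \<Rightarrow> real^'d \<Rightarrow> bool" where
  "minimal_force l u \<theta> v \<zeta> \<longleftrightarrow>
     is_arg_min norm
       (\<lambda>z. - z \<in> normal_cone_box l u \<theta> \<and>
            (\<exists>\<epsilon>>0. \<forall>s\<in>{0..\<epsilon>}. \<theta> + s *\<^sub>R (v + z) \<in> cbox l u)) \<zeta>"

definition boundary_stationary ::
    "real^'d \<Rightarrow> real^'d \<Rightarrow> (real^'d \<Rightarrow> real^'d) \<Rightarrow> real^'d \<Rightarrow> bool" where
  "boundary_stationary l u drift \<theta> \<longleftrightarrow>
     \<theta> \<in> frontier (cbox l u) \<and> (\<exists>\<zeta>. minimal_force l u \<theta> (drift \<theta>) \<zeta> \<and> drift \<theta> + \<zeta> = 0)"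


section \<open>The estimators\<close>

text \<open>\<open>projection_term T p \<beta> n \<theta>\<close> is \<open>J\<^sub>n\<close> when \<open>\<theta>\<close> is the base estimate at time \<open>n - 1\<close>.\<close>

definition projection_term ::
    "(real^'d) set \<Rightarrow> (real^'d \<Rightarrow> real \<Rightarrow> real \<Rightarrow> real) \<Rightarrow> real \<Rightarrow>
     nat \<Rightarrow> real^'d \<Rightarrow> (nat \<Rightarrow> real) \<Rightarrow> real^'d" where
  "projection_term T p \<beta> n \<theta> \<omega> =
     (let w = \<theta> + (\<beta> / real n) *\<^sub>R score T p n \<theta> \<omega>
      in (real n / \<beta>) *\<^sub>R (closest_point T w - w))"

primrec base_est ::
    "(real^'d) set \<Rightarrow> (real^'d \<Rightarrow> real \<Rightarrow> real \<Rightarrow> real) \<Rightarrow> real \<Rightarrow> real^'d \<Rightarrow>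
     nat \<Rightarrow> (nat \<Rightarrow> real) \<Rightarrow> real^'d" where
  "base_est T p \<beta> t0 0 \<omega> = t0"
| "base_est T p \<beta> t0 (Suc n) \<omega> =
     base_est T p \<beta> t0 n \<omega>
     + (\<beta> / real (Suc n)) *\<^sub>R score T p (Suc n) (base_est T p \<beta> t0 n \<omega>) \<omega>
     + (\<beta> / real (Suc n)) *\<^sub>R projection_term T p \<beta> (Suc n) (base_est T p \<beta> t0 n \<omega>) \<omega>"

primrec info_seq ::
    "(real^'d) set \<Rightarrow> (real^'d \<Rightarrow> real \<Rightarrow> real \<Rightarrow> real) \<Rightarrow> real \<Rightarrow> real^'d \<Rightarrow>
     nat \<Rightarrow> (nat \<Rightarrow> real) \<Rightarrow> real^'d^'d" where
  "info_seq T p \<beta> t0 0 \<omega> = 0"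
| "info_seq T p \<beta> t0 (Suc n) \<omega> =
     (real n / real (Suc n)) *\<^sub>R info_seq T p \<beta> t0 n \<omega>
     + (1 / real (Suc n)) *\<^sub>R score_jac T p (Suc n) (base_est T p \<beta> t0 n \<omega>) \<omega>"

primrec gamma_seq ::
    "(real^'d) set \<Rightarrow> (real^'d \<Rightarrow> real \<Rightarrow> real \<Rightarrow> real) \<Rightarrow> real \<Rightarrow> real^'d \<Rightarrow>
     nat \<Rightarrow> (nat \<Rightarrow> real) \<Rightarrow> real^'d" where
  "gamma_seq T p \<beta> t0 0 \<omega> = 0"
| "gamma_seq T p \<beta> t0 (Suc n) \<omega> =
     (real n / real (Suc n)) *\<^sub>R gamma_seq T p \<beta> t0 n \<omega>
     + (1 / real (Suc n)) *\<^sub>R ((mat 1 + \<beta> *\<^sub>R info_seq T p \<beta> t0 (Suc n) \<omega>)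
           *v score T p (Suc n) (base_est T p \<beta> t0 n \<omega>) \<omega>)
     + (\<beta> / real (Suc n)) *\<^sub>R (info_seq T p \<beta> t0 (Suc n) \<omega>
           *v projection_term T p \<beta> (Suc n) (base_est T p \<beta> t0 n \<omega>) \<omega>)"

definition estimator ::
    "(real^'d \<Rightarrow> (nat \<Rightarrow> real) measure) \<Rightarrow> (real^'d) set \<Rightarrow>
     (real^'d \<Rightarrow> real \<Rightarrow> real \<Rightarrow> real) \<Rightarrow> real \<Rightarrow> real^'d \<Rightarrow>
     nat \<Rightarrow> (nat \<Rightarrow> real) \<Rightarrow> real^'d" where
  "estimator P T p \<beta> t0 n \<omega> =
     (let R = matrix_inv (fisher P T p (base_est T p \<beta> t0 n \<omega>))
      in - (R *v (info_seq T p \<beta> t0 n \<omega> *v base_est T p \<beta> t0 n \<omega>))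
         + R *v gamma_seq T p \<beta> t0 n \<omega>)"


section \<open>The confidence ellipsoid and its extreme points\<close>

definition ellipsoid ::
    "(real^'d \<Rightarrow> (nat \<Rightarrow> real) measure) \<Rightarrow> (real^'d) set \<Rightarrow>
     (real^'d \<Rightarrow> real \<Rightarrow> real \<Rightarrow> real) \<Rightarrow> real \<Rightarrow> real^'d \<Rightarrow> real \<Rightarrow>
     nat \<Rightarrow> (nat \<Rightarrow> real) \<Rightarrow> (real^'d) set" where
  "ellipsoid P T p \<beta> t0 \<kappa> n \<omega> =
     {\<theta>. real n * ((estimator P T p \<beta> t0 n \<omega> - \<theta>) \<bullet>
            (fisher P T p (base_est T p \<beta> t0 n \<omega>) *v (estimator P T p \<beta> t0 n \<omega> - \<theta>))) < \<kappa>}"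

definition is_cholesky :: "((real, 'd::{finite,linorder}) vec, 'd) vec \<Rightarrow> ((real, 'd) vec, 'd) vec \<Rightarrow> bool" where
  "is_cholesky A L \<longleftrightarrow>
     (\<forall>i j. i < j \<longrightarrow> L $ i $ j = 0) \<and> (\<forall>i. 0 < L $ i $ i) \<and> A = L ** transpose L"

definition cholesky :: "((real, 'd::{finite,linorder}) vec, 'd) vec \<Rightarrow> ((real, 'd) vec, 'd) vec" where
  "cholesky A = (THE L. is_cholesky A L)"

text \<open>The \<open>j\<close>-th coordinate index, \<open>1 \<le> j \<le> CARD('d)\<close>, in the order of \<open>'d\<close>.\<close>

definition coord_index :: "nat \<Rightarrow> 'd::{finite,linorder}" where
  "coord_index j = sorted_list_of_set UNIV ! (j - 1)"

text \<open>The extreme point number \<open>k \<in> {1..2 * CARD('d)}\<close>: odd \<open>k = 2 * j - 1\<close> takes the minus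
  sign and even \<open>k = 2 * j\<close> the plus sign, in both cases with \<open>j = (k + 1) div 2\<close>.\<close>

definition extreme_point ::
    "((real, 'd::{finite,linorder}) vec \<Rightarrow> (nat \<Rightarrow> real) measure) \<Rightarrow> ((real, 'd) vec) set \<Rightarrow>
     ((real, 'd) vec \<Rightarrow> real \<Rightarrow> real \<Rightarrow> real) \<Rightarrow> real \<Rightarrow> (real, 'd) vec \<Rightarrow> real \<Rightarrow>
     nat \<Rightarrow> nat \<Rightarrow> (nat \<Rightarrow> real) \<Rightarrow> (real, 'd) vec" where
  "extreme_point P T p \<beta> t0 \<kappa> n k \<omega> =
     estimator P T p \<beta> t0 n \<omega>
     + ((if odd k then - 1 else 1) * sqrt (\<kappa> / real n)) *\<^sub>R
       (matrix_inv (transpose (cholesky (fisher P T p (base_est T p \<beta> t0 n \<omega>))))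
          *v axis (coord_index ((k + 1) div 2)) 1)"

lemma extreme_point_on_boundary:
  fixes P :: "(real, 'd::{finite,linorder}) vec \<Rightarrow> (nat \<Rightarrow> real) measure"
    and T p \<beta> t0 \<kappa> n k \<omega>
  defines "A \<equiv> fisher P T p (base_est T p \<beta> t0 n \<omega>)"
    and "D \<equiv> estimator P T p \<beta> t0 n \<omega> - extreme_point P T p \<beta> t0 \<kappa> n k \<omega>"
  assumes pd: "positive_definite A" and ch: "is_cholesky A (cholesky A)"
    and "n \<ge> 1" "\<kappa> > 0"
  shows "extreme_point P T p \<beta> t0 \<kappa> n k \<omega> \<in> frontier (ellipsoid P T p \<beta> t0 \<kappa> n \<omega>)"
proof -
  define L where "L = cholesky (A)"
  define R where "R = matrix_inv (transpose L)"
  define e where "e = (axis (coord_index ((k + 1) div 2)) 1 :: (real, 'd) vec)"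
  define c where "c = (if odd k then - 1 else 1) * sqrt (\<kappa> / real n)"
  have AL: "A = L ** transpose L"
    using ch by (simp add: is_cholesky_def L_def)
  have ker: "x = 0" if "transpose L *v x = 0" for x
  proof (rule ccontr)
    assume "x \<noteq> 0"
    then have "0 < x \<bullet> (L *v (transpose L *v x))"
      using pd unfolding positive_definite_def AL matrix_vector_mul_assoc by blast
    then show False
      by (simp only: that matrix_vector_mult_0_right inner_zero_right)
  qed
  then have "invertible (transpose L)"
    using invertible_left_inverse matrix_left_invertible_ker by blast
  then have TR: "transpose L ** R = mat 1"
    unfolding R_def matrix_inv_def invertible_def by (rule someI2_ex) simp
  have inv: "transpose L *v (R *v v) = v" for v
    by (simp only: matrix_vector_mul_assoc TR matrix_vector_mul_lid)
  have D: "D = (- c) *\<^sub>R (R *v e)"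
    by (simp add: D_def extreme_point_def c_def R_def e_def L_def A_def)
  have "(R *v e) \<bullet> (A *v (R *v e)) = (transpose L *v (R *v e)) \<bullet> (transpose L *v (R *v e))"
    by (simp only: AL dot_lmul_matrix[symmetric] matrix_vector_mul_assoc[symmetric]
        transpose_matrix_vector)
  also have "\<dots> = 1"
    by (simp only: inv) (simp add: e_def inner_axis_axis)
  finally have "D \<bullet> (A *v D) = c\<^sup>2"
    by (simp only: D matrix_vector_mult_scaleR inner_scaleR_left inner_scaleR_right)
       (simp add: power2_eq_square)
  also have "c\<^sup>2 = \<kappa> / real n"
    using assms by (simp add: c_def power_mult_distrib)
  finally have q: "real n * (D \<bullet> (A *v D)) = \<kappa>"
    using assms by simp
  define x where "x = estimator P T p \<beta> t0 n \<omega>"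
  have mem: "x - s *\<^sub>R D \<in> ellipsoid P T p \<beta> t0 \<kappa> n \<omega> \<longleftrightarrow> s\<^sup>2 * \<kappa> < \<kappa>" for s
    unfolding q[symmetric]
    by (simp add: q ellipsoid_def x_def flip: A_def)
       (simp add: q[symmetric] matrix_vector_mult_scaleR power2_eq_square algebra_simps)
  have "(\<lambda>m. x - (1 - inverse (real (Suc m))) *\<^sub>R D) \<longlonglongrightarrow> x - (1 - 0) *\<^sub>R D"
    by (intro tendsto_intros LIMSEQ_inverse_real_of_nat)
  moreover have "x - (1 - inverse (real (Suc m))) *\<^sub>R D \<in> ellipsoid P T p \<beta> t0 \<kappa> n \<omega>" for m
  proof -
    have "(1 - inverse (real (Suc m)))\<^sup>2 < 1"
      by (intro power_less_one_iff[THEN iffD2] conjI) (auto simp: field_simps )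
    then show ?thesis
      using \<open>\<kappa> > 0\<close> unfolding mem by simp
  qed
  ultimately have "x - (1 - 0) *\<^sub>R D \<in> closure (ellipsoid P T p \<beta> t0 \<kappa> n \<omega>)"
    unfolding closure_sequential
    by (intro exI[of _ "\<lambda>m. x - (1 - inverse (real (Suc m))) *\<^sub>R D"]) simp
  moreover have "x - 1 *\<^sub>R D \<notin> ellipsoid P T p \<beta> t0 \<kappa> n \<omega>"
    by (simp only: mem) simp
  ultimately show ?thesis
    using interior_subset[of "ellipsoid P T p \<beta> t0 \<kappa> n \<omega>"]
    by (auto simp: frontier_def D_def x_def)
qed

end

theory Submission
  imports Defs
begin

text \<open>
  Summation by parts turns the recursion for \<open>\<Gamma>\<^sub>n\<close> into
  \<open>\<Gamma>\<^sub>n - I\<^sub>n x\<^sub>n = (1/n) (\<Sum>k<n. \<psi>\<^sub>k\<^sub>+\<^sub>1(x\<^sub>k) - \<Psi>\<^sub>k\<^sub>+\<^sub>1(x\<^sub>k) x\<^sub>k)\<close>, where \<open>x\<^sub>n\<close> is the base estimate.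
  Since \<open>x\<^sub>n\<close> tends to \<open>\<theta>s\<close> in probability, the Lipschitz condition on \<open>\<Psi>\<close> makes it possible, up to an
  error tending to zero in \<open>L\<^sup>1\<close>, to replace \<open>x\<^sub>k\<close> by \<open>\<theta>s\<close>; Birkhoff's theorem and the information identity
  \<open>E \<Psi>\<^sub>1(\<theta>s) = - I(\<theta>s)\<close> then give the limit \<open>I(\<theta>s) \<theta>s\<close> of the average, and hence the limit \<open>\<theta>s\<close> of the
  estimator. The Cholesky factor depends continuously on the matrix, so that the axes of the
  ellipsoid are of order \<open>1/sqrt n\<close>.

  The bound on the second moment of the score at each fixed parameter does not control it at the
  random parameter \<open>x\<^sub>n\<close>. The convergence of \<open>x\<^sub>n\<close> is therefore derived from first moments: projection
  onto a bounded set makes the error of one step at most linear in the score, and the scores are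
  uniformly integrable.
\<close>

section \<open>The Cholesky factor\<close>

text \<open>Each conditional bound holds almost surely for one fixed parameter, with an exceptional
  set that depends on it, whereas the recursion evaluates the score at a random parameter known from
  the past. The bounds are therefore used in integrated form over events of the past, which passes
  to simple predictable parameters by summing over their values. For nonnegative integrands Fatou
  does the rest. The drift changes sign, so its passage to the limit rests on L1 continuity of the
  score in the parameter; this comes from integrating the Jacobian along a segment, up to an
  arbitrarily small additive error because the Jacobian at \<open>\<theta>s\<close> is merely
  integrable. The gain enters as \<open>2 * \<beta> * K1 \<ge> 1\<close>: then \<open>n\<close>
  times the mean square error grows in each step by no more than the remainder of that step, and the
  error is dominated by a Cesaro mean of null remainders.\<close>

lemma norm_matrix_vector_mult_le:
  fixes A :: "real^'n^'m" and x :: "real^'n"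
  shows "norm (A *v x) \<le> norm A * norm x"
proof -
  have "norm (A *v x) = L2_set (\<lambda>i. norm ((A *v x) $ i)) UNIV"
    by (simp add: norm_vec_def)
  also have "\<dots> \<le> L2_set (\<lambda>i. norm (A $ i) * norm x) UNIV"
    by (intro L2_set_mono) (auto simp: matrix_vector_mul_component Cauchy_Schwarz_ineq2)
  also have "\<dots> = norm A * norm x"
    by (simp add: L2_set_left_distrib norm_vec_def)
  finally show ?thesis .
qed

section \<open>Continuity of determinants, transposes and inverses\<close>

lemma continuous_on_det:
  fixes A :: "'a::topological_space \<Rightarrow> real^'n^'n"
  assumes "continuous_on S A"
  shows "continuous_on S (\<lambda>x. det (A x))"
  unfolding det_def by (intro continuous_intros assms)

lemma continuous_on_transpose:
  fixes A :: "'a::topological_space \<Rightarrow> real^'n^'m"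
  assumes "continuous_on S A"
  shows "continuous_on S (\<lambda>x. transpose (A x))"
  unfolding transpose_def by (intro continuous_intros assms)

text \<open>Cramer's rule writes every entry of the inverse as a quotient of determinants, which are
  polynomials in the entries of the matrix.\<close>

lemma continuous_on_matrix_inv:
  fixes A :: "'a::topological_space \<Rightarrow> real^'n^'n"
  assumes cont: "continuous_on S A" and inv: "\<And>x. x \<in> S \<Longrightarrow> invertible (A x)"
  shows "continuous_on S (\<lambda>x. matrix_inv (A x))"
proof -
  have eq: "matrix_inv (A x) =
      (\<chi> k m. det (\<chi> i j. if j = k then axis m 1 $ i else A x $ i $ j) / det (A x))" if "x \<in> S" for x
  proof -
    have d: "det (A x) \<noteq> 0" using inv[OF that] by (simp add: invertible_det_nz)
    have r: "A x ** matrix_inv (A x) = mat 1"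
      using inv[OF that] unfolding matrix_inv_def invertible_def by (rule someI2_ex) simp
    have "matrix_inv (A x) $ k $ m = det (\<chi> i j. if j = k then axis m 1 $ i else A x $ i $ j) / det (A x)" for k m
    proof -
      have "A x *v (matrix_inv (A x) *v axis m 1) = axis m 1"
        by (simp add: matrix_vector_mul_assoc r)
      then have "matrix_inv (A x) *v axis m 1 =
          (\<chi> k. det (\<chi> i j. if j = k then axis m 1 $ i else A x $ i $ j) / det (A x))"
        unfolding cramer[OF d] .
      then have "(matrix_inv (A x) *v axis m 1) $ k =
          det (\<chi> i j. if j = k then axis m 1 $ i else A x $ i $ j) / det (A x)"
        by simp
      moreover have "(matrix_inv (A x) *v axis m 1) $ k = matrix_inv (A x) $ k $ m"
        by (simp add: matrix_vector_mult_def axis_def if_distrib cong: if_cong)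
      ultimately show ?thesis by simp
    qed
    then show ?thesis by (simp add: vec_eq_iff)
  qed
  have "continuous_on S (\<lambda>x. \<chi> k m. det (\<chi> i j. if j = k then axis m 1 $ i else A x $ i $ j) / det (A x))"
  proof (intro continuous_intros continuous_on_det)
    show "continuous_on S (\<lambda>x. if j = k then axis m 1 $ i else A x $ i $ j)" for i j k m
      using cont by (cases "j = k") (auto intro!: continuous_intros)
    show "\<forall>x\<in>S. det (A x) \<noteq> 0" using inv by (simp add: invertible_det_nz)
  qed (rule cont)
  then show ?thesis
    by (rule continuous_on_eq) (simp add: eq)
qed

section \<open>Existence, uniqueness and continuity of the triangular factor\<close>

lemma positive_definite_invertible:
  fixes A :: "real^'n^'n"
  assumes "positive_definite A"
  shows "invertible A"
proof -
  have "x = 0" if "A *v x = 0" for x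
    using assms that unfolding positive_definite_def by (metis inner_zero_right less_irrefl)
  then show ?thesis
    using invertible_left_inverse matrix_left_invertible_ker by blast
qed

text \<open>At the first nonzero coordinate \<open>m\<close> of a kernel vector, row
  \<open>m\<close> reduces to its diagonal term: entries to the right vanish by triangularity,
  coordinates to the left by the choice of \<open>m\<close>.\<close>

lemma lower_triangular_invertible:
  fixes L :: "real^('d::{finite,linorder})^('d::{finite,linorder})"
  assumes "\<And>i j. i < j \<Longrightarrow> L $ i $ j = 0" "\<And>i. L $ i $ i \<noteq> 0"
  shows "invertible L"
proof -
  have "x = 0" if Lx: "L *v x = 0" for x
  proof (rule ccontr)
    assume "x \<noteq> 0"
    then have ne: "{i. x $ i \<noteq> 0} \<noteq> {}" by (auto simp: vec_eq_iff)
    define m where "m = Min {i. x $ i \<noteq> 0}"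
    have m: "x $ m \<noteq> 0" using Min_in[OF _ ne] by (auto simp: m_def)
    have below: "x $ i = 0" if "i < m" for i
    proof (rule ccontr)
      assume "x $ i \<noteq> 0"
      then have "m \<le> i" unfolding m_def by (intro Min_le) auto
      with that show False by simp
    qed
    have "0 = (L *v x) $ m" using Lx by simp
    also have "\<dots> = (\<Sum>j\<in>UNIV. L $ m $ j * x $ j)" by (simp add: matrix_vector_mult_def)
    also have "\<dots> = (\<Sum>j\<in>{m}. L $ m $ j * x $ j)"
      by (rule sum.mono_neutral_right) (auto, metis assms(1) below neqE)
    finally show False using m assms(2) by simp
  qed
  then show ?thesis
    using invertible_left_inverse matrix_left_invertible_ker by blast
qed

lemma is_cholesky_invertible:
  "is_cholesky A L \<Longrightarrow> invertible L"
  by (rule lower_triangular_invertible) (auto simp: is_cholesky_def less_imp_neq[symmetric] dest: less_imp_neq)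

lemma is_cholesky_entry:
  assumes "is_cholesky A L"
  shows "A $ i $ j = (\<Sum>k\<in>UNIV. L $ i $ k * L $ j $ k)"
  using assms by (simp add: is_cholesky_def matrix_matrix_mult_def transpose_def)

text \<open>Column by column, the entries of the factor are determined by those to their left.\<close>

lemma is_cholesky_unique:
  fixes A L M :: "real^('d::{finite,linorder})^('d::{finite,linorder})"
  assumes M: "is_cholesky A M"
    and tri: "\<And>i j. i < j \<Longrightarrow> L $ i $ j = 0" and nonneg: "\<And>i. 0 \<le> L $ i $ i" and fac: "A = L ** transpose L"
  shows "L = M"
proof -
  have entry: "A $ i $ j = (\<Sum>k\<in>UNIV. L $ i $ k * L $ j $ k)" for i j
    by (simp add: fac matrix_matrix_mult_def transpose_def)
  have triM: "M $ i $ j = 0" if "i < j" for i j using M that by (simp add: is_cholesky_def)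
  have "\<forall>i. L $ i $ j = M $ i $ j" for j
  proof (induction "card {k. k < j}" arbitrary: j rule: less_induct)
    case less
    have left: "\<forall>i. L $ i $ k = M $ i $ k" if "k < j" for k
      using that by (intro less psubset_card_mono) auto
    \<comment> \<open>Row \<open>j\<close> of a triangular factor stops at the diagonal, so column
      \<open>j\<close> of \<open>A\<close> involves no column of the factor beyond
      \<open>j\<close>.\<close>
    have split: "A $ i $ j = (\<Sum>k | k < j. K $ i $ k * K $ j $ k) + K $ i $ j * K $ j $ j"
      if K: "\<And>i j. A $ i $ j = (\<Sum>k\<in>UNIV. K $ i $ k * K $ j $ k)" "\<And>i j. i < j \<Longrightarrow> K $ i $ j = 0" for K i
    proof -
      have "A $ i $ j = (\<Sum>k | k \<le> j. K $ i $ k * K $ j $ k)"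
        unfolding K(1) using K(2) by (intro sum.mono_neutral_right) auto
      also have "{k. k \<le> j} = insert j {k. k < j}" by auto
      finally show ?thesis by simp
    qed
    have same: "(\<Sum>k | k < j. L $ i $ k * L $ j $ k) = (\<Sum>k | k < j. M $ i $ k * M $ j $ k)" for i
      using left by (intro sum.cong) auto
    have eq: "L $ i $ j * L $ j $ j = M $ i $ j * M $ j $ j" for i
      using split[OF entry tri, of i] split[OF is_cholesky_entry[OF M] triM, of i] same[of i] by simp
    have pos: "0 < M $ j $ j" using M by (simp add: is_cholesky_def)
    \<comment> \<open>The squares agree. The diagonal of \<open>L\<close> is only known to be
      nonnegative, because this weak form is what survives in a limit of Cholesky factors.\<close>
    have "L $ j $ j = M $ j $ j"
      using eq[of j] nonneg[of j] pos by (metis power2_eq_iff_nonneg power2_eq_square less_imp_le)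
    with eq pos show ?case by simp
  qed
  then show ?thesis by (simp add: vec_eq_iff)
qed

text \<open>Bordering: indices are added in increasing order, so that a new index contributes one
  row below the others. The off-diagonal part of this row solves a triangular system, and its
  diagonal entry is the square root of a Schur complement, which positive definiteness makes
  positive.\<close>

lemma is_cholesky_exists:
  fixes A :: "real^('d::{finite,linorder})^('d::{finite,linorder})"
  assumes pd: "positive_definite A"
  shows "\<exists>L. is_cholesky A L"
proof -
  have sym: "A $ i $ j = A $ j $ i" for i j
  proof -
    have "transpose A $ j $ i = A $ j $ i" using pd by (simp add: positive_definite_def)
    then show ?thesis by (simp add: transpose_def)
  qed
  \<comment> \<open>The factor of the block indexed by \<open>S\<close>, completed by the identity off \<open>S\<close>.\<close>
  have "\<exists>L :: real^('d::{finite,linorder})^('d::{finite,linorder}). (\<forall>i j. i < j \<longrightarrow> L $ i $ j = 0) \<and> (\<forall>i. 0 < L $ i $ i)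
      \<and> (\<forall>i j. i \<noteq> j \<and> (i \<notin> S \<or> j \<notin> S) \<longrightarrow> L $ i $ j = 0)
      \<and> (\<forall>i\<in>S. \<forall>j\<in>S. A $ i $ j = (\<Sum>k\<in>UNIV. L $ i $ k * L $ j $ k))"
    if "finite S" for S :: "'d set"
    using that
  proof (induction S rule: finite_linorder_max_induct)
    case empty
    show ?case
      by (rule exI[of _ "mat 1"]) (auto simp: mat_def)
  next
    case (insert m S)
    from insert.IH obtain L :: "real^('d::{finite,linorder})^('d::{finite,linorder})" where
      L: "\<forall>i j. i < j \<longrightarrow> L $ i $ j = 0" "\<forall>i. 0 < L $ i $ i"
        "\<forall>i j. i \<noteq> j \<and> (i \<notin> S \<or> j \<notin> S) \<longrightarrow> L $ i $ j = 0"
        "\<forall>i\<in>S. \<forall>j\<in>S. A $ i $ j = (\<Sum>k\<in>UNIV. L $ i $ k * L $ j $ k)"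
      by (elim exE conjE)
    have tri: "L $ i $ j = 0" if "i < j" for i j using L(1) that by blast
    have pos: "0 < L $ i $ i" for i using L(2) by blast
    have off: "L $ i $ j = 0" if "i \<noteq> j" "i \<notin> S \<or> j \<notin> S" for i j using L(3) that by blast
    have fac: "A $ i $ j = (\<Sum>k\<in>UNIV. L $ i $ k * L $ j $ k)" if "i \<in> S" "j \<in> S" for i j
      using L(4) that by blast
    have mS: "m \<notin> S" using insert by auto
    have inv: "invertible L"
      using tri pos by (intro lower_triangular_invertible) (auto simp: less_le)
    then obtain B where B: "L ** B = mat 1" "B ** L = mat 1" by (auto simp: invertible_def)
    \<comment> \<open>\<open>a\<close> is the part of row \<open>m\<close> of \<open>A\<close> that
      has to be matched, which forces the new row \<open>r\<close> of the factor to satisfy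
      \<open>L *v r = a\<close>. Off \<open>S\<close> the matrix \<open>L\<close> is diagonal, so
      \<open>r\<close> vanishes there.\<close>
    define a :: "real^('d::{finite,linorder})" where "a = (\<chi> j. if j \<in> S then A $ m $ j else 0)"
    define r where "r = B *v a"
    have Lr: "L *v r = a" by (simp add: r_def matrix_vector_mul_assoc B)
    have r0: "r $ j = 0" if "j \<notin> S" for j
    proof -
      have "(L *v r) $ j = (\<Sum>k\<in>{j}. L $ j $ k * r $ k)"
        unfolding matrix_vector_mult_def using off[of j] that
        by (simp, intro sum.mono_neutral_right[of UNIV "{j}", simplified]) auto
      then show ?thesis using Lr that pos[of j] by (simp add: a_def)
    qed
    \<comment> \<open>Thus \<open>x\<close> solves the system with matrix
      \<open>L ** transpose L\<close> and right side \<open>a\<close>. The quadratic form of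
      \<open>A\<close> at \<open>axis m 1 - x\<close> is then exactly the Schur complement
      \<open>A $ m $ m - r \<bullet> r\<close>.\<close>
    define x where "x = transpose B *v r"
    have Ltx: "transpose L *v x = r"
      by (simp only: x_def matrix_vector_mul_assoc B matrix_transpose_mul[symmetric] transpose_mat matrix_vector_mul_lid)
    have x0: "x $ j = 0" if "j \<notin> S" for j
    proof -
      have "(transpose L *v x) $ j = (\<Sum>k\<in>{j}. L $ k $ j * x $ k)"
        unfolding matrix_vector_mult_def using off that
        by (simp add: transpose_def, intro sum.mono_neutral_right[of UNIV "{j}", simplified]) auto
      then show ?thesis using Ltx r0[OF that] pos[of j] by simp
    qed
    define v where "v = axis m 1 - x"
    have "v $ m = 1" using x0[OF mS] by (simp add: v_def)
    then have "v \<noteq> 0" by auto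
    have xA: "x \<bullet> (A *v x) = r \<bullet> r"
    proof -
      have "x \<bullet> (A *v x) = (\<Sum>i\<in>UNIV. \<Sum>j\<in>UNIV. x $ i * (A $ i $ j * x $ j))"
        by (simp add: inner_vec_def matrix_vector_mult_def sum_distrib_left)
      also have "\<dots> = (\<Sum>i\<in>UNIV. \<Sum>j\<in>UNIV. x $ i * ((L ** transpose L) $ i $ j * x $ j))"
      proof (intro sum.cong refl)
        fix i j
        show "x $ i * (A $ i $ j * x $ j) = x $ i * ((L ** transpose L) $ i $ j * x $ j)"
          by (cases "i \<in> S"; cases "j \<in> S")
            (simp_all add: x0 fac matrix_matrix_mult_def transpose_def)
      qed
      also have "\<dots> = x \<bullet> ((L ** transpose L) *v x)"
        by (simp add: inner_vec_def matrix_vector_mult_def sum_distrib_left)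
      also have "\<dots> = (transpose L *v x) \<bullet> (transpose L *v x)"
        by (simp only: dot_lmul_matrix[symmetric] matrix_vector_mul_assoc[symmetric] transpose_matrix_vector)
      finally show ?thesis by (simp only: Ltx)
    qed
    have xm: "x \<bullet> (A *v axis m 1) = r \<bullet> r" and mx: "axis m 1 \<bullet> (A *v x) = r \<bullet> r"
    proof -
      have "x \<bullet> (A *v axis m 1) = (\<Sum>i\<in>UNIV. x $ i * A $ i $ m)"
        by (simp add: inner_vec_def matrix_vector_mult_def axis_def if_distrib cong: if_cong)
      also have "\<dots> = (\<Sum>i\<in>UNIV. x $ i * a $ i)"
        by (intro sum.cong refl) (auto simp: a_def x0 sym[of m])
      also have "\<dots> = x \<bullet> (L *v r)" by (simp add: Lr inner_vec_def)
      also have "\<dots> = (transpose L *v x) \<bullet> r"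
        by (simp only: dot_lmul_matrix[symmetric] transpose_matrix_vector)
      finally show *: "x \<bullet> (A *v axis m 1) = r \<bullet> r" by (simp only: Ltx)
      have "axis m 1 \<bullet> (A *v x) = (transpose A *v axis m 1) \<bullet> x"
        by (simp only: dot_lmul_matrix[symmetric] transpose_matrix_vector)
      then show "axis m 1 \<bullet> (A *v x) = r \<bullet> r"
        unfolding conjunct1[OF pd[unfolded positive_definite_def]] using *
        by (simp only: inner_commute)
    qed
    have mm: "axis m 1 \<bullet> (A *v axis m 1) = A $ m $ m"
      by (simp add: inner_vec_def matrix_vector_mult_def axis_def if_distrib if_distribR cong: if_cong)
    have "0 < v \<bullet> (A *v v)" using pd \<open>v \<noteq> 0\<close> by (simp add: positive_definite_def)
    also have "v \<bullet> (A *v v) = A $ m $ m - r \<bullet> r"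
      by (simp add: v_def matrix_vector_mult_diff_distrib inner_diff_left inner_diff_right xA xm mx mm)
    finally have schur: "0 < A $ m $ m - r \<bullet> r" .
    define D where "D = (\<chi> i j. if i = m then (if j = m then sqrt (A $ m $ m - r \<bullet> r) else r $ j) else L $ i $ j)"
    have Dm: "(\<Sum>k\<in>UNIV. D $ m $ k * D $ j $ k) = a $ j" if "j \<in> S" for j
    proof -
      have "j \<noteq> m" using that mS by auto
      have "(\<Sum>k\<in>UNIV. D $ m $ k * D $ j $ k) = (\<Sum>k\<in>UNIV. L $ j $ k * r $ k)"
        using \<open>j \<noteq> m\<close> r0[OF mS] off[of j m] mS by (intro sum.cong) (auto simp: D_def)
      also have "\<dots> = (L *v r) $ j" by (simp add: matrix_vector_mult_def)
      finally show ?thesis by (simp add: Lr)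
    qed
    have Dmm: "(\<Sum>k\<in>UNIV. D $ m $ k * D $ m $ k) = A $ m $ m"
    proof -
      have "(\<Sum>k\<in>UNIV. D $ m $ k * D $ m $ k) =
          (\<Sum>k\<in>UNIV. r $ k * r $ k + (if k = m then A $ m $ m - r \<bullet> r else 0))"
        using schur r0[OF mS] by (intro sum.cong) (auto simp: D_def)
      then show ?thesis by (simp add: sum.distrib inner_vec_def)
    qed
    have DL: "(\<Sum>k\<in>UNIV. D $ i $ k * D $ j $ k) = A $ i $ j" if "i \<in> S" "j \<in> S" for i j
      using that mS fac[OF that] by (auto simp: D_def intro!: sum.cong)
    have swap: "(\<Sum>k\<in>UNIV. D $ i $ k * D $ j $ k) = (\<Sum>k\<in>UNIV. D $ j $ k * D $ i $ k)" for i j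
      by (simp add: mult.commute)
    show ?case
    proof (intro exI[of _ D] conjI allI impI ballI)
      show "D $ i $ j = 0" if "i < j" for i j
      proof (cases "i = m")
        case True
        then have "j \<notin> S" using that insert(2) by (auto dest: less_asym)
        then show ?thesis using True that r0[of j] by (simp add: D_def)
      qed (simp add: D_def tri that)
      show "0 < D $ i $ i" for i using schur pos by (auto simp: D_def)
      show "D $ i $ j = 0" if "i \<noteq> j \<and> (i \<notin> insert m S \<or> j \<notin> insert m S)" for i j
        using that off[of i j] r0[of j] by (auto simp: D_def)
      show "A $ i $ j = (\<Sum>k\<in>UNIV. D $ i $ k * D $ j $ k)" if "i \<in> insert m S" "j \<in> insert m S" for i j
        using that Dm Dmm DL swap[of i m] sym[of i m] by (auto simp: a_def)
    qed
  qed
  from this[of UNIV] obtain L :: "real^('d::{finite,linorder})^('d::{finite,linorder})" where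
    "\<forall>i j. i < j \<longrightarrow> L $ i $ j = 0" "\<forall>i. 0 < L $ i $ i" 
    "\<forall>i j. A $ i $ j = (\<Sum>k\<in>UNIV. L $ i $ k * L $ j $ k)" by auto
  then have "is_cholesky A L"
    by (simp add: is_cholesky_def vec_eq_iff matrix_matrix_mult_def transpose_def)
  then show ?thesis ..
qed

lemma is_cholesky_cholesky:
  "positive_definite A \<Longrightarrow> is_cholesky A (cholesky A)"
  unfolding cholesky_def
proof (rule theI')
  assume "positive_definite A"
  then obtain M where M: "is_cholesky A M" using is_cholesky_exists by blast
  then show "\<exists>!L. is_cholesky A L"
    using is_cholesky_unique[OF M] by (intro ex1I[of _ M]) (auto simp: is_cholesky_def less_imp_le)
qed

text \<open>The squared norm of the factor is the trace of the matrix, so over a compact set all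
  factors lie in one ball, and a closed graph suffices. A limit of factors is a triangular factor of
  the limit matrix with nonnegative diagonal, hence the Cholesky factor by uniqueness.\<close>

lemma continuous_on_cholesky:
  fixes A :: "real^'n \<Rightarrow> real^('d::{finite,linorder})^('d::{finite,linorder})"
  assumes S: "compact S" and cont: "continuous_on S A"
    and pd: "\<And>x. x \<in> S \<Longrightarrow> positive_definite (A x)"
  shows "continuous_on S (\<lambda>x. cholesky (A x))"
proof -
  have ch: "is_cholesky (A x) (cholesky (A x))" if "x \<in> S" for x
    using pd[OF that] by (rule is_cholesky_cholesky)
  have sq: "(norm (cholesky (A x)))\<^sup>2 = (\<Sum>i\<in>UNIV. A x $ i $ i)" if "x \<in> S" for x
    by (simp add: power2_norm_eq_inner inner_vec_def is_cholesky_entry[OF ch[OF that]])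
  have "compact ((\<lambda>x. \<Sum>i\<in>UNIV. A x $ i $ i) ` S)"
    by (intro compact_continuous_image continuous_intros cont S)
  then obtain R where R: "\<And>x. x \<in> S \<Longrightarrow> \<bar>\<Sum>i\<in>UNIV. A x $ i $ i\<bar> \<le> R"
    by (auto simp: bounded_iff dest!: compact_imp_bounded) blast
  show ?thesis
  proof (rule continuous_from_closed_graph)
    show "compact (cball 0 (sqrt R) :: (real^('d::{finite,linorder})^('d::{finite,linorder})) set)" by simp
    show "(\<lambda>x. cholesky (A x)) \<in> S \<rightarrow> cball 0 (sqrt R)"
      using sq R by (auto intro!: real_le_rsqrt) (metis abs_ge_self order_trans)
    show "closed ((\<lambda>x. (x, cholesky (A x))) ` S)"
      unfolding closed_sequential_limits
    proof (intro allI impI, elim conjE)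
      fix z and l :: "(real^'n) \<times> (real^('d::{finite,linorder})^('d::{finite,linorder}))"
      assume z: "\<forall>n. z n \<in> (\<lambda>x. (x, cholesky (A x))) ` S" and lim: "z \<longlonglongrightarrow> l"
      have zS: "fst (z n) \<in> S" and zc: "snd (z n) = cholesky (A (fst (z n)))" for n
        using z[THEN spec, of n] by auto
      obtain x L where l: "l = (x, L)" by (cases l)
      have lx: "(\<lambda>n. fst (z n)) \<longlonglongrightarrow> x" and lL: "(\<lambda>n. snd (z n)) \<longlonglongrightarrow> L"
        using tendsto_fst[OF lim] tendsto_snd[OF lim] by (simp_all add: l)
      have xS: "x \<in> S"
        by (rule closed_sequentially[OF compact_imp_closed[OF S] zS lx])
      have lA: "(\<lambda>n. A (fst (z n))) \<longlonglongrightarrow> A x"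
        using continuous_on_tendsto_compose[OF cont lx xS] zS by simp
      have chn: "is_cholesky (A (fst (z n))) (snd (z n))" for n
        using ch[OF zS] by (simp add: zc)
      have comp: "(\<lambda>n. snd (z n) $ i $ j) \<longlonglongrightarrow> L $ i $ j" for i j
        by (intro tendsto_vec_nth lL)
      have tri: "L $ i $ j = 0" if "i < j" for i j
        using comp[of i j] chn that by (simp add: is_cholesky_def LIMSEQ_const_iff)
      have nonneg: "0 \<le> L $ i $ i" for i
        using comp[of i i] chn by (intro LIMSEQ_le_const) (auto simp: is_cholesky_def less_imp_le)
      have entry: "A x $ i $ j = (\<Sum>k\<in>UNIV. L $ i $ k * L $ j $ k)" for i j
      proof (rule LIMSEQ_unique)
        show "(\<lambda>n. A (fst (z n)) $ i $ j) \<longlonglongrightarrow> A x $ i $ j" by (intro tendsto_vec_nth lA)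
        show "(\<lambda>n. A (fst (z n)) $ i $ j) \<longlonglongrightarrow> (\<Sum>k\<in>UNIV. L $ i $ k * L $ j $ k)"
          unfolding is_cholesky_entry[OF chn] by (intro tendsto_intros comp)
      qed
      have AL: "A x = L ** transpose L"
        by (simp add: vec_eq_iff entry matrix_matrix_mult_def transpose_def)
      have "L = cholesky (A x)"
        by (rule is_cholesky_unique[OF ch[OF xS] tri nonneg AL])
      then show "l \<in> (\<lambda>x. (x, cholesky (A x))) ` S" using xS l by auto
    qed
  qed
qed

section \<open>Birkhoff's ergodic theorem\<close>

locale ergodic_map = prob_space M for M :: "'a measure" +
  fixes T :: "'a \<Rightarrow> 'a"
  assumes T_measurable [measurable]: "T \<in> M \<rightarrow>\<^sub>M M"
    and T_preserves: "distr M M T = M"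
    and T_ergodic: "A \<in> sets M \<Longrightarrow> T -` A \<inter> space M = A \<Longrightarrow> measure M A = 0 \<or> measure M A = 1"
begin

section \<open>Ergodic sums and their running maxima\<close>

definition ergodic_sum :: "('a \<Rightarrow> real) \<Rightarrow> nat \<Rightarrow> 'a \<Rightarrow> real" where
  "ergodic_sum f n x = (\<Sum>k<n. f ((T ^^ k) x))"

lemma funpow_T_measurable [measurable]: "(T ^^ k) \<in> M \<rightarrow>\<^sub>M M"
  by (induction k) (auto simp: id_def)

lemma distr_funpow: "distr M M (T ^^ k) = M"
proof (induction k)
  case (Suc k)
  have "distr M M (T ^^ Suc k) = distr (distr M M (T ^^ k)) M T"
    by (subst distr_distr) (auto simp: comp_def)
  then show ?case by (simp only: Suc T_preserves)
qed (simp add: id_def distr_id)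

lemma ergodic_sum_measurable [measurable]:
  "f \<in> borel_measurable M \<Longrightarrow> ergodic_sum f n \<in> borel_measurable M"
  unfolding ergodic_sum_def[abs_def]
  by (intro borel_measurable_sum measurable_compose[OF funpow_T_measurable])

lemma ergodic_sum_Suc: "ergodic_sum f (Suc n) x = f x + ergodic_sum f n (T x)"
  unfolding ergodic_sum_def sum.lessThan_Suc_shift by (simp add: funpow_swap1)

lemma integral_comp_T: "f \<in> borel_measurable M \<Longrightarrow> (\<integral>x. f (T x) \<partial>M) = (\<integral>x. f x \<partial>M)"
  for f :: "'a \<Rightarrow> real"
  using integral_distr[OF T_measurable, of f] by (simp add: T_preserves)

lemma integrable_comp_T: "integrable M f \<Longrightarrow> integrable M (\<lambda>x. f (T x))"
  for f :: "'a \<Rightarrow> real"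
  using integrable_distr_eq[OF T_measurable, of f] by (simp add: T_preserves)

text \<open>The largest of the ergodic sums of lengths \<open>1\<close> to \<open>n + 1\<close>,
  written recursively along the orbit so that its value at \<open>x\<close> is directly comparable
  with the previous one at \<open>T x\<close>.\<close>

primrec running_max :: "('a \<Rightarrow> real) \<Rightarrow> nat \<Rightarrow> 'a \<Rightarrow> real" where
  "running_max f 0 x = f x"
| "running_max f (Suc n) x = f x + max 0 (running_max f n (T x))"

lemma running_max_integrable:
  assumes "integrable M f" shows "integrable M (running_max f n)"
proof (induction n)
  case 0 then show ?case using assms by (simp add: running_max.simps(1)[abs_def])
next
  case (Suc n)
  show ?case
    using assms integrable_comp_T[OF Suc]
    by (simp add: running_max.simps(2)[abs_def] del: running_max.simps)
qed

lemma running_max_mono: "running_max f n x \<le> running_max f (Suc n) x"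
proof (induction n arbitrary: x)
  case (Suc n)
  have "max 0 (running_max f n (T x)) \<le> max 0 (running_max f (Suc n) (T x))"
    using Suc by (rule max.mono[OF order_refl])
  then show ?case by (simp only: running_max.simps(2) add_left_mono)
qed auto

lemma ergodic_sum_le_running_max: "k \<le> n \<Longrightarrow> ergodic_sum f (Suc k) x \<le> running_max f n x"
proof (induction n arbitrary: k x)
  case 0 then show ?case by (simp add: ergodic_sum_def)
next
  case (Suc n)
  show ?case
  proof (cases k)
    case 0 then show ?thesis by (simp add: ergodic_sum_def)
  next
    case (Suc k')
    then show ?thesis
      using Suc.IH[of k' "T x"] Suc.prems
      unfolding Suc ergodic_sum_Suc[of f "Suc k'"] running_max.simps(2) by simp
  qed
qed

text \<open>If the sums were unbounded above almost surely, the running maxima would tend to infinity, so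
  that their increments along \<^term>\<open>T\<close> would decrease to \<^term>\<open>f\<close>, although these increments
  have nonnegative integrals.\<close>

lemma AE_ergodic_sum_bounded:
  assumes f: "integrable M f" and neg: "(\<integral>x. f x \<partial>M) < 0"
  shows "AE x in M. \<exists>B::nat. \<forall>n. ergodic_sum f n x \<le> real B"
proof -
  have [measurable]: "f \<in> borel_measurable M" using f by auto
  define A where "A = {x \<in> space M. \<forall>B::nat. \<exists>n. real B < ergodic_sum f n x}"
  have A [measurable]: "A \<in> sets M" unfolding A_def by measurable
  \<comment> \<open>The sums at \<open>x\<close> and at \<open>T x\<close> differ by the single term
    \<open>f x\<close> and a shift of the length, so unboundedness is an invariant property.\<close>
  have TA: "T x \<in> A \<longleftrightarrow> x \<in> A" if x: "x \<in> space M" for x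
  proof
    assume TxA: "T x \<in> A"
    have "\<exists>n. real B < ergodic_sum f n x" for B
    proof -
      obtain C :: nat where C: "real B - f x \<le> real C" using real_arch_simple by blast
      from TxA obtain n where "real C < ergodic_sum f n (T x)" unfolding A_def by blast
      with C have "real B < ergodic_sum f (Suc n) x" by (simp add: ergodic_sum_Suc)
      then show ?thesis ..
    qed
    then show "x \<in> A" using x by (simp add: A_def)
  next
    assume xA: "x \<in> A"
    have "\<exists>n. real B < ergodic_sum f n (T x)" for B
    proof -
      obtain C :: nat where C: "max (real B + f x) 0 \<le> real C" using real_arch_simple by blast
      from xA obtain n where n: "real C < ergodic_sum f n x" unfolding A_def by blast
      with C have "n \<noteq> 0" by (auto simp: ergodic_sum_def intro!: gr0I)
      then obtain m where "n = Suc m" by (cases n) auto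
      with n C have "real B < ergodic_sum f m (T x)" by (simp add: ergodic_sum_Suc)
      then show ?thesis ..
    qed
    then show "T x \<in> A" using measurable_space[OF T_measurable x] by (simp add: A_def)
  qed
  have "T -` A \<inter> space M = A"
    using TA by (auto simp: A_def)
  then consider "measure M A = 0" | "measure M A = 1" using T_ergodic[OF A] by blast
  then show ?thesis
  proof cases
    case 1
    then have "AE x in M. x \<notin> A" using A by (simp add: prob_eq_0)
    then show ?thesis
      using AE_space by eventually_elim (auto simp: A_def not_less)
  next
    case 2
    then have AEA: "AE x in M. x \<in> A" using A prob_eq_1 by blast
    \<comment> \<open>This is \<open>running_max f (Suc n) x - running_max f n (T x)\<close>, since
      \<open>max 0 r - r = max 0 (- r)\<close>.\<close>
    let ?g = "\<lambda>n x. f x + max 0 (- running_max f n (T x))"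
    note rmi = running_max_integrable[OF f]
    have lim: "(\<lambda>n. \<integral>x. ?g n x \<partial>M) \<longlonglongrightarrow> (\<integral>x. f x \<partial>M)"
    proof (rule integral_dominated_convergence[where w = "\<lambda>x. \<bar>f x\<bar> + \<bar>f (T x)\<bar>"])
      show "AE x in M. (\<lambda>n. ?g n x) \<longlonglongrightarrow> f x"
        using AEA AE_space
      proof eventually_elim
        case (elim x)
        then have "T x \<in> A" using TA by blast
        then have "\<exists>n. real 0 < ergodic_sum f n (T x)" unfolding A_def by blast
        then obtain n where n: "0 < ergodic_sum f n (T x)" by auto
        then obtain k where k: "n = Suc k" by (cases n) (auto simp: ergodic_sum_def)
        have "?g m x = f x" if "m \<ge> k" for m
          using ergodic_sum_le_running_max[OF that, of f "T x"] n k by simp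
        then show ?case by (intro tendsto_eventually) (auto simp: eventually_sequentially)
      qed
      show "AE x in M. norm (?g n x) \<le> \<bar>f x\<bar> + \<bar>f (T x)\<bar>" for n
      proof (rule AE_I2)
        fix x
        have "running_max f 0 (T x) \<le> running_max f n (T x)"
          by (rule lift_Suc_mono_le[of "\<lambda>n. running_max f n (T x)"]) (rule running_max_mono, simp)
        then have "- running_max f n (T x) \<le> \<bar>f (T x)\<bar>" by simp
        then show "norm (?g n x) \<le> \<bar>f x\<bar> + \<bar>f (T x)\<bar>" unfolding max_def real_norm_def by (auto split: if_splits)
      qed
    qed (use f rmi in \<open>auto intro!: integrable_comp_T\<close>)
    \<comment> \<open>Invariance of the measure replaces \<open>T x\<close> by \<open>x\<close> in
      the second term of the increment, and what remains is the growth of the running maximum from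
      \<open>n\<close> to \<open>n + 1\<close>.\<close>
    have "0 \<le> (\<integral>x. ?g n x \<partial>M)" for n
    proof -
      have "0 \<le> (\<integral>x. running_max f (Suc n) x - running_max f n x \<partial>M)"
        using running_max_mono[of f n] by (intro integral_nonneg_AE) auto
      also have "\<dots> = (\<integral>x. running_max f (Suc n) x \<partial>M) - (\<integral>x. running_max f n (T x) \<partial>M)"
        using rmi by (subst Bochner_Integration.integral_diff) (auto simp: integral_comp_T)
      also have "\<dots> = (\<integral>x. running_max f (Suc n) x - running_max f n (T x) \<partial>M)"
        using rmi by (subst Bochner_Integration.integral_diff) (auto intro: integrable_comp_T)
      also have "\<dots> = (\<integral>x. ?g n x \<partial>M)"
        by (intro Bochner_Integration.integral_cong) (auto simp: max_def)
      finally show ?thesis .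
    qed
    then have "0 \<le> (\<integral>x. f x \<partial>M)"
      by (intro LIMSEQ_le_const[OF lim]) auto
    with neg show ?thesis by simp
  qed
qed

text \<open>Subtracting slightly more than the mean makes the integral strictly negative, so the
  sums stay bounded. Half of \<open>e\<close> pays for this centring, the other half for the bound
  divided by \<open>n\<close>.\<close>

lemma AE_ergodic_average_le:
  assumes f: "integrable M f" and e: "0 < e"
  shows "AE x in M. \<forall>\<^sub>F n in sequentially. ergodic_sum f n x / real n \<le> (\<integral>x. f x \<partial>M) + e"
proof -
  let ?c = "(\<integral>x. f x \<partial>M) + e / 2"
  have "(\<integral>x. f x - ?c \<partial>M) < 0" using f e by (simp add: prob_space)
  then have "AE x in M. \<exists>B::nat. \<forall>n. ergodic_sum (\<lambda>x. f x - ?c) n x \<le> real B"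
    using f by (intro AE_ergodic_sum_bounded) auto
  then show ?thesis
  proof eventually_elim
    case (elim x)
    then obtain B :: nat where B: "\<And>n. ergodic_sum f n x - real n * ?c \<le> real B"
      by (auto simp: ergodic_sum_def sum_subtractf)
    have "(\<lambda>n. real B / real n) \<longlonglongrightarrow> 0" by (rule lim_const_over_n)
    then have "\<forall>\<^sub>F n in sequentially. real B / real n < e / 2"
      using e by (intro order_tendstoD) auto
    then show ?case using eventually_gt_at_top[of 0]
    proof eventually_elim
      case (elim n)
      have "ergodic_sum f n x / real n \<le> (real B + real n * ?c) / real n"
        using B[of n] by (intro divide_right_mono) auto
      also have "\<dots> = real B / real n + ?c" using elim by (simp add: field_simps)
      finally show ?case using elim(1) field_sum_of_halves[of e] by linarith
    qed
  qed
qed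

theorem AE_ergodic_average:
  assumes f: "integrable M f"
  shows "AE x in M. (\<lambda>n. ergodic_sum f n x / real n) \<longlonglongrightarrow> (\<integral>x. f x \<partial>M)"
proof -
  \<comment> \<open>Countably many tolerances keep the union of the exceptional sets null; the lower
    bound is the upper bound for \<open>- f\<close>.\<close>
  have "AE x in M. \<forall>m. \<forall>\<^sub>F n in sequentially.
      ergodic_sum f n x / real n \<le> (\<integral>x. f x \<partial>M) + 1 / real (Suc m)"
    by (intro AE_all_countable[THEN iffD2] allI AE_ergodic_average_le f) auto
  moreover have "AE x in M. \<forall>m. \<forall>\<^sub>F n in sequentially.
      ergodic_sum (\<lambda>x. - f x) n x / real n \<le> (\<integral>x. - f x \<partial>M) + 1 / real (Suc m)"
    using f by (intro AE_all_countable[THEN iffD2] allI AE_ergodic_average_le) auto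
  ultimately show ?thesis
  proof eventually_elim
    case (elim x)
    show ?case
    proof (rule LIMSEQ_I)
      fix r :: real assume "0 < r"
      then obtain m where m: "1 / real (Suc m) < r" by (metis nat_approx_posE)
      have "\<forall>\<^sub>F n in sequentially. norm (ergodic_sum f n x / real n - (\<integral>x. f x \<partial>M)) < r"
        using elim(1)[THEN spec, of m] elim(2)[THEN spec, of m]
      proof eventually_elim
        case (elim n)
        then show ?case using m by (simp add: ergodic_sum_def sum_negf abs_less_iff)
      qed
      then show "\<exists>no. \<forall>n\<ge>no. norm (ergodic_sum f n x / real n - (\<integral>x. f x \<partial>M)) < r"
        by (simp add: eventually_sequentially)
    qed
  qed
qed

end

section \<open>Convergence in probability\<close>

context prob_space
begin

lemma tendsto_in_probability_AE:
  fixes X :: "nat \<Rightarrow> 'a \<Rightarrow> 'b::{metric_space, second_countable_topology}"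
  assumes X [measurable]: "\<And>n. X n \<in> borel_measurable M"
    and lim: "AE w in M. (\<lambda>n. X n w) \<longlonglongrightarrow> c"
  shows "tendsto_in_probability M X c"
  unfolding tendsto_in_probability_def
proof (intro conjI allI impI)
  fix e :: real assume e: "0 < e"
  have [measurable]: "{w \<in> space M. dist (X n w) c > e} \<in> sets M" for n by measurable
  have "(\<lambda>n. \<integral>w. indicator {w \<in> space M. dist (X n w) c > e} w \<partial>M) \<longlonglongrightarrow> (\<integral>w. 0 \<partial>M :: real)"
  proof (rule integral_dominated_convergence[where w = "\<lambda>_. 1"])
    show "AE w in M. (\<lambda>n. indicator {w \<in> space M. dist (X n w) c > e} w :: real) \<longlonglongrightarrow> 0"
      using lim
    proof eventually_elim
      case (elim w)
      have "\<forall>\<^sub>F n in sequentially. dist (X n w) c < e" using tendstoD[OF elim e] .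
      then show ?case
        by (intro tendsto_eventually) (auto elim!: eventually_mono simp: indicator_def)
    qed
  qed (auto simp: indicator_def)
  then show "(\<lambda>n. measure M {w \<in> space M. dist (X n w) c > e}) \<longlonglongrightarrow> 0"
    by simp
qed (rule X)

lemma tendsto_in_probability_bound:
  fixes X :: "nat \<Rightarrow> 'a \<Rightarrow> 'b::{metric_space, second_countable_topology}"
  assumes X [measurable]: "\<And>n. X n \<in> borel_measurable M"
    and lim: "\<And>e. 0 < e \<Longrightarrow> \<exists>b. b \<longlonglongrightarrow> 0 \<and> (\<forall>n. measure M {w \<in> space M. dist (X n w) c > e} \<le> b n)"
  shows "tendsto_in_probability M X c"
  unfolding tendsto_in_probability_def
proof (intro conjI allI impI)
  fix e :: real assume "0 < e"
  then obtain b where "b \<longlonglongrightarrow> 0" "\<And>n. measure M {w \<in> space M. dist (X n w) c > e} \<le> b n"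
    using lim by blast
  then show "(\<lambda>n. measure M {w \<in> space M. dist (X n w) c > e}) \<longlonglongrightarrow> 0"
    using Lim_null_comparison[OF always_eventually[OF allI], of "\<lambda>n. measure M {w \<in> space M. dist (X n w) c > e}" b]
    by simp
qed (rule X)

text \<open>Markov's inequality. The hypothesis uses the nonnegative integral because a Bochner
  integral is 0 by default for a function that is not integrable.\<close>

lemma tendsto_in_probability_L1:
  fixes X :: "nat \<Rightarrow> 'a \<Rightarrow> 'b::{metric_space, second_countable_topology}"
  assumes X [measurable]: "\<And>n. X n \<in> borel_measurable M"
    and lim: "(\<lambda>n. \<integral>\<^sup>+w. ennreal (dist (X n w) c) \<partial>M) \<longlonglongrightarrow> 0"
  shows "tendsto_in_probability M X c"
  unfolding tendsto_in_probability_def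
proof (intro conjI allI impI)
  fix e :: real assume e: "0 < e"
  have le: "emeasure M {w \<in> space M. dist (X n w) c > e} \<le> ennreal (1/e) * (\<integral>\<^sup>+w. ennreal (dist (X n w) c) \<partial>M)" for n
  proof -
    have "emeasure M {w \<in> space M. dist (X n w) c > e} \<le>
        emeasure M ({w \<in> space M. 1 \<le> ennreal (1/e) * ennreal (dist (X n w) c)} \<inter> space M)"
      using e by (intro emeasure_mono) (auto simp: ennreal_mult[symmetric] ennreal_1[symmetric] simp del: ennreal_1)
    also have "\<dots> \<le> ennreal (1/e) * (\<integral>\<^sup>+w. ennreal (dist (X n w) c) * indicator (space M) w \<partial>M)"
      by (intro order_trans[OF _ nn_integral_Markov_inequality]) (auto intro!: emeasure_mono)
    also have "(\<integral>\<^sup>+w. ennreal (dist (X n w) c) * indicator (space M) w \<partial>M) = (\<integral>\<^sup>+w. ennreal (dist (X n w) c) \<partial>M)"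
      by (intro nn_integral_cong) auto
    finally show ?thesis .
  qed
  have bound: "(\<lambda>n. ennreal (1/e) * (\<integral>\<^sup>+w. ennreal (dist (X n w) c) \<partial>M)) \<longlonglongrightarrow> 0"
    using ennreal_tendsto_cmult[OF _ lim, of "ennreal (1/e)"] by simp
  have "(\<lambda>n. emeasure M {w \<in> space M. dist (X n w) c > e}) \<longlonglongrightarrow> ennreal 0"
    using tendsto_sandwich[OF always_eventually[OF allI] always_eventually[OF allI] tendsto_const bound,
        of "\<lambda>n. emeasure M {w \<in> space M. dist (X n w) c > e}"] le
    by simp
  then show "(\<lambda>n. measure M {w \<in> space M. dist (X n w) c > e}) \<longlonglongrightarrow> 0"
    unfolding emeasure_eq_measure by (subst (asm) tendsto_ennreal_iff) auto
qed (rule X)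

lemma tendsto_in_probability_Pair:
  fixes X :: "nat \<Rightarrow> 'a \<Rightarrow> 'b::{metric_space, second_countable_topology}"
    and Y :: "nat \<Rightarrow> 'a \<Rightarrow> 'c::{metric_space, second_countable_topology}"
  assumes X: "tendsto_in_probability M X a" and Y: "tendsto_in_probability M Y b"
  shows "tendsto_in_probability M (\<lambda>n w. (X n w, Y n w)) (a, b)"
proof -
  have [measurable]: "X n \<in> borel_measurable M" "Y n \<in> borel_measurable M" for n
    using X Y by (auto simp: tendsto_in_probability_def)
  show ?thesis
  proof (rule tendsto_in_probability_bound)
    fix e :: real assume e: "0 < e"
    let ?A = "\<lambda>n. {w \<in> space M. dist (X n w) a > e/2}" and ?B = "\<lambda>n. {w \<in> space M. dist (Y n w) b > e/2}"
    have "(\<lambda>n. measure M (?A n) + measure M (?B n)) \<longlonglongrightarrow> 0 + 0"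
      using X Y half_gt_zero[OF e] unfolding tendsto_in_probability_def by (intro tendsto_add) blast+
    moreover have "measure M {w \<in> space M. dist (X n w, Y n w) (a, b) > e} \<le> measure M (?A n) + measure M (?B n)" for n
    proof -
      have "dist (X n w, Y n w) (a, b) \<le> dist (X n w) a + dist (Y n w) b" for w
        by (simp add: dist_Pair_Pair sqrt_sum_squares_le_sum)
      then have "e < dist (X n w) a + dist (Y n w) b" if "e < dist (X n w, Y n w) (a, b)" for w
        using that by (rule less_le_trans[rotated])
      then have "{w \<in> space M. dist (X n w, Y n w) (a, b) > e} \<subseteq> ?A n \<union> ?B n"
        by force
      then have "measure M {w \<in> space M. dist (X n w, Y n w) (a, b) > e} \<le> measure M (?A n \<union> ?B n)"
        by (intro finite_measure_mono) auto
      also have "\<dots> \<le> measure M (?A n) + measure M (?B n)"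
        by (intro measure_Un_le) auto
      finally show ?thesis .
    qed
    ultimately show "\<exists>r. r \<longlonglongrightarrow> 0 \<and> (\<forall>n. measure M {w \<in> space M. dist (X n w, Y n w) (a, b) > e} \<le> r n)"
      by (intro exI[of _ "\<lambda>n. measure M (?A n) + measure M (?B n)"]) auto
  qed measurable
qed

lemma tendsto_in_probability_continuous:
  fixes X :: "nat \<Rightarrow> 'a \<Rightarrow> 'b::{metric_space, second_countable_topology}"
    and f :: "'b \<Rightarrow> 'c::{metric_space, second_countable_topology}"
  assumes X: "tendsto_in_probability M X a" and XS: "\<And>n w. w \<in> space M \<Longrightarrow> X n w \<in> S" and a: "a \<in> S"
    and f: "continuous_on S f"
  shows "tendsto_in_probability M (\<lambda>n w. f (X n w)) (f a)"
proof (rule tendsto_in_probability_bound)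
  have Xm [measurable]: "X n \<in> borel_measurable M" for n
    using X by (auto simp: tendsto_in_probability_def)
  \<comment> \<open>Continuity of \<open>f\<close> is assumed on \<open>S\<close> only, so
    measurability of the composition requires \<open>S\<close> as the range space.\<close>
  have "X n \<in> M \<rightarrow>\<^sub>M restrict_space borel S" for n
    using XS Xm by (intro measurable_restrict_space2) auto
  then show fX [measurable]: "(\<lambda>w. f (X n w)) \<in> borel_measurable M" for n
    by (rule measurable_compose[OF _ borel_measurable_continuous_on_restrict[OF f]])
  fix e :: real assume e: "0 < e"
  then obtain d where d: "0 < d" "\<And>x. x \<in> S \<Longrightarrow> dist x a < d \<Longrightarrow> dist (f x) (f a) < e"
    using f a unfolding continuous_on_iff by metis
  have "measure M {w \<in> space M. dist (f (X n w)) (f a) > e} \<le> measure M {w \<in> space M. dist (X n w) a > d/2}" for n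
  proof (intro finite_measure_mono subsetI)
    fix w assume "w \<in> {w \<in> space M. dist (f (X n w)) (f a) > e}"
    then show "w \<in> {w \<in> space M. dist (X n w) a > d/2}"
      using d(1) d(2)[OF XS, of w n] by (cases "dist (X n w) a < d") auto
  qed measurable
  moreover have "(\<lambda>n. measure M {w \<in> space M. dist (X n w) a > d/2}) \<longlonglongrightarrow> 0"
    using X half_gt_zero[OF d(1)] unfolding tendsto_in_probability_def by blast
  ultimately show "\<exists>b. b \<longlonglongrightarrow> 0 \<and> (\<forall>n. measure M {w \<in> space M. dist (f (X n w)) (f a) > e} \<le> b n)"
    by blast
qed

lemma tendsto_in_probability_add:
  fixes X Y :: "nat \<Rightarrow> 'a \<Rightarrow> 'b::{real_normed_vector, second_countable_topology}"
  assumes X: "tendsto_in_probability M X a" and Y: "tendsto_in_probability M Y b"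
  shows "tendsto_in_probability M (\<lambda>n w. X n w + Y n w) (a + b)"
proof -
  have [measurable]: "X n \<in> borel_measurable M" "Y n \<in> borel_measurable M" for n
    using X Y by (auto simp: tendsto_in_probability_def)
  show ?thesis
    using tendsto_in_probability_continuous[OF tendsto_in_probability_Pair[OF X Y], of UNIV "\<lambda>(x, y). x + y"]
    by (simp add: split_beta continuous_on_add continuous_on_fst continuous_on_snd)
qed

end

section \<open>Random parameters\<close>

text \<open>Ordinary simple approximations may leave \<open>S\<close>, where nothing is known about
  the parameter. The nearest-point projection onto a closed convex set is continuous and fixes
  \<open>S\<close>, so composing with it repairs this without losing the limit.\<close>

lemma simple_function_approximation_in:
  fixes X :: "'a \<Rightarrow> 'v::euclidean_space"
  assumes X: "X \<in> borel_measurable N" and S: "closed S" "convex S" "S \<noteq> {}"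
    and XS: "\<And>w. w \<in> space N \<Longrightarrow> X w \<in> S"
  obtains U where "\<And>m::nat. simple_function N (U m)"
    and "\<And>m w. U m w \<in> S"
    and "\<And>w. w \<in> space N \<Longrightarrow> (\<lambda>m. U m w) \<longlonglongrightarrow> X w"
proof -
  obtain V where V: "\<And>m::nat. simple_function N (V m)"
    "\<And>w. w \<in> space N \<Longrightarrow> (\<lambda>m. V m w) \<longlonglongrightarrow> X w"
    using borel_measurable_implies_sequence_metric[OF X] by metis
  show thesis
  proof (rule that[of "\<lambda>m w. closest_point S (V m w)"])
    show "simple_function N (\<lambda>w. closest_point S (V m w))" for m
      using simple_function_compose1[OF V(1)] .
    show "closest_point S (V m w) \<in> S" for m w
      using S by (intro closest_point_in_set) auto
    show "(\<lambda>m. closest_point S (V m w)) \<longlonglongrightarrow> X w" if "w \<in> space N" for w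
    proof -
      have "isCont (closest_point S) (X w)" by (rule continuous_at_closest_point[OF S(2,1,3)])
      then have "(\<lambda>m. closest_point S (V m w)) \<longlonglongrightarrow> closest_point S (X w)"
        using V(2)[OF that] by (rule isCont_tendsto_compose)
      then show ?thesis using closest_point_self[OF XS[OF that]] by simp
    qed
  qed
qed

lemma simple_random_parameter_measurable:
  fixes G :: "'v \<Rightarrow> 'a \<Rightarrow> 'c::topological_space"
  assumes U: "simple_function N U" and US: "\<And>w. U w \<in> S"
    and G: "\<And>t. t \<in> S \<Longrightarrow> G t \<in> borel_measurable N"
  shows "(\<lambda>w. G (U w) w) \<in> borel_measurable N"
proof (rule measurable_compose_countable'[where I = "U ` space N" and g = U and f = G])
  show "U \<in> N \<rightarrow>\<^sub>M count_space (U ` space N)"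
    using simple_functionD[OF U] by (auto simp: measurable_count_space_eq2)
qed (use US simple_functionD(1)[OF U] in \<open>auto intro!: G countable_finite\<close>)

text \<open>A function measurable in the outcome and continuous in the parameter (a Caratheodory
  function) is a pointwise limit of its evaluations at simple parameters.\<close>

lemma random_parameter_measurable:
  fixes G :: "'v::euclidean_space \<Rightarrow> 'a \<Rightarrow> 'c::metric_space"
  assumes X: "X \<in> borel_measurable N" and S: "closed S" "convex S" "S \<noteq> {}"
    and XS: "\<And>w. w \<in> space N \<Longrightarrow> X w \<in> S"
    and G: "\<And>t. t \<in> S \<Longrightarrow> G t \<in> borel_measurable N"
    and cont: "\<And>w. w \<in> space N \<Longrightarrow> continuous_on S (\<lambda>t. G t w)"
  shows "(\<lambda>w. G (X w) w) \<in> borel_measurable N"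
proof -
  obtain U where U: "\<And>m::nat. simple_function N (U m)" "\<And>m w. U m w \<in> S"
    "\<And>w. w \<in> space N \<Longrightarrow> (\<lambda>m. U m w) \<longlonglongrightarrow> X w"
    using simple_function_approximation_in[OF X S XS] by blast
  show ?thesis
  proof (rule borel_measurable_LIMSEQ_metric)
    show "(\<lambda>w. G (U m w) w) \<in> borel_measurable N" for m
      by (rule simple_random_parameter_measurable[where S = S]) (use U G in auto)
    show "(\<lambda>m. G (U m w) w) \<longlonglongrightarrow> G (X w) w" if "w \<in> space N" for w
      by (rule continuous_on_tendsto_compose[OF cont[OF that] U(3)[OF that] XS[OF that]]) (use U in auto)
  qed
qed

text \<open>Replacing a fixed parameter by one that is measurable with respect to the conditioning
  \<open>\<sigma>\<close>-algebra \<open>N\<close> is trivial for simple functions; the general case follows by Fatou's lemma.\<close>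

lemma (in prob_space) nn_integral_random_parameter_le:
  fixes G :: "'v::euclidean_space \<Rightarrow> 'a \<Rightarrow> real" and c :: "'v \<Rightarrow> real"
  assumes N: "subalgebra M N" and X: "X \<in> borel_measurable N" and S: "compact S" "convex S"
    and XS: "\<And>w. w \<in> space M \<Longrightarrow> X w \<in> S"
    and G: "\<And>t. t \<in> S \<Longrightarrow> G t \<in> borel_measurable M"
    and cont: "\<And>w. w \<in> space M \<Longrightarrow> continuous_on S (\<lambda>t. G t w)"
    and c: "continuous_on S c"
    and le: "\<And>t A. t \<in> S \<Longrightarrow> A \<in> sets N \<Longrightarrow> (\<integral>\<^sup>+w\<in>A. ennreal (G t w) \<partial>M) \<le> ennreal (c t) * emeasure M A"
  shows "(\<integral>\<^sup>+w. ennreal (G (X w) w) \<partial>M) \<le> (\<integral>\<^sup>+w. ennreal (c (X w)) \<partial>M)"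
proof -
  have sp: "space N = space M" and sets: "sets N \<subseteq> sets M" using N by (auto simp: subalgebra_def)
  have ne: "S \<noteq> {}" using XS not_empty by blast
  have cl: "closed S" using S by (simp add: compact_imp_closed)
  obtain U where U: "\<And>m::nat. simple_function N (U m)" "\<And>m w. U m w \<in> S"
    "\<And>w. w \<in> space M \<Longrightarrow> (\<lambda>m. U m w) \<longlonglongrightarrow> X w"
    using simple_function_approximation_in[OF X cl S(2) ne] XS unfolding sp by blast
  have UM: "simple_function M (U m)" for m
    using U(1)[of m] sets by (auto simp: simple_function_def sp)
  \<comment> \<open>The sets on which \<open>U m\<close> is constant belong to \<open>N\<close>, so
    the hypothesis applies to each of them with a fixed parameter.\<close>
  have step: "(\<integral>\<^sup>+w. ennreal (G (U m w) w) \<partial>M) \<le> (\<integral>\<^sup>+w. ennreal (c (U m w)) \<partial>M)" for m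
  proof -
    let ?V = "U m ` space M" and ?A = "\<lambda>t. U m -` {t} \<inter> space M"
    have fin: "finite ?V" using UM by (simp add: simple_function_def)
    have AN: "?A t \<in> sets N" for t using simple_functionD(2)[OF U(1), of m "{t}"] by (simp add: sp)
    have AM [measurable]: "?A t \<in> sets M" for t using AN sets by blast
    have split: "(\<integral>\<^sup>+w. H (U m w) w \<partial>M) = (\<Sum>t\<in>?V. \<integral>\<^sup>+w\<in>?A t. H t w \<partial>M)"
      if H: "\<And>t. t \<in> S \<Longrightarrow> H t \<in> borel_measurable M" for H :: "'v \<Rightarrow> 'a \<Rightarrow> ennreal"
    proof -
      have "(\<integral>\<^sup>+w. H (U m w) w \<partial>M) = (\<integral>\<^sup>+w. (\<Sum>t\<in>?V. H t w * indicator (?A t) w) \<partial>M)"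
      proof (rule nn_integral_cong)
        fix w assume w: "w \<in> space M"
        have "(\<Sum>t\<in>?V. H t w * indicator (?A t) w) = (\<Sum>t\<in>{U m w}. H t w * indicator (?A t) w)"
          using w fin by (intro sum.mono_neutral_right) auto
        then show "H (U m w) w = (\<Sum>t\<in>?V. H t w * indicator (?A t) w)" using w by simp
      qed
      also have "\<dots> = (\<Sum>t\<in>?V. \<integral>\<^sup>+w\<in>?A t. H t w \<partial>M)"
        using U(2) H by (intro nn_integral_sum) (auto intro!: borel_measurable_times_ennreal borel_measurable_indicator)
      finally show ?thesis .
    qed
    have "(\<integral>\<^sup>+w. ennreal (G (U m w) w) \<partial>M) = (\<Sum>t\<in>?V. \<integral>\<^sup>+w\<in>?A t. ennreal (G t w) \<partial>M)"
      using G by (intro split[of "\<lambda>t w. ennreal (G t w)"]) auto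
    also have "\<dots> \<le> (\<Sum>t\<in>?V. ennreal (c t) * emeasure M (?A t))"
      using U(2) AN by (intro sum_mono le) auto
    also have "\<dots> = (\<Sum>t\<in>?V. \<integral>\<^sup>+w\<in>?A t. ennreal (c t) \<partial>M)"
      by (simp add: nn_integral_cmult_indicator)
    also have "\<dots> = (\<integral>\<^sup>+w. ennreal (c (U m w)) \<partial>M)"
      by (intro split[of "\<lambda>t w. ennreal (c t)", symmetric]) auto
    finally show ?thesis .
  qed
  \<comment> \<open>On the right, boundedness of \<open>c\<close> on the compact set permits
    dominated convergence. On the left no dominating function is available, which is why Fatou is
    used there.\<close>
  have "bounded (c ` S)" by (intro compact_imp_bounded compact_continuous_image c S)
  then obtain B where B: "\<And>t. t \<in> S \<Longrightarrow> \<bar>c t\<bar> \<le> B" by (auto simp: bounded_iff)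
  have Umeas: "(\<lambda>w. ennreal (G (U m w) w)) \<in> borel_measurable M" 
    "(\<lambda>w. ennreal (c (U m w))) \<in> borel_measurable M" for m
    using simple_random_parameter_measurable[OF UM, of m S G] U G
      simple_random_parameter_measurable[OF UM, of m S "\<lambda>t _. c t"] by auto
  have XM: "X \<in> borel_measurable M" using X N by (rule measurable_from_subalg[rotated])
  have "(\<integral>\<^sup>+w. ennreal (G (X w) w) \<partial>M) = (\<integral>\<^sup>+w. liminf (\<lambda>m. ennreal (G (U m w) w)) \<partial>M)"
  proof (rule nn_integral_cong)
    fix w assume w: "w \<in> space M"
    have "(\<lambda>m. G (U m w) w) \<longlonglongrightarrow> G (X w) w"
      by (rule continuous_on_tendsto_compose[OF cont[OF w] U(3)[OF w] XS[OF w]]) (use U in auto)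
    then have "(\<lambda>m. ennreal (G (U m w) w)) \<longlonglongrightarrow> ennreal (G (X w) w)" by (rule tendsto_ennrealI)
    then show "ennreal (G (X w) w) = liminf (\<lambda>m. ennreal (G (U m w) w))"
      by (simp add: lim_imp_Liminf)
  qed
  also have "\<dots> \<le> liminf (\<lambda>m. \<integral>\<^sup>+w. ennreal (G (U m w) w) \<partial>M)"
    by (rule nn_integral_liminf) (rule Umeas)
  also have "\<dots> \<le> liminf (\<lambda>m. \<integral>\<^sup>+w. ennreal (c (U m w)) \<partial>M)"
    by (intro Liminf_mono always_eventually allI step)
  also have "\<dots> = (\<integral>\<^sup>+w. ennreal (c (X w)) \<partial>M)"
  proof (intro lim_imp_Liminf trivial_limit_sequentially nn_integral_dominated_convergence[where w = "\<lambda>_. ennreal B"])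
    show "(\<lambda>w. ennreal (c (X w))) \<in> borel_measurable M"
      using random_parameter_measurable[OF XM cl S(2) ne XS, of "\<lambda>t _. c t"] c by auto
    show "AE w in M. ennreal (c (U m w)) \<le> ennreal B" for m
      using B U(2) by (intro AE_I2 ennreal_leI) (meson abs_le_D1)
    show "AE w in M. (\<lambda>m. ennreal (c (U m w))) \<longlonglongrightarrow> ennreal (c (X w))"
      by (intro AE_I2 tendsto_ennrealI continuous_on_tendsto_compose[OF c U(3) XS]) (use U in auto)
  qed (auto simp: Umeas emeasure_space_1)
  finally show ?thesis .
qed

text \<open>The signed counterpart stays with simple parameters, because Fatou does not apply to
  integrands of varying sign. The limit is taken in \<open>score_drift_le\<close>, by L1 continuity
  of the score.\<close>

lemma (in prob_space) integral_simple_random_parameter_le: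
  fixes G :: "'v \<Rightarrow> 'a \<Rightarrow> real" and c :: "'v \<Rightarrow> real"
  assumes N: "subalgebra M N" and U: "simple_function N U" and US: "\<And>w. U w \<in> S"
    and G: "\<And>t. t \<in> S \<Longrightarrow> integrable M (G t)"
    and le: "\<And>t A. t \<in> S \<Longrightarrow> A \<in> sets N \<Longrightarrow> (\<integral>w\<in>A. G t w \<partial>M) \<le> c t * measure M A"
  shows "(\<integral>w. G (U w) w \<partial>M) \<le> (\<integral>w. c (U w) \<partial>M)"
proof -
  have sp: "space N = space M" and sets: "sets N \<subseteq> sets M" using N by (auto simp: subalgebra_def)
  let ?V = "U ` space M" and ?A = "\<lambda>t. U -` {t} \<inter> space M"
  have fin: "finite ?V" using U by (simp add: simple_function_def sp)
  have AN: "?A t \<in> sets N" for t using simple_functionD(2)[OF U, of "{t}"] by (simp add: sp)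
  have AM [measurable]: "?A t \<in> sets M" for t using AN sets by blast
  have split: "(\<integral>w. H (U w) w \<partial>M) = (\<Sum>t\<in>?V. \<integral>w\<in>?A t. H t w \<partial>M)"
    if H: "\<And>t. t \<in> S \<Longrightarrow> integrable M (H t)" for H :: "'v \<Rightarrow> 'a \<Rightarrow> real"
  proof -
    have "(\<integral>w. H (U w) w \<partial>M) = (\<integral>w. (\<Sum>t\<in>?V. indicator (?A t) w *\<^sub>R H t w) \<partial>M)"
    proof (rule Bochner_Integration.integral_cong[OF refl])
      fix w assume w: "w \<in> space M"
      have "(\<Sum>t\<in>?V. indicator (?A t) w *\<^sub>R H t w) = (\<Sum>t\<in>{U w}. indicator (?A t) w *\<^sub>R H t w)"
        using w fin by (intro sum.mono_neutral_right) auto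
      then show "H (U w) w = (\<Sum>t\<in>?V. indicator (?A t) w *\<^sub>R H t w)" using w by simp
    qed
    also have "\<dots> = (\<Sum>t\<in>?V. \<integral>w\<in>?A t. H t w \<partial>M)"
      unfolding set_lebesgue_integral_def
      using US by (intro Bochner_Integration.integral_sum integrable_mult_indicator H AM) auto
    finally show ?thesis .
  qed
  have "(\<integral>w. G (U w) w \<partial>M) = (\<Sum>t\<in>?V. \<integral>w\<in>?A t. G t w \<partial>M)"
    by (intro split G)
  also have "\<dots> \<le> (\<Sum>t\<in>?V. c t * measure M (?A t))"
    using US AN by (intro sum_mono le) auto
  also have "\<dots> = (\<Sum>t\<in>?V. \<integral>w\<in>?A t. c t \<partial>M)"
    by (simp add: set_integral_const mult.commute)
  also have "\<dots> = (\<integral>w. c (U w) \<partial>M)"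
    by (intro split[of "\<lambda>t w. c t", symmetric]) auto
  finally show ?thesis .
qed

section \<open>Scores at random parameters\<close>

text \<open>The index is shifted: \<open>\<psi> n\<close> is the score at time \<open>n + 1\<close>,
  revealed at \<open>F (Suc n)\<close> and conditioned on \<open>F n\<close>. The conditional bounds
  appear integrated over events of \<open>F n\<close>, so that no exceptional null set depends on
  the parameter.\<close>

locale score_process = prob_space M for M :: "'a measure" +
  fixes F :: "nat \<Rightarrow> 'a measure" and S :: "(real^'d) set" and \<theta>s :: "real^'d"
    and \<psi> :: "nat \<Rightarrow> real^'d \<Rightarrow> 'a \<Rightarrow> real^'d" and \<Psi> :: "nat \<Rightarrow> real^'d \<Rightarrow> 'a \<Rightarrow> real^'d^'d"
    and K1 K3 :: real
  assumes F_subalgebra: "subalgebra M (F n)"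
    and F_mono: "sets (F n) \<subseteq> sets (F (Suc n))"
    and S_compact: "compact S" and S_convex: "convex S" and \<theta>s_in_S: "\<theta>s \<in> S"
    and \<psi>_adapted: "t \<in> S \<Longrightarrow> \<psi> n t \<in> borel_measurable (F (Suc n))"
    and \<Psi>_adapted: "t \<in> S \<Longrightarrow> \<Psi> n t \<in> borel_measurable (F (Suc n))"
    and \<psi>_deriv: "t \<in> S \<Longrightarrow> w \<in> space M \<Longrightarrow>
      ((\<lambda>t. \<psi> n t w) has_derivative (\<lambda>h. \<Psi> n t w *v h)) (at t within S)"
    and \<Psi>_continuous: "w \<in> space M \<Longrightarrow> continuous_on S (\<lambda>t. \<Psi> n t w)"
    and \<psi>_integrable: "t \<in> S \<Longrightarrow> integrable M (\<psi> n t)"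
    and \<Psi>_integrable: "integrable M (\<Psi> n \<theta>s)"
    and \<psi>_identically: "t \<in> S \<Longrightarrow> distr M borel (\<psi> n t) = distr M borel (\<psi> 0 t)"
    and \<Psi>_identically: "distr M borel (\<Psi> n \<theta>s) = distr M borel (\<Psi> 0 \<theta>s)"
    and K1_nonneg: "0 \<le> K1" and K3_nonneg: "0 \<le> K3"
    and drift: "t \<in> S \<Longrightarrow> A \<in> sets (F n) \<Longrightarrow>
      (\<integral>w\<in>A. (t - \<theta>s) \<bullet> \<psi> n t w \<partial>M) \<le> - K1 * (norm (t - \<theta>s))\<^sup>2 * measure M A"
    and jac_Lipschitz: "t1 \<in> S \<Longrightarrow> t2 \<in> S \<Longrightarrow> A \<in> sets (F n) \<Longrightarrow>
      (\<integral>\<^sup>+w\<in>A. ennreal (norm (\<Psi> n t1 w - \<Psi> n t2 w)) \<partial>M) \<le> ennreal (K3 * norm (t1 - t2)) * emeasure M A"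
begin

text \<open>A predictable parameter: it is known at \<open>F n\<close>, before
  \<open>\<psi> n\<close> is revealed. It lies in \<open>S\<close> at every outcome, since
  derivatives in the parameter are taken pointwise.\<close>

definition parameter :: "nat \<Rightarrow> ('a \<Rightarrow> real^'d) \<Rightarrow> bool" where
  "parameter n X \<longleftrightarrow> X \<in> borel_measurable (F n) \<and> (\<forall>w\<in>space M. X w \<in> S)"

lemma S_closed: "closed S" and S_bounded: "bounded S" and S_nonempty: "S \<noteq> {}"
  using S_compact \<theta>s_in_S by (auto simp: compact_imp_closed compact_imp_bounded)

lemma space_F: "space (F n) = space M"
  using F_subalgebra by (simp add: subalgebra_def)

lemma dist_le_diameter: "x \<in> S \<Longrightarrow> y \<in> S \<Longrightarrow> norm (x - y) \<le> diameter S"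
  using diameter_bounded_bound[OF S_bounded, of x y] by (simp add: dist_norm)

lemma diameter_S_nonneg: "0 \<le> diameter S"
  using S_bounded by (rule diameter_ge_0)

lemma segment_in_S: "x \<in> S \<Longrightarrow> y \<in> S \<Longrightarrow> 0 \<le> s \<Longrightarrow> s \<le> 1 \<Longrightarrow> y + s *\<^sub>R (x - y) \<in> S"
  using convexD[OF S_convex, of x y s "1 - s"] by (simp add: algebra_simps)

lemma F_measurable_M: "f \<in> borel_measurable (F n) \<Longrightarrow> f \<in> borel_measurable M"
  by (rule measurable_from_subalg[OF F_subalgebra])

lemma parameter_measurable: "parameter n X \<Longrightarrow> X \<in> borel_measurable M"
  by (auto simp: parameter_def intro: F_measurable_M)

lemma parameter_in: "parameter n X \<Longrightarrow> w \<in> space M \<Longrightarrow> X w \<in> S"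
  by (auto simp: parameter_def)

lemma parameter_const: "t \<in> S \<Longrightarrow> parameter n (\<lambda>_. t)"
  by (auto simp: parameter_def)

lemma \<psi>_measurable: "t \<in> S \<Longrightarrow> \<psi> n t \<in> borel_measurable M"
  by (rule F_measurable_M[OF \<psi>_adapted])

lemma \<Psi>_measurable: "t \<in> S \<Longrightarrow> \<Psi> n t \<in> borel_measurable M"
  by (rule F_measurable_M[OF \<Psi>_adapted])

lemma \<psi>_continuous: "w \<in> space M \<Longrightarrow> continuous_on S (\<lambda>t. \<psi> n t w)"
  by (intro continuous_at_imp_continuous_on ballI differentiable_imp_continuous_on)
    (auto simp: differentiable_on_def differentiable_def intro!: \<psi>_deriv)

lemma parameter_adapted:
  assumes X: "parameter n X"
  shows "(\<lambda>w. \<psi> n (X w) w) \<in> borel_measurable (F (Suc n))"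
    and "(\<lambda>w. \<Psi> n (X w) w) \<in> borel_measurable (F (Suc n))"
proof -
  have "X \<in> borel_measurable (F (Suc n))"
    using X F_mono[of n] by (auto simp: parameter_def measurable_def space_F)
  note R = random_parameter_measurable[OF this S_closed S_convex S_nonempty]
  show "(\<lambda>w. \<psi> n (X w) w) \<in> borel_measurable (F (Suc n))"
    by (rule R) (use X in \<open>auto simp: space_F parameter_def \<psi>_adapted \<psi>_continuous\<close>)
  show "(\<lambda>w. \<Psi> n (X w) w) \<in> borel_measurable (F (Suc n))"
    by (rule R) (use X in \<open>auto simp: space_F parameter_def \<Psi>_adapted \<Psi>_continuous\<close>)
qed

lemmas parameter_score_measurable = parameter_adapted[THEN F_measurable_M]

text \<open>The fundamental theorem of calculus along the segment. An integral over the segment is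
  used, not a supremum: the Jacobian is controlled in mean at each single point, and integrals can
  be exchanged with the expectation.\<close>

lemma norm_score_diff_le:
  assumes x: "x \<in> S" and y: "y \<in> S" and w: "w \<in> space M"
  shows "ennreal (norm (\<psi> n x w - \<psi> n y w)) \<le>
    (\<integral>\<^sup>+s. ennreal (norm (x - y) * norm (\<Psi> n (y + s *\<^sub>R (x - y)) w)) * indicator {0..1} s \<partial>lborel)"
proof -
  let ?W = "\<lambda>s. y + s *\<^sub>R (x - y)"
  let ?f = "\<lambda>s. \<Psi> n (?W s) w *v (x - y)"
  have WS: "?W s \<in> S" if "s \<in> {0..1}" for s using segment_in_S[OF x y] that by auto
  have deriv: "((\<lambda>s. \<psi> n (?W s) w) has_vector_derivative ?f s) (at s within {0..1})" if "0 \<le> s" "s \<le> 1" for s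
  proof -
    have "((\<lambda>s. \<psi> n (?W s) w) has_derivative (\<lambda>h. \<Psi> n (?W s) w *v (h *\<^sub>R (x - y)))) (at s within {0..1})"
      by (rule has_derivative_in_compose2[OF \<psi>_deriv[OF _ w]])
        (use WS that in \<open>auto intro!: derivative_eq_intros\<close>)
    then show ?thesis
      by (simp add: has_vector_derivative_def matrix_vector_mult_scaleR)
  qed
  have cont: "continuous_on {0..1} ?f"
  proof (rule continuous_on_compose2[of S "\<lambda>t. \<Psi> n t w *v (x - y)"])
    show "continuous_on S (\<lambda>t. \<Psi> n t w *v (x - y))"
      unfolding matrix_vector_mult_def by (intro continuous_intros \<Psi>_continuous w)
  qed (use WS in \<open>auto intro!: continuous_intros\<close>)
  have bo: "has_bochner_integral lborel (\<lambda>s. indicator {0..1} s *\<^sub>R ?f s) (\<psi> n (?W 1) w - \<psi> n (?W 0) w)"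
    by (intro has_bochner_integral_FTC_Icc deriv cont) auto
  then have "ennreal (norm (\<psi> n x w - \<psi> n y w)) \<le> (\<integral>\<^sup>+s. ennreal (norm (indicator {0..1} s *\<^sub>R ?f s)) \<partial>lborel)"
    using has_bochner_integral_norm_bound[OF bo] by simp
  also have "\<dots> \<le> (\<integral>\<^sup>+s. ennreal (norm (x - y) * norm (\<Psi> n (?W s) w)) * indicator {0..1} s \<partial>lborel)"
    using norm_matrix_vector_mult_le
    by (intro nn_integral_mono) (auto simp: indicator_def mult.commute intro!: ennreal_leI)
  finally show ?thesis .
qed

lemma nn_integral_jac_diff_le:
  assumes X: "parameter n X"
  shows "(\<integral>\<^sup>+w. ennreal (norm (\<Psi> n (X w) w - \<Psi> n \<theta>s w)) \<partial>M) \<le> (\<integral>\<^sup>+w. ennreal (K3 * norm (X w - \<theta>s)) \<partial>M)"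
proof (rule nn_integral_random_parameter_le[OF F_subalgebra[of n] _ S_compact S_convex,
      where X = X and G = "\<lambda>x w. norm (\<Psi> n x w - \<Psi> n \<theta>s w)" and c = "\<lambda>x. K3 * norm (x - \<theta>s)"])
  show "(\<lambda>w. norm (\<Psi> n t w - \<Psi> n \<theta>s w)) \<in> borel_measurable M" if "t \<in> S" for t
    using \<Psi>_measurable[OF that, of n] \<Psi>_measurable[OF \<theta>s_in_S, of n] by measurable
  show "X \<in> borel_measurable (F n)" using X by (simp add: parameter_def)
qed (use \<theta>s_in_S jac_Lipschitz parameter_in[OF X] in
  \<open>auto intro!: continuous_intros \<Psi>_continuous\<close>)

text \<open>The weight \<open>norm (X w - Y w)\<close> and the point on the segment both depend on
  the outcome, so the random parameter to be frozen is the pair of \<open>X\<close> and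
  \<open>Y\<close>, with values in \<open>S \<times> S\<close>.\<close>

lemma nn_integral_path_jac_diff_le:
  assumes X: "parameter n X" and Y: "parameter n Y" and s: "0 \<le> s" "s \<le> 1"
  shows "(\<integral>\<^sup>+w. ennreal (norm (X w - Y w) * norm (\<Psi> n (Y w + s *\<^sub>R (X w - Y w)) w - \<Psi> n \<theta>s w)) \<partial>M)
    \<le> (\<integral>\<^sup>+w. ennreal (K3 * diameter S * norm (X w - Y w)) \<partial>M)"
proof -
  let ?w = "\<lambda>z :: (real^'d) \<times> (real^'d). snd z + s *\<^sub>R (fst z - snd z)"
  let ?G = "\<lambda>z w. norm (fst z - snd z) * norm (\<Psi> n (?w z) w - \<Psi> n \<theta>s w)"
  let ?c = "\<lambda>z. K3 * diameter S * norm (fst z - snd z)"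
  have w: "?w z \<in> S" if "z \<in> S \<times> S" for z using that s by (auto intro!: segment_in_S)
  have "(\<integral>\<^sup>+w. ennreal (?G (X w, Y w) w) \<partial>M) \<le> (\<integral>\<^sup>+w. ennreal (?c (X w, Y w)) \<partial>M)"
  proof (rule nn_integral_random_parameter_le[OF F_subalgebra[of n], where X = "\<lambda>w. (X w, Y w)" and G = ?G and c = ?c])
    show "(\<lambda>w. (X w, Y w)) \<in> borel_measurable (F n)"
      using X Y by (auto simp: parameter_def)
    show "compact (S \<times> S)" "convex (S \<times> S)"
      using S_compact S_convex by (auto intro: compact_Times convex_Times)
    show "(X w, Y w) \<in> S \<times> S" if "w \<in> space M" for w
      using X Y that by (auto simp: parameter_def)
    show "?G z \<in> borel_measurable M" if "z \<in> S \<times> S" for z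
      using \<Psi>_measurable[OF w[OF that], of n] \<Psi>_measurable[OF \<theta>s_in_S, of n] by measurable
    show "continuous_on (S \<times> S) (\<lambda>z. ?G z w)" if "w \<in> space M" for w
      by (intro continuous_intros continuous_on_compose2[OF \<Psi>_continuous[OF that]]) (use w in auto)
    show "continuous_on (S \<times> S) ?c" by (intro continuous_intros)
    show "(\<integral>\<^sup>+w\<in>A. ennreal (?G z w) \<partial>M) \<le> ennreal (?c z) * emeasure M A"
      if z: "z \<in> S \<times> S" and A: "A \<in> sets (F n)" for z A
    proof -
      have [measurable]: "A \<in> sets M" using A F_subalgebra[of n] by (auto simp: subalgebra_def)
      have [measurable]: "\<Psi> n (?w z) \<in> borel_measurable M" "\<Psi> n \<theta>s \<in> borel_measurable M"
        using \<Psi>_measurable w[OF z] \<theta>s_in_S by auto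
      have "(\<integral>\<^sup>+w\<in>A. ennreal (?G z w) \<partial>M) =
          ennreal (norm (fst z - snd z)) * (\<integral>\<^sup>+w\<in>A. ennreal (norm (\<Psi> n (?w z) w - \<Psi> n \<theta>s w)) \<partial>M)"
        by (simp add: ennreal_mult' mult.assoc nn_integral_cmult)
      also have "\<dots> \<le> ennreal (norm (fst z - snd z)) * (ennreal (K3 * norm (?w z - \<theta>s)) * emeasure M A)"
        by (intro mult_left_mono jac_Lipschitz w z \<theta>s_in_S A) auto
      also have "\<dots> = ennreal (norm (fst z - snd z) * (K3 * norm (?w z - \<theta>s))) * emeasure M A"
        using K3_nonneg by (simp add: ennreal_mult' mult.assoc)
      also have "\<dots> \<le> ennreal (?c z) * emeasure M A"
      proof (intro mult_right_mono ennreal_leI)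
        have "norm (fst z - snd z) * (K3 * norm (?w z - \<theta>s)) \<le> norm (fst z - snd z) * (K3 * diameter S)"
          using K3_nonneg by (intro mult_left_mono dist_le_diameter w z \<theta>s_in_S) auto
        then show "norm (fst z - snd z) * (K3 * norm (?w z - \<theta>s)) \<le> ?c z" by (simp add: mult_ac)
      qed auto
      finally show ?thesis .
    qed
  qed
  then show ?thesis by simp
qed

text \<open>The Jacobian on the segment is compared with the one at \<open>\<theta>s\<close>, whose
  law does not depend on \<open>n\<close>; the comparison error is at most
  \<open>K3 * diameter S\<close> in conditional mean, at each point of the segment separately.
  Tonelli then integrates over the segment.\<close>

lemma nn_integral_score_diff_le:
  assumes X: "parameter n X" and Y: "parameter n Y"
  shows "(\<integral>\<^sup>+w. ennreal (norm (\<psi> n (X w) w - \<psi> n (Y w) w)) \<partial>M)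
    \<le> (\<integral>\<^sup>+w. ennreal (norm (X w - Y w) * norm (\<Psi> n \<theta>s w)) \<partial>M)
      + (\<integral>\<^sup>+w. ennreal (K3 * diameter S * norm (X w - Y w)) \<partial>M)"
proof -
  let ?W = "\<lambda>w s. Y w + s *\<^sub>R (X w - Y w)"
  let ?h = "\<lambda>w s. ennreal (norm (X w - Y w) * norm (\<Psi> n (?W w s) w - \<Psi> n \<theta>s w)) * indicator {0..1} s"
  let ?b = "\<lambda>w. ennreal (norm (X w - Y w) * norm (\<Psi> n \<theta>s w))"
  have [measurable]: "X \<in> borel_measurable M" "Y \<in> borel_measurable M" "\<Psi> n \<theta>s \<in> borel_measurable M"
    using X Y \<Psi>_measurable[OF \<theta>s_in_S] parameter_measurable by auto
  \<comment> \<open>Clamping \<open>s\<close> to the unit interval keeps the point in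
    \<open>S\<close> for every real \<open>s\<close>, as joint measurability requires; the indicator
    in \<open>?h\<close> makes the clamping invisible.\<close>
  let ?V = "\<lambda>p :: 'a \<times> real. ?W (fst p) (min 1 (max 0 (snd p)))"
  have "(\<lambda>p. \<Psi> n (?V p) (fst p)) \<in> borel_measurable (M \<Otimes>\<^sub>M lborel)"
  proof (rule random_parameter_measurable[OF _ S_closed S_convex S_nonempty])
    show "?V \<in> borel_measurable (M \<Otimes>\<^sub>M lborel)" by measurable
    show "?V p \<in> S" if "p \<in> space (M \<Otimes>\<^sub>M lborel)" for p
      using that X Y by (intro segment_in_S) (auto simp: space_pair_measure parameter_def)
    show "(\<lambda>p. \<Psi> n t (fst p)) \<in> borel_measurable (M \<Otimes>\<^sub>M lborel)" if "t \<in> S" for t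
      using \<Psi>_measurable[OF that] by measurable
    show "continuous_on S (\<lambda>t. \<Psi> n t (fst p))" if "p \<in> space (M \<Otimes>\<^sub>M lborel)" for p
      using that by (intro \<Psi>_continuous) (auto simp: space_pair_measure)
  qed
  then have "(\<lambda>p. ennreal (norm (X (fst p) - Y (fst p)) * norm (\<Psi> n (?V p) (fst p) - \<Psi> n \<theta>s (fst p)))
      * indicator {0..1} (snd p)) \<in> borel_measurable (M \<Otimes>\<^sub>M lborel)"
    by measurable
  also have "(\<lambda>p. ennreal (norm (X (fst p) - Y (fst p)) * norm (\<Psi> n (?V p) (fst p) - \<Psi> n \<theta>s (fst p)))
      * indicator {0..1} (snd p)) = (\<lambda>(w, s). ?h w s)"
    by (auto simp: fun_eq_iff indicator_def)
  finally have h [measurable]: "(\<lambda>(w, s). ?h w s) \<in> borel_measurable (M \<Otimes>\<^sub>M lborel)" .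
  interpret P: pair_sigma_finite M "lborel :: real measure" ..
  have "ennreal (norm (\<psi> n (X w) w - \<psi> n (Y w) w)) \<le> ?b w + (\<integral>\<^sup>+s. ?h w s \<partial>lborel)" if w: "w \<in> space M" for w
  proof -
    have [measurable]: "?h w \<in> borel_measurable lborel"
      using measurable_Pair2[OF h w] by simp
    have "ennreal (norm (\<psi> n (X w) w - \<psi> n (Y w) w)) \<le>
        (\<integral>\<^sup>+s. ennreal (norm (X w - Y w) * norm (\<Psi> n (?W w s) w)) * indicator {0..1} s \<partial>lborel)"
      using norm_score_diff_le[OF _ _ w] X Y w by (auto simp: parameter_def)
    also have "\<dots> \<le> (\<integral>\<^sup>+s. ?b w * indicator {0..1} s + ?h w s \<partial>lborel)"
    proof (intro nn_integral_mono)
      fix s :: real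
      have "norm (X w - Y w) * norm (\<Psi> n (?W w s) w) \<le>
          norm (X w - Y w) * (norm (\<Psi> n \<theta>s w) + norm (\<Psi> n (?W w s) w - \<Psi> n \<theta>s w))"
        by (intro mult_left_mono norm_triangle_sub) auto
      then show "ennreal (norm (X w - Y w) * norm (\<Psi> n (?W w s) w)) * indicator {0..1} s
          \<le> ?b w * indicator {0..1} s + ?h w s"
        by (auto simp: indicator_def distrib_left ennreal_plus[symmetric] simp del: ennreal_plus intro!: ennreal_leI)
    qed
    also have "\<dots> = ?b w + (\<integral>\<^sup>+s. ?h w s \<partial>lborel)"
      by (subst nn_integral_add) (auto simp: nn_integral_cmult_indicator)
    finally show ?thesis .
  qed
  then have "(\<integral>\<^sup>+w. ennreal (norm (\<psi> n (X w) w - \<psi> n (Y w) w)) \<partial>M) \<le> (\<integral>\<^sup>+w. ?b w + (\<integral>\<^sup>+s. ?h w s \<partial>lborel) \<partial>M)"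
    by (rule nn_integral_mono)
  also have "\<dots> = (\<integral>\<^sup>+w. ?b w \<partial>M) + (\<integral>\<^sup>+w. \<integral>\<^sup>+s. ?h w s \<partial>lborel \<partial>M)"
    by (intro nn_integral_add) measurable
  also have "(\<integral>\<^sup>+w. \<integral>\<^sup>+s. ?h w s \<partial>lborel \<partial>M) = (\<integral>\<^sup>+s. \<integral>\<^sup>+w. ?h w s \<partial>M \<partial>lborel)"
    by (rule P.Fubini'[symmetric]) (rule h)
  also have "\<dots> \<le> (\<integral>\<^sup>+s. (\<integral>\<^sup>+w. ennreal (K3 * diameter S * norm (X w - Y w)) \<partial>M) * indicator {0..1} (s::real) \<partial>lborel)"
  proof (intro nn_integral_mono)
    fix s :: real
    show "(\<integral>\<^sup>+w. ?h w s \<partial>M) \<le> (\<integral>\<^sup>+w. ennreal (K3 * diameter S * norm (X w - Y w)) \<partial>M) * indicator {0..1} s"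
      using nn_integral_path_jac_diff_le[OF X Y, of s] by (simp add: indicator_def)
  qed
  also have "\<dots> = (\<integral>\<^sup>+w. ennreal (K3 * diameter S * norm (X w - Y w)) \<partial>M)"
    by (simp add: nn_integral_cmult_indicator)
  finally show ?thesis by (simp add: add_left_mono)
qed

text \<open>Truncation at a level \<open>R\<close>: where the Jacobian is larger, the weight is
  replaced by \<open>diameter S\<close>, leaving a small tail integral; elsewhere the Jacobian is
  replaced by \<open>R\<close>, which is the constant \<open>C\<close>. One level serves all
  \<open>n\<close> because the Jacobians at \<open>\<theta>s\<close> are identically
  distributed.\<close>

lemma weighted_jac_le:
  assumes e: "0 < e"
  obtains C where "0 \<le> C"
    and "\<And>n Y. Y \<in> borel_measurable M \<Longrightarrow> (\<And>w. w \<in> space M \<Longrightarrow> 0 \<le> Y w \<and> Y w \<le> diameter S) \<Longrightarrow>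
      (\<integral>\<^sup>+w. ennreal (Y w * norm (\<Psi> n \<theta>s w)) \<partial>M) \<le> ennreal e + (\<integral>\<^sup>+w. ennreal (C * Y w) \<partial>M)"
proof -
  let ?t = "\<lambda>(R::nat) A. if real R < norm A then diameter S * norm A else 0 :: real"
  have [measurable]: "\<Psi> n \<theta>s \<in> borel_measurable M" for n by (rule \<Psi>_measurable[OF \<theta>s_in_S])
  have "(\<lambda>R. \<integral>\<^sup>+w. ennreal (?t R (\<Psi> 0 \<theta>s w)) \<partial>M) \<longlonglongrightarrow> (\<integral>\<^sup>+w. 0 \<partial>M)"
  proof (rule nn_integral_dominated_convergence[where w = "\<lambda>w. ennreal (diameter S * norm (\<Psi> 0 \<theta>s w))"])
    have "integrable M (\<lambda>w. diameter S * norm (\<Psi> 0 \<theta>s w))" using \<Psi>_integrable by simp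
    then show "(\<integral>\<^sup>+w. ennreal (diameter S * norm (\<Psi> 0 \<theta>s w)) \<partial>M) < \<infinity>"
      by (subst nn_integral_eq_integral) (auto simp: diameter_S_nonneg)
    show "AE w in M. (\<lambda>R. ennreal (?t R (\<Psi> 0 \<theta>s w))) \<longlonglongrightarrow> 0"
    proof (intro AE_I2 tendsto_eventually)
      fix w
      obtain R0 :: nat where "norm (\<Psi> 0 \<theta>s w) \<le> real R0" using real_arch_simple by blast
      then show "\<forall>\<^sub>F R in sequentially. ennreal (?t R (\<Psi> 0 \<theta>s w)) = 0"
        by (intro eventually_sequentiallyI[of R0]) auto
    qed
  qed (auto intro!: ennreal_leI simp: diameter_S_nonneg)
  then have "\<forall>\<^sub>F R in sequentially. (\<integral>\<^sup>+w. ennreal (?t R (\<Psi> 0 \<theta>s w)) \<partial>M) < ennreal e"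
    using e by (intro order_tendstoD(2)) auto
  then obtain R :: nat where R: "(\<integral>\<^sup>+w. ennreal (?t R (\<Psi> 0 \<theta>s w)) \<partial>M) < ennreal e"
    by (auto simp: eventually_sequentially)
  show thesis
  proof (rule that[of "real R"])
    fix n and Y :: "'a \<Rightarrow> real" assume [measurable]: "Y \<in> borel_measurable M"
      and Y: "\<And>w. w \<in> space M \<Longrightarrow> 0 \<le> Y w \<and> Y w \<le> diameter S"
    have same: "(\<integral>\<^sup>+w. ennreal (?t R (\<Psi> n \<theta>s w)) \<partial>M) = (\<integral>\<^sup>+w. ennreal (?t R (\<Psi> 0 \<theta>s w)) \<partial>M)"
    proof -
      have "(\<integral>\<^sup>+w. ennreal (?t R (\<Psi> k \<theta>s w)) \<partial>M) = (\<integral>\<^sup>+A. ennreal (?t R A) \<partial>distr M borel (\<Psi> k \<theta>s))" for k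
        by (subst nn_integral_distr) auto
      note this[of n] this[of 0]
      then show ?thesis by (simp only: \<Psi>_identically[of n])
    qed
    have "(\<integral>\<^sup>+w. ennreal (Y w * norm (\<Psi> n \<theta>s w)) \<partial>M) \<le> (\<integral>\<^sup>+w. ennreal (?t R (\<Psi> n \<theta>s w)) + ennreal (real R * Y w) \<partial>M)"
    proof (intro nn_integral_mono)
      fix w assume w: "w \<in> space M"
      have "Y w * norm (\<Psi> n \<theta>s w) \<le> ?t R (\<Psi> n \<theta>s w) + real R * Y w"
      proof (cases "real R < norm (\<Psi> n \<theta>s w)")
        case True
        have "Y w * norm (\<Psi> n \<theta>s w) \<le> diameter S * norm (\<Psi> n \<theta>s w)"
          using Y[OF w] by (intro mult_right_mono) auto
        with True Y[OF w] show ?thesis by (simp add: add_increasing2)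
      next
        case False
        have "norm (\<Psi> n \<theta>s w) * Y w \<le> real R * Y w"
          using Y[OF w] False by (intro mult_right_mono) auto
        with False show ?thesis by (simp add: mult.commute)
      qed
      then show "ennreal (Y w * norm (\<Psi> n \<theta>s w)) \<le> ennreal (?t R (\<Psi> n \<theta>s w)) + ennreal (real R * Y w)"
        using Y[OF w] diameter_S_nonneg
        by (subst ennreal_plus[symmetric]) (auto intro!: ennreal_leI simp del: ennreal_plus)
    qed
    also have "\<dots> = (\<integral>\<^sup>+w. ennreal (?t R (\<Psi> n \<theta>s w)) \<partial>M) + (\<integral>\<^sup>+w. ennreal (real R * Y w) \<partial>M)"
      by (intro nn_integral_add) auto
    also have "\<dots> \<le> ennreal e + (\<integral>\<^sup>+w. ennreal (real R * Y w) \<partial>M)"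
      unfolding same using R by (intro add_right_mono) auto
    finally show "(\<integral>\<^sup>+w. ennreal (Y w * norm (\<Psi> n \<theta>s w)) \<partial>M) \<le> ennreal e + (\<integral>\<^sup>+w. ennreal (real R * Y w) \<partial>M)" .
  qed simp
qed

end

section \<open>Two criteria for null sequences\<close>

lemma cesaro_mean_tendsto_0:
  fixes a :: "nat \<Rightarrow> real"
  assumes a: "a \<longlonglongrightarrow> 0"
  shows "(\<lambda>n. (\<Sum>k<n. a k) / real n) \<longlonglongrightarrow> 0"
proof (rule LIMSEQ_I)
  fix r :: real assume r: "0 < r"
  obtain N where N: "\<And>n. n \<ge> N \<Longrightarrow> \<bar>a n\<bar> < r / 2"
    using LIMSEQ_D[OF a half_gt_zero[OF r]] by auto
  define B where "B = (\<Sum>k<N. \<bar>a k\<bar>)"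
  obtain N' :: nat where N': "2 * B / r < real N'" using reals_Archimedean2 by blast
  show "\<exists>no. \<forall>n\<ge>no. norm ((\<Sum>k<n. a k) / real n - 0) < r"
  proof (intro exI[of _ "max N (max N' 1)"] allI impI)
    fix n assume n: "n \<ge> max N (max N' 1)"
    have "\<bar>\<Sum>k<n. a k\<bar> \<le> (\<Sum>k<n. \<bar>a k\<bar>)" by (rule sum_abs)
    also have "\<dots> = (\<Sum>k\<in>{..<N} \<union> {N..<n}. \<bar>a k\<bar>)"
      using n by (intro sum.cong) auto
    also have "\<dots> = B + (\<Sum>k\<in>{N..<n}. \<bar>a k\<bar>)"
      unfolding B_def by (intro sum.union_disjoint) auto
    also have "(\<Sum>k\<in>{N..<n}. \<bar>a k\<bar>) \<le> (\<Sum>k\<in>{N..<n}. r / 2)"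
      using N by (intro sum_mono) (auto intro: less_imp_le)
    also have "\<dots> \<le> real n * (r / 2)" using r by (simp add: mult_right_mono)
    finally have 1: "\<bar>\<Sum>k<n. a k\<bar> \<le> B + real n * (r / 2)" by simp
    have "2 * B / r < real n" using N' n by simp
    then have "B < real n * (r / 2)" using r by (simp add: field_simps)
    with 1 have "\<bar>\<Sum>k<n. a k\<bar> < real n * r" by simp
    then show "norm ((\<Sum>k<n. a k) / real n - 0) < r"
      using n by (simp add: field_simps)
  qed
qed

text \<open>The form in which truncation delivers its bounds: the null sequence \<open>b\<close> may
  depend on \<open>e\<close>, since the truncation level does.\<close>

lemma tendsto_0_approx:
  fixes a :: "nat \<Rightarrow> real"
  assumes nonneg: "\<And>n. 0 \<le> a n"
    and approx: "\<And>e. 0 < e \<Longrightarrow> \<exists>b. b \<longlonglongrightarrow> 0 \<and> (\<forall>n. a n \<le> e + b n)"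
  shows "a \<longlonglongrightarrow> 0"
proof (rule LIMSEQ_I)
  fix r :: real assume r: "0 < r"
  obtain b where b: "b \<longlonglongrightarrow> 0" "\<And>n. a n \<le> r / 2 + b n"
    using approx[OF half_gt_zero[OF r]] by blast
  obtain N where N: "\<And>n. n \<ge> N \<Longrightarrow> \<bar>b n\<bar> < r / 2"
    using LIMSEQ_D[OF b(1) half_gt_zero[OF r]] by auto
  show "\<exists>no. \<forall>n\<ge>no. norm (a n - 0) < r"
  proof (intro exI[of _ N] allI impI)
    fix n assume "n \<ge> N"
    then show "norm (a n - 0) < r" using N[of n] b(2)[of n] nonneg[of n] by auto
  qed
qed

section \<open>First moments of the score at random parameters\<close>

context score_process
begin

lemma integrable_norm_bound_const:
  assumes [measurable]: "f \<in> borel_measurable M" and "\<And>w. w \<in> space M \<Longrightarrow> norm (f w) \<le> B"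
  shows "integrable M (f :: 'a \<Rightarrow> 'b::{banach, second_countable_topology})"
  using assms(2) by (intro integrable_const_bound[where B = B] AE_I2) auto

lemma parameter_diff_integrable:
  assumes "parameter n X" "parameter n Y"
  shows "integrable M (\<lambda>w. norm (X w - Y w))"
proof (rule integrable_norm_bound_const[where B = "diameter S"])
  show "(\<lambda>w. norm (X w - Y w)) \<in> borel_measurable M"
    using assms[THEN parameter_measurable] by measurable
qed (use assms dist_le_diameter in \<open>auto simp: parameter_def\<close>)

text \<open>Almost a Lipschitz bound in L1, uniform in \<open>n\<close>. The additive
  \<open>e\<close> is the truncation error for the Jacobian at \<open>\<theta>s\<close>, which is
  integrable but has no bounded conditional mean at hand; \<open>C\<close> collects the truncation
  level and \<open>K3 * diameter S\<close>.\<close>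

lemma score_L1_le:
  assumes e: "0 < e"
  obtains C where "0 \<le> C"
    and "\<And>n X Y. parameter n X \<Longrightarrow> parameter n Y \<Longrightarrow>
      integrable M (\<lambda>w. norm (\<psi> n (X w) w - \<psi> n (Y w) w)) \<and>
      (\<integral>w. norm (\<psi> n (X w) w - \<psi> n (Y w) w) \<partial>M) \<le> e + C * (\<integral>w. norm (X w - Y w) \<partial>M)"
proof -
  obtain C where C: "0 \<le> C" "\<And>n Y. Y \<in> borel_measurable M \<Longrightarrow>
      (\<And>w. w \<in> space M \<Longrightarrow> 0 \<le> Y w \<and> Y w \<le> diameter S) \<Longrightarrow>
      (\<integral>\<^sup>+w. ennreal (Y w * norm (\<Psi> n \<theta>s w)) \<partial>M) \<le> ennreal e + (\<integral>\<^sup>+w. ennreal (C * Y w) \<partial>M)"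
    using weighted_jac_le[OF e] by blast
  show thesis
  proof (rule that[of "C + K3 * diameter S"])
    show "0 \<le> C + K3 * diameter S" using C(1) K3_nonneg diameter_S_nonneg by simp
  next
    fix n X Y assume X: "parameter n X" and Y: "parameter n Y"
    have [measurable]: "X \<in> borel_measurable M" "Y \<in> borel_measurable M"
      using X Y by (auto intro: parameter_measurable)
    have meas [measurable]: "(\<lambda>w. \<psi> n (X w) w) \<in> borel_measurable M" "(\<lambda>w. \<psi> n (Y w) w) \<in> borel_measurable M"
      using X Y by (auto intro: parameter_score_measurable)
    note int = parameter_diff_integrable[OF X Y]
    let ?I = "\<integral>w. norm (X w - Y w) \<partial>M"
    have nn: "(\<integral>\<^sup>+w. ennreal (c * norm (X w - Y w)) \<partial>M) = ennreal (c * ?I)" if "0 \<le> c" for c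
      using int that by (subst nn_integral_eq_integral) auto
    have "(\<integral>\<^sup>+w. ennreal (norm (\<psi> n (X w) w - \<psi> n (Y w) w)) \<partial>M)
        \<le> (\<integral>\<^sup>+w. ennreal (norm (X w - Y w) * norm (\<Psi> n \<theta>s w)) \<partial>M) + ennreal (K3 * diameter S * ?I)"
      using nn_integral_score_diff_le[OF X Y] K3_nonneg diameter_S_nonneg by (simp add: nn)
    also have "(\<integral>\<^sup>+w. ennreal (norm (X w - Y w) * norm (\<Psi> n \<theta>s w)) \<partial>M) \<le> ennreal e + ennreal (C * ?I)"
      unfolding nn[OF C(1), symmetric]
      by (rule C(2)) (use X Y dist_le_diameter in \<open>auto simp: parameter_def\<close>)
    also have "ennreal e + ennreal (C * ?I) + ennreal (K3 * diameter S * ?I) = ennreal (e + (C + K3 * diameter S) * ?I)"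
      using e C(1) K3_nonneg diameter_S_nonneg
      by (simp add: ennreal_plus[symmetric] algebra_simps del: ennreal_plus)
    finally have le: "(\<integral>\<^sup>+w. ennreal (norm (\<psi> n (X w) w - \<psi> n (Y w) w)) \<partial>M) \<le> ennreal (e + (C + K3 * diameter S) * ?I)"
      by simp
    then have integrable: "integrable M (\<lambda>w. norm (\<psi> n (X w) w - \<psi> n (Y w) w))"
      by (intro integrableI_bounded) (auto intro: le_less_trans)
    moreover have "(\<integral>w. norm (\<psi> n (X w) w - \<psi> n (Y w) w) \<partial>M) \<le> e + (C + K3 * diameter S) * ?I"
      using le e C(1) K3_nonneg diameter_S_nonneg
      by (subst (asm) nn_integral_eq_integral[OF integrable]) (auto simp: ennreal_le_iff simp del: ennreal_plus)
    ultimately show "integrable M (\<lambda>w. norm (\<psi> n (X w) w - \<psi> n (Y w) w)) \<and>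
      (\<integral>w. norm (\<psi> n (X w) w - \<psi> n (Y w) w) \<partial>M) \<le> e + (C + K3 * diameter S) * ?I" ..
  qed
qed

lemma score_diff_integrable:
  "parameter n X \<Longrightarrow> parameter n Y \<Longrightarrow> integrable M (\<lambda>w. norm (\<psi> n (X w) w - \<psi> n (Y w) w))"
  by (rule score_L1_le[OF zero_less_one]) blast

lemma parameter_score_integrable:
  assumes X: "parameter n X"
  shows "integrable M (\<lambda>w. \<psi> n (X w) w)"
proof -
  have "integrable M (\<lambda>w. norm (\<psi> n \<theta>s w) + norm (\<psi> n (X w) w - \<psi> n \<theta>s w))"
    using score_diff_integrable[OF X parameter_const[OF \<theta>s_in_S]] \<psi>_integrable[OF \<theta>s_in_S] by simp
  then show ?thesis
    by (rule Bochner_Integration.integrable_bound)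
      (auto intro!: parameter_score_measurable X AE_I2 simp: norm_triangle_sub)
qed

lemma score_L1_tendsto:
  assumes X: "\<And>k. parameter (m k) (X k)" and Y: "\<And>k. parameter (m k) (Y k)"
    and lim: "(\<lambda>k. \<integral>w. norm (X k w - Y k w) \<partial>M) \<longlonglongrightarrow> 0"
  shows "(\<lambda>k. \<integral>w. norm (\<psi> (m k) (X k w) w - \<psi> (m k) (Y k w) w) \<partial>M) \<longlonglongrightarrow> 0"
proof (rule tendsto_0_approx)
  fix e :: real assume "0 < e"
  then obtain C where "0 \<le> C" and C: "\<And>n X Y. parameter n X \<Longrightarrow> parameter n Y \<Longrightarrow>
      integrable M (\<lambda>w. norm (\<psi> n (X w) w - \<psi> n (Y w) w)) \<and>
      (\<integral>w. norm (\<psi> n (X w) w - \<psi> n (Y w) w) \<partial>M) \<le> e + C * (\<integral>w. norm (X w - Y w) \<partial>M)"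
    by (rule score_L1_le) (rule that)
  show "\<exists>b. b \<longlonglongrightarrow> 0 \<and> (\<forall>k. (\<integral>w. norm (\<psi> (m k) (X k w) w - \<psi> (m k) (Y k w) w) \<partial>M) \<le> e + b k)"
    using C[OF X Y, THEN conjunct2] tendsto_mult_right_zero[OF lim, of C] by blast
qed auto

lemma inner_score_integrable:
  assumes X: "parameter n X"
  shows "integrable M (\<lambda>w. (X w - \<theta>s) \<bullet> \<psi> n (X w) w)"
proof (rule Bochner_Integration.integrable_bound)
  show "integrable M (\<lambda>w. diameter S * norm (\<psi> n (X w) w))" using parameter_score_integrable[OF X] by simp
  show "(\<lambda>w. (X w - \<theta>s) \<bullet> \<psi> n (X w) w) \<in> borel_measurable M"
    using parameter_measurable[OF X] parameter_score_measurable(1)[OF X] by measurable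
  show "AE w in M. norm ((X w - \<theta>s) \<bullet> \<psi> n (X w) w) \<le> norm (diameter S * norm (\<psi> n (X w) w))"
  proof (rule AE_I2)
    fix w assume w: "w \<in> space M"
    have "\<bar>(X w - \<theta>s) \<bullet> \<psi> n (X w) w\<bar> \<le> norm (X w - \<theta>s) * norm (\<psi> n (X w) w)" by (rule Cauchy_Schwarz_ineq2)
    also have "\<dots> \<le> diameter S * norm (\<psi> n (X w) w)"
      using parameter_in[OF X w] \<theta>s_in_S by (intro mult_right_mono dist_le_diameter) auto
    finally show "norm ((X w - \<theta>s) \<bullet> \<psi> n (X w) w) \<le> norm (diameter S * norm (\<psi> n (X w) w))"
      using diameter_S_nonneg by simp
  qed
qed

lemma parameter_sq_integrable:
  assumes X: "parameter n X"
  shows "integrable M (\<lambda>w. (norm (X w - \<theta>s))\<^sup>2)"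
proof (rule integrable_norm_bound_const[where B = "(diameter S)\<^sup>2"])
  show "(\<lambda>w. (norm (X w - \<theta>s))\<^sup>2) \<in> borel_measurable M"
    using parameter_measurable[OF X] by measurable
qed (use parameter_in[OF X] \<theta>s_in_S dist_le_diameter in \<open>auto intro!: power_mono\<close>)

text \<open>Simple predictable parameters satisfy the bound, and both sides are continuous along the
  approximation: the left by L1 continuity of the score, the right by dominated convergence.\<close>

lemma score_drift_le:
  assumes X: "parameter n X"
  shows "(\<integral>w. (X w - \<theta>s) \<bullet> \<psi> n (X w) w \<partial>M) \<le> - K1 * (\<integral>w. (norm (X w - \<theta>s))\<^sup>2 \<partial>M)"
proof -
  have [measurable]: "X \<in> borel_measurable M" using X by (rule parameter_measurable)
  have [measurable]: "(\<lambda>w. \<psi> n (X w) w) \<in> borel_measurable M" using X by (rule parameter_score_measurable)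
  obtain U where U: "\<And>m::nat. simple_function (F n) (U m)" "\<And>m w. U m w \<in> S"
    "\<And>w. w \<in> space (F n) \<Longrightarrow> (\<lambda>m. U m w) \<longlonglongrightarrow> X w"
    using simple_function_approximation_in[of X "F n", OF _ S_closed S_convex S_nonempty] X
    unfolding parameter_def space_F by metis
  have Up: "parameter n (U m)" for m
    using U by (auto simp: parameter_def borel_measurable_simple_function)
  have [measurable]: "U m \<in> borel_measurable M" for m by (rule parameter_measurable[OF Up])
  have [measurable]: "(\<lambda>w. \<psi> n (U m w) w) \<in> borel_measurable M" for m using Up by (rule parameter_score_measurable)
  note Xi = parameter_score_integrable[OF X]
  have Ulim: "(\<lambda>m. norm (U m w - X w)) \<longlonglongrightarrow> 0" if "w \<in> space M" for w
    using U(3) that by (intro tendsto_norm_zero LIM_zero) (simp add: space_F)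
  have Udiam: "norm (U m w - X w) \<le> diameter S" "norm (U m w - \<theta>s) \<le> diameter S" "norm (X w - \<theta>s) \<le> diameter S"
    if "w \<in> space M" for m w
    using U(2) parameter_in[OF X that] \<theta>s_in_S by (auto intro: dist_le_diameter)
  have simple: "(\<integral>w. (U m w - \<theta>s) \<bullet> \<psi> n (U m w) w \<partial>M) \<le> (\<integral>w. - K1 * (norm (U m w - \<theta>s))\<^sup>2 \<partial>M)" for m
    by (rule integral_simple_random_parameter_le[OF F_subalgebra[of n] U(1,2),
        where G = "\<lambda>t w. (t - \<theta>s) \<bullet> \<psi> n t w" and c = "\<lambda>t. - K1 * (norm (t - \<theta>s))\<^sup>2"])
      (use drift inner_score_integrable[OF parameter_const] in auto)
  have rhs: "(\<lambda>m. \<integral>w. - K1 * (norm (U m w - \<theta>s))\<^sup>2 \<partial>M) \<longlonglongrightarrow> (\<integral>w. - K1 * (norm (X w - \<theta>s))\<^sup>2 \<partial>M)"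
  proof (rule integral_dominated_convergence[where w = "\<lambda>_. K1 * (diameter S)\<^sup>2"])
    show "AE w in M. (\<lambda>m. - K1 * (norm (U m w - \<theta>s))\<^sup>2) \<longlonglongrightarrow> - K1 * (norm (X w - \<theta>s))\<^sup>2"
      using U(3) by (intro AE_I2 tendsto_intros) (simp add: space_F)
    show "AE w in M. norm (- K1 * (norm (U m w - \<theta>s))\<^sup>2) \<le> K1 * (diameter S)\<^sup>2" for m
      using Udiam(2) K1_nonneg by (intro AE_I2) (auto simp: abs_mult intro!: mult_left_mono power_mono)
  qed auto
  have "(\<lambda>m. \<integral>w. norm (U m w - X w) \<partial>M) \<longlonglongrightarrow> (\<integral>w. 0 \<partial>M)"
    by (rule integral_dominated_convergence[where w = "\<lambda>_. diameter S"])
      (use Ulim Udiam in \<open>auto intro!: AE_I2\<close>)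
  then have L1: "(\<lambda>m. \<integral>w. norm (\<psi> n (U m w) w - \<psi> n (X w) w) \<partial>M) \<longlonglongrightarrow> 0"
    using score_L1_tendsto[of "\<lambda>_. n" U "\<lambda>_. X"] Up X by simp
  have wi: "integrable M (\<lambda>w. norm (U m w - X w) * norm (\<psi> n (X w) w))" for m
    by (rule Bochner_Integration.integrable_bound[of _ "\<lambda>w. diameter S * norm (\<psi> n (X w) w)"])
      (use Xi Udiam diameter_S_nonneg in \<open>auto simp: abs_mult intro!: AE_I2 mult_right_mono\<close>)
  have W: "(\<lambda>m. \<integral>w. norm (U m w - X w) * norm (\<psi> n (X w) w) \<partial>M) \<longlonglongrightarrow> (\<integral>w. 0 \<partial>M)"
  proof (rule integral_dominated_convergence[where w = "\<lambda>w. diameter S * norm (\<psi> n (X w) w)"])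
    show "AE w in M. (\<lambda>m. norm (U m w - X w) * norm (\<psi> n (X w) w)) \<longlonglongrightarrow> 0"
      using Ulim by (intro AE_I2 tendsto_mult_left_zero) auto
  qed (use Xi Udiam in \<open>auto intro!: AE_I2 mult_right_mono\<close>)
  have lhs: "(\<lambda>m. (\<integral>w. (U m w - \<theta>s) \<bullet> \<psi> n (U m w) w \<partial>M) - (\<integral>w. (X w - \<theta>s) \<bullet> \<psi> n (X w) w \<partial>M)) \<longlonglongrightarrow> 0"
  proof (rule Lim_null_comparison[OF always_eventually])
    let ?D = "\<lambda>m. \<integral>w. norm (\<psi> n (U m w) w - \<psi> n (X w) w) \<partial>M"
    let ?W = "\<lambda>m. \<integral>w. norm (U m w - X w) * norm (\<psi> n (X w) w) \<partial>M"
    show "(\<lambda>m. diameter S * ?D m + ?W m) \<longlonglongrightarrow> 0"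
      using tendsto_add[OF tendsto_mult_right_zero[OF L1, of "diameter S"] W] by simp
    show "\<forall>m. norm ((\<integral>w. (U m w - \<theta>s) \<bullet> \<psi> n (U m w) w \<partial>M) - (\<integral>w. (X w - \<theta>s) \<bullet> \<psi> n (X w) w \<partial>M)) \<le> diameter S * ?D m + ?W m"
    proof
      fix m
      have "norm ((\<integral>w. (U m w - \<theta>s) \<bullet> \<psi> n (U m w) w \<partial>M) - (\<integral>w. (X w - \<theta>s) \<bullet> \<psi> n (X w) w \<partial>M)) =
          norm (\<integral>w. (U m w - \<theta>s) \<bullet> \<psi> n (U m w) w - (X w - \<theta>s) \<bullet> \<psi> n (X w) w \<partial>M)"
        by (subst Bochner_Integration.integral_diff) (auto intro: inner_score_integrable X Up)
      also have "\<dots> \<le> (\<integral>w. diameter S * norm (\<psi> n (U m w) w - \<psi> n (X w) w) + norm (U m w - X w) * norm (\<psi> n (X w) w) \<partial>M)"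
      proof (rule order_trans[OF integral_norm_bound integral_mono])
        fix w assume w: "w \<in> space M"
        \<comment> \<open>In the first term the weight is bounded and the score difference tends to
          0 in L1; in the second the score at \<open>X\<close> is a fixed integrable function, which
          dominates.\<close>
        have "(U m w - \<theta>s) \<bullet> \<psi> n (U m w) w - (X w - \<theta>s) \<bullet> \<psi> n (X w) w =
            (U m w - \<theta>s) \<bullet> (\<psi> n (U m w) w - \<psi> n (X w) w) + (U m w - X w) \<bullet> \<psi> n (X w) w"
          by (simp add: inner_diff_left inner_diff_right)
        also have "norm \<dots> \<le> norm (U m w - \<theta>s) * norm (\<psi> n (U m w) w - \<psi> n (X w) w) + norm (U m w - X w) * norm (\<psi> n (X w) w)"
          by (intro norm_triangle_mono) (auto simp: Cauchy_Schwarz_ineq2)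
        also have "norm (U m w - \<theta>s) * norm (\<psi> n (U m w) w - \<psi> n (X w) w) \<le> diameter S * norm (\<psi> n (U m w) w - \<psi> n (X w) w)"
          using Udiam[OF w] by (intro mult_right_mono) auto
        finally show "norm ((U m w - \<theta>s) \<bullet> \<psi> n (U m w) w - (X w - \<theta>s) \<bullet> \<psi> n (X w) w)
            \<le> diameter S * norm (\<psi> n (U m w) w - \<psi> n (X w) w) + norm (U m w - X w) * norm (\<psi> n (X w) w)"
          by simp
      qed (use inner_score_integrable[OF X] inner_score_integrable[OF Up, of m] wi score_diff_integrable[OF Up X] in auto)
      also have "\<dots> = diameter S * ?D m + ?W m"
        using wi score_diff_integrable[OF Up X] by (subst Bochner_Integration.integral_add) auto
      finally show "norm ((\<integral>w. (U m w - \<theta>s) \<bullet> \<psi> n (U m w) w \<partial>M) - (\<integral>w. (X w - \<theta>s) \<bullet> \<psi> n (X w) w \<partial>M)) \<le> diameter S * ?D m + ?W m" .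
    qed
  qed
  have "(\<integral>w. (X w - \<theta>s) \<bullet> \<psi> n (X w) w \<partial>M) \<le> (\<integral>w. - K1 * (norm (X w - \<theta>s))\<^sup>2 \<partial>M)"
    by (rule LIMSEQ_le[OF LIM_zero_cancel[OF lhs] rhs]) (use simple in auto)
  then show ?thesis by simp
qed

end

section \<open>The projected recursion\<close>

lemma borel_measurable_matrix_vector_mult:
  fixes A :: "'a \<Rightarrow> real^'n^'m" and v :: "'a \<Rightarrow> real^'n"
  assumes "A \<in> borel_measurable N" "v \<in> borel_measurable N"
  shows "(\<lambda>x. A x *v v x) \<in> borel_measurable N"
  using assms
proof (rule borel_measurable_continuous_Pair)
  show "continuous_on UNIV (\<lambda>p :: (real^'n^'m) \<times> (real^'n). fst p *v snd p)"
    unfolding matrix_vector_mult_def by (intro continuous_intros)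
qed

text \<open>The remainder of one step is quadratic in the score \<open>s\<close> while the projection is inactive, but
  never more than linear because \<open>S\<close> is bounded; this is why first moments of the score suffice.\<close>

definition step_remainder :: "real \<Rightarrow> real \<Rightarrow> nat \<Rightarrow> real \<Rightarrow> real" where
  "step_remainder B L n s = min (B * s\<^sup>2 / real (Suc n)) (L * s)"

text \<open>If \<open>y\<close> is the larger part, then \<open>s \<le> 2 * y\<close> and the linear
  cap suffices. Otherwise \<open>s \<le> 2 * x\<close>, and doubling the argument costs at most a
  factor 4, attained in the quadratic branch.\<close>

lemma step_remainder_add:
  assumes "0 \<le> B" "0 \<le> L" "0 \<le> x" "0 \<le> y" "s \<le> x + y" "0 \<le> s"
  shows "step_remainder B L n s \<le> 4 * step_remainder B L n x + 2 * L * y"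
proof (cases "x \<le> y")
  case True
  have "step_remainder B L n s \<le> L * s" by (simp add: step_remainder_def)
  also have "\<dots> \<le> L * (2 * y)" using assms True by (intro mult_left_mono) auto
  also have "0 \<le> step_remainder B L n x" using assms by (simp add: step_remainder_def)
  ultimately show ?thesis by simp
next
  case False
  have s: "s \<le> 2 * x" using False assms by simp
  have "B * s\<^sup>2 / real (Suc n) \<le> B * (2 * x)\<^sup>2 / real (Suc n)"
    using assms s by (intro divide_right_mono mult_left_mono power_mono) auto
  also have "\<dots> = 4 * (B * x\<^sup>2 / real (Suc n))" by (simp add: power_mult_distrib)
  finally have 1: "B * s\<^sup>2 / real (Suc n) \<le> 4 * (B * x\<^sup>2 / real (Suc n))" .
  have "L * s \<le> L * (2 * x)" using assms s by (intro mult_left_mono) auto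
  also have "\<dots> \<le> 4 * (L * x)" using assms by simp
  finally have 2: "L * s \<le> 4 * (L * x)" .
  have "step_remainder B L n s \<le> 4 * step_remainder B L n x"
    using 1 2 unfolding step_remainder_def by linarith
  moreover have "0 \<le> 2 * L * y" using assms by simp
  ultimately show ?thesis by linarith
qed

section \<open>Step remainders at random parameters\<close>

context score_process
begin

lemma weighted_jac_tendsto:
  assumes [measurable]: "\<And>k. Y k \<in> borel_measurable M"
    and Y: "\<And>k w. w \<in> space M \<Longrightarrow> 0 \<le> Y k w \<and> Y k w \<le> diameter S"
    and lim: "(\<lambda>k. \<integral>w. Y k w \<partial>M) \<longlonglongrightarrow> 0"
  shows "(\<lambda>k. \<integral>w. Y k w * norm (\<Psi> k \<theta>s w) \<partial>M) \<longlonglongrightarrow> 0"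
proof (rule tendsto_0_approx)
  have [measurable]: "\<Psi> n \<theta>s \<in> borel_measurable M" for n by (rule \<Psi>_measurable[OF \<theta>s_in_S])
  show "0 \<le> (\<integral>w. Y k w * norm (\<Psi> k \<theta>s w) \<partial>M)" for k
    using Y by (intro integral_nonneg_AE) auto
  fix e :: real assume e: "0 < e"
  obtain C where C: "0 \<le> C" "\<And>n Y. Y \<in> borel_measurable M \<Longrightarrow>
      (\<And>w. w \<in> space M \<Longrightarrow> 0 \<le> Y w \<and> Y w \<le> diameter S) \<Longrightarrow>
      (\<integral>\<^sup>+w. ennreal (Y w * norm (\<Psi> n \<theta>s w)) \<partial>M) \<le> ennreal e + (\<integral>\<^sup>+w. ennreal (C * Y w) \<partial>M)"
    using weighted_jac_le[OF e] by blast
  have Yi: "integrable M (Y k)" for k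
    by (rule integrable_norm_bound_const[where B = "diameter S"]) (use Y in auto)
  have YPi: "integrable M (\<lambda>w. Y k w * norm (\<Psi> k \<theta>s w))" for k
    by (rule Bochner_Integration.integrable_bound[of _ "\<lambda>w. diameter S * norm (\<Psi> k \<theta>s w)"])
      (use Y \<Psi>_integrable diameter_S_nonneg in \<open>auto simp: abs_mult intro!: AE_I2 mult_right_mono\<close>)
  have "(\<integral>w. Y k w * norm (\<Psi> k \<theta>s w) \<partial>M) \<le> e + C * (\<integral>w. Y k w \<partial>M)" for k
  proof -
    have I: "0 \<le> (\<integral>w. Y k w \<partial>M)" using Y by (intro integral_nonneg_AE) auto
    have "(\<integral>\<^sup>+w. ennreal (C * Y k w) \<partial>M) = ennreal (C * (\<integral>w. Y k w \<partial>M))"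
      using Yi C(1) Y by (subst nn_integral_eq_integral) auto
    moreover have "(\<integral>\<^sup>+w. ennreal (Y k w * norm (\<Psi> k \<theta>s w)) \<partial>M) = ennreal (\<integral>w. Y k w * norm (\<Psi> k \<theta>s w) \<partial>M)"
      using Y by (intro nn_integral_eq_integral[OF YPi]) auto
    ultimately have "ennreal (\<integral>w. Y k w * norm (\<Psi> k \<theta>s w) \<partial>M) \<le> ennreal (e + C * (\<integral>w. Y k w \<partial>M))"
      using C(2)[of "Y k" k, OF _ Y] C(1) e I by simp
    then show ?thesis using e C(1) I by (auto simp: ennreal_le_iff simp del: ennreal_plus)
  qed
  then show "\<exists>b. b \<longlonglongrightarrow> 0 \<and> (\<forall>k. (\<integral>w. Y k w * norm (\<Psi> k \<theta>s w) \<partial>M) \<le> e + b k)"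
    using tendsto_mult_right_zero[OF lim, of C] by blast
qed

lemma step_remainder_score_integrable:
  assumes "0 \<le> B" "0 \<le> L" and X: "parameter n X"
  shows "integrable M (\<lambda>w. step_remainder B L k (norm (\<psi> n (X w) w)))"
proof (rule Bochner_Integration.integrable_bound)
  show "integrable M (\<lambda>w. L * norm (\<psi> n (X w) w))" using parameter_score_integrable[OF X] by simp
  show "(\<lambda>w. step_remainder B L k (norm (\<psi> n (X w) w))) \<in> borel_measurable M"
    using parameter_score_measurable(1)[OF X] unfolding step_remainder_def by measurable
qed (use assms in \<open>auto simp: step_remainder_def min_def intro!: AE_I2\<close>)

text \<open>For a fixed parameter the law of the score does not change with \<open>n\<close>, so one
  score can stand for all. Its quadratic branch vanishes pointwise, and the linear branch is an
  integrable majorant.\<close>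

lemma step_remainder_score_tendsto:
  assumes B: "0 \<le> B" and L: "0 \<le> L" and t: "t \<in> S"
  shows "(\<lambda>n. \<integral>w. step_remainder B L n (norm (\<psi> n t w)) \<partial>M) \<longlonglongrightarrow> 0"
proof -
  have [measurable]: "\<psi> n t \<in> borel_measurable M" for n by (rule \<psi>_measurable[OF t])
  have [measurable]: "step_remainder B L n \<in> borel_measurable borel" for n
    unfolding step_remainder_def[abs_def] by measurable
  have eq: "(\<integral>w. step_remainder B L n (norm (\<psi> n t w)) \<partial>M) = (\<integral>w. step_remainder B L n (norm (\<psi> 0 t w)) \<partial>M)" for n
  proof -
    have "(\<integral>w. step_remainder B L n (norm (\<psi> k t w)) \<partial>M) =
        (\<integral>v. step_remainder B L n (norm v) \<partial>distr M borel (\<psi> k t))" for k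
      by (subst integral_distr) auto
    note this[of n] this[of 0]
    then show ?thesis by (simp only: \<psi>_identically[OF t, of n])
  qed
  have "(\<lambda>n. \<integral>w. step_remainder B L n (norm (\<psi> 0 t w)) \<partial>M) \<longlonglongrightarrow> (\<integral>w. 0 \<partial>M)"
  proof (rule integral_dominated_convergence[where w = "\<lambda>w. L * norm (\<psi> 0 t w)"])
    show "AE w in M. (\<lambda>n. step_remainder B L n (norm (\<psi> 0 t w))) \<longlonglongrightarrow> 0"
    proof (rule AE_I2)
      fix w
      have "(\<lambda>n. B * (norm (\<psi> 0 t w))\<^sup>2 / real (Suc n)) \<longlonglongrightarrow> 0"
        by (rule LIMSEQ_Suc[OF lim_const_over_n])
      then show "(\<lambda>n. step_remainder B L n (norm (\<psi> 0 t w))) \<longlonglongrightarrow> 0"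
        by (rule Lim_null_comparison[rotated])
          (use B L in \<open>auto simp: step_remainder_def intro!: always_eventually\<close>)
    qed
  qed (use B L \<psi>_integrable[OF t] in \<open>auto simp: step_remainder_def intro!: AE_I2\<close>)
  then show ?thesis by (simp add: eq)
qed

text \<open>Uniformity over random parameters comes from replacing the parameter by the nearest point of a
  finite net.\<close>

lemma step_remainder_parameter_tendsto:
  assumes B: "0 \<le> B" and L: "0 \<le> L" and X: "\<And>n. parameter n (X n)"
  shows "(\<lambda>n. \<integral>w. step_remainder B L n (norm (\<psi> n (X n w) w)) \<partial>M) \<longlonglongrightarrow> 0"
proof (rule tendsto_0_approx)
  show "0 \<le> (\<integral>w. step_remainder B L n (norm (\<psi> n (X n w) w)) \<partial>M)" for n
    using B L by (intro integral_nonneg_AE) (auto simp: step_remainder_def)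
  fix e :: real assume e: "0 < e"
  \<comment> \<open>With \<open>C * r \<le> d\<close>, the score changes by at most
    \<open>2 * d\<close> in L1 when the parameter moves by less than \<open>r\<close>, and the
    factor \<open>2 * L\<close> from \<open>step_remainder_add\<close> gives at most
    \<open>e\<close>. The added ones in \<open>d\<close> and \<open>r\<close> cover
    \<open>L = 0\<close> and \<open>C = 0\<close>.\<close>
  define d where "d = e / (4 * (L + 1))"
  have d: "0 < d" using e L by (simp add: d_def)
  then obtain C where C: "0 \<le> C" "\<And>n X Y. parameter n X \<Longrightarrow> parameter n Y \<Longrightarrow>
      integrable M (\<lambda>w. norm (\<psi> n (X w) w - \<psi> n (Y w) w)) \<and>
      (\<integral>w. norm (\<psi> n (X w) w - \<psi> n (Y w) w) \<partial>M) \<le> d + C * (\<integral>w. norm (X w - Y w) \<partial>M)"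
    by (rule score_L1_le) (rule that)
  define r where "r = d / (C + 1)"
  have r: "0 < r" using d C(1) by (simp add: r_def)
  obtain N where N: "finite N" "N \<subseteq> S" "S \<subseteq> (\<Union>x\<in>N. ball x r)"
    by (rule compactE_image[OF S_compact, of S "\<lambda>x. ball x r"]) (use r in \<open>auto intro: that\<close>)
  obtain ts where ts: "set ts = N" using finite_list[OF N(1)] by blast
  \<comment> \<open>Taking the least admissible index makes the choice of a net point measurable, so
    that the discretized parameter is still predictable.\<close>
  define ix where "ix = (\<lambda>x. LEAST i. i < length ts \<and> norm (x - ts ! i) < r)"
  have ix: "ix x < length ts" "norm (x - ts ! ix x) < r" if x: "x \<in> S" for x
  proof -
    obtain t where "t \<in> N" "dist t x < r" using N(3) x by auto
    then obtain i where "i < length ts \<and> norm (x - ts ! i) < r"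
      using ts by (auto simp: in_set_conv_nth dist_norm norm_minus_commute)
    then have "ix x < length ts \<and> norm (x - ts ! ix x) < r" unfolding ix_def by (rule LeastI)
    then show "ix x < length ts" "norm (x - ts ! ix x) < r" by auto
  qed
  define Y where "Y n w = ts ! ix (X n w)" for n w
  have YN: "Y n w \<in> N" if "w \<in> space M" for n w
    using ix[OF parameter_in[OF X that]] ts nth_mem unfolding Y_def by blast
  have Y: "parameter n (Y n)" for n
  proof -
    have [measurable]: "X n \<in> borel_measurable (F n)" using X by (simp add: parameter_def)
    have ixm: "(\<lambda>w. ix (X n w)) \<in> F n \<rightarrow>\<^sub>M count_space UNIV"
      unfolding ix_def by measurable
    have "Y n \<in> borel_measurable (F n)"
      unfolding Y_def[abs_def] using ixm by measurable
    then show ?thesis using YN N(2) by (auto simp: parameter_def)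
  qed
  have XY: "(\<integral>w. norm (X n w - Y n w) \<partial>M) \<le> r" for n
  proof -
    have "(\<integral>w. norm (X n w - Y n w) \<partial>M) \<le> (\<integral>w. r \<partial>M)"
      using parameter_diff_integrable[OF X Y] ix(2)[OF parameter_in[OF X]]
      by (intro integral_mono) (auto simp: Y_def less_imp_le)
    then show ?thesis by (simp add: prob_space)
  qed
  have diff: "2 * L * (\<integral>w. norm (\<psi> n (X n w) w - \<psi> n (Y n w) w) \<partial>M) \<le> e" for n
  proof -
    have "C * (\<integral>w. norm (X n w - Y n w) \<partial>M) \<le> C * r" using C(1) XY by (intro mult_left_mono) auto
    also have "\<dots> \<le> d" using C(1) d by (simp add: r_def field_simps)
    finally have "(\<integral>w. norm (\<psi> n (X n w) w - \<psi> n (Y n w) w) \<partial>M) \<le> 2 * d"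
      using C(2)[OF X Y, THEN conjunct2, of n] by linarith
    then have "2 * L * (\<integral>w. norm (\<psi> n (X n w) w - \<psi> n (Y n w) w) \<partial>M) \<le> 2 * L * (2 * d)"
      using L by (intro mult_left_mono) auto
    also have "\<dots> \<le> e" using L e by (simp add: d_def field_simps)
    finally show ?thesis .
  qed
  let ?b = "\<lambda>n. 4 * (\<Sum>t\<in>N. \<integral>w. step_remainder B L n (norm (\<psi> n t w)) \<partial>M)"
  have "(\<integral>w. step_remainder B L n (norm (\<psi> n (X n w) w)) \<partial>M) \<le> e + ?b n" for n
  proof -
    have si: "integrable M (\<lambda>w. step_remainder B L n (norm (\<psi> n t w)))" if "t \<in> N" for t
      using step_remainder_score_integrable[OF B L parameter_const] that N(2) by auto
    note di = score_diff_integrable[OF X Y, of n]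
    have "(\<integral>w. step_remainder B L n (norm (\<psi> n (X n w) w)) \<partial>M) \<le>
        (\<integral>w. 4 * (\<Sum>t\<in>N. step_remainder B L n (norm (\<psi> n t w))) + 2 * L * norm (\<psi> n (X n w) w - \<psi> n (Y n w) w) \<partial>M)"
    proof (rule integral_mono)
      fix w assume w: "w \<in> space M"
      have "step_remainder B L n (norm (\<psi> n (X n w) w)) \<le>
          4 * step_remainder B L n (norm (\<psi> n (Y n w) w)) + 2 * L * norm (\<psi> n (X n w) w - \<psi> n (Y n w) w)"
        by (rule step_remainder_add[OF B L]) (auto simp: norm_triangle_sub)
      \<comment> \<open>All terms are nonnegative, so the sum over the finite net dominates the one
        term selected by the outcome; only fixed parameters remain.\<close>
      also have "step_remainder B L n (norm (\<psi> n (Y n w) w)) \<le> (\<Sum>t\<in>N. step_remainder B L n (norm (\<psi> n t w)))"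
        using B L by (intro member_le_sum[OF YN[OF w]] N(1)) (auto simp: step_remainder_def)
      finally show "step_remainder B L n (norm (\<psi> n (X n w) w)) \<le>
          4 * (\<Sum>t\<in>N. step_remainder B L n (norm (\<psi> n t w))) + 2 * L * norm (\<psi> n (X n w) w - \<psi> n (Y n w) w)"
        by simp
    qed (use step_remainder_score_integrable[OF B L X] si di in auto)
    also have "\<dots> = ?b n + 2 * L * (\<integral>w. norm (\<psi> n (X n w) w - \<psi> n (Y n w) w) \<partial>M)"
      using si di by (subst Bochner_Integration.integral_add) (auto simp: Bochner_Integration.integral_sum)
    finally show ?thesis using diff[of n] by linarith
  qed
  moreover have "?b \<longlonglongrightarrow> 4 * (\<Sum>t\<in>N. 0)"
    using N(2) by (intro tendsto_intros step_remainder_score_tendsto B L) auto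
  ultimately show "\<exists>b. b \<longlonglongrightarrow> 0 \<and> (\<forall>n. (\<integral>w. step_remainder B L n (norm (\<psi> n (X n w) w)) \<partial>M) \<le> e + b n)"
    by (intro exI[of _ ?b]) simp
qed

section \<open>Convergence of the projected sequence\<close>

primrec projected_seq :: "real \<Rightarrow> real^'d \<Rightarrow> nat \<Rightarrow> 'a \<Rightarrow> real^'d" where
  "projected_seq \<beta> t0 0 w = t0"
| "projected_seq \<beta> t0 (Suc n) w = closest_point S
     (projected_seq \<beta> t0 n w + (\<beta> / real (Suc n)) *\<^sub>R \<psi> n (projected_seq \<beta> t0 n w) w)"

lemma projected_seq_parameter:
  assumes "t0 \<in> S"
  shows "parameter n (projected_seq \<beta> t0 n)"
proof (induction n)
  case 0 then show ?case using assms by (simp add: parameter_def projected_seq.simps(1)[abs_def])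
next
  case (Suc n)
  have "projected_seq \<beta> t0 n \<in> borel_measurable (F (Suc n))"
    using Suc F_mono[of n] by (auto simp: parameter_def measurable_def space_F)
  moreover note parameter_adapted(1)[OF Suc]
  moreover have "closest_point S \<in> borel_measurable borel"
    by (intro borel_measurable_continuous_onI continuous_on_closest_point S_convex S_closed S_nonempty)
  ultimately have "(\<lambda>w. closest_point S (projected_seq \<beta> t0 n w + (\<beta> / real (Suc n)) *\<^sub>R \<psi> n (projected_seq \<beta> t0 n w) w))
      \<in> borel_measurable (F (Suc n))"
    by measurable
  then show ?case
    using closest_point_in_set[OF S_closed S_nonempty] by (simp add: parameter_def)
qed

text \<open>The remainder is the smaller of two bounds. Nonexpansiveness of the projection with
  respect to \<open>\<theta>s\<close> gives the quadratic expansion. With respect to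
  \<open>x\<close> it bounds the step by \<open>c * norm v\<close>, and since distances to
  \<open>\<theta>s\<close> are at most the diameter, their squares change at most linearly in
  \<open>norm v\<close>.\<close>

lemma projected_step_le:
  assumes \<beta>: "0 \<le> \<beta>" and x: "x \<in> S"
  shows "(norm (closest_point S (x + (\<beta> / real (Suc n)) *\<^sub>R v) - \<theta>s))\<^sup>2 \<le>
    (norm (x - \<theta>s))\<^sup>2 + 2 * \<beta> / real (Suc n) * ((x - \<theta>s) \<bullet> v)
      + step_remainder (\<beta>\<^sup>2) (4 * \<beta> * diameter S) n (norm v) / real (Suc n)"
proof -
  define c where "c = \<beta> / real (Suc n)"
  define z where "z = closest_point S (x + c *\<^sub>R v)"
  define D where "D = diameter S"
  have c: "0 \<le> c" using \<beta> by (simp add: c_def)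
  have D: "0 \<le> D" unfolding D_def by (rule diameter_S_nonneg)
  have zS: "z \<in> S" unfolding z_def by (rule closest_point_in_set[OF S_closed S_nonempty])
  note lip = closest_point_lipschitz[OF S_convex S_closed S_nonempty, unfolded dist_norm]
  have "norm (z - \<theta>s) \<le> norm (x + c *\<^sub>R v - \<theta>s)"
    using lip[of "x + c *\<^sub>R v" \<theta>s] closest_point_self[OF \<theta>s_in_S] by (simp add: z_def)
  then have "(norm (z - \<theta>s))\<^sup>2 \<le> (norm ((x - \<theta>s) + c *\<^sub>R v))\<^sup>2"
    by (intro power_mono) (auto simp: algebra_simps)
  also have "\<dots> = (norm (x - \<theta>s))\<^sup>2 + 2 * c * ((x - \<theta>s) \<bullet> v) + c\<^sup>2 * (norm v)\<^sup>2"
    by (simp only: power2_norm_eq_inner)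
      (simp add: inner_add_left inner_add_right inner_commute power2_eq_square algebra_simps)
  finally have quad: "(norm (z - \<theta>s))\<^sup>2 \<le> (norm (x - \<theta>s))\<^sup>2 + 2 * c * ((x - \<theta>s) \<bullet> v) + c\<^sup>2 * (norm v)\<^sup>2" .
  have zx: "norm (z - x) \<le> c * norm v"
    using lip[of "x + c *\<^sub>R v" x] closest_point_self[OF x] c by (simp add: z_def)
  have "(norm (z - \<theta>s))\<^sup>2 - (norm (x - \<theta>s))\<^sup>2 = (norm (z - \<theta>s) - norm (x - \<theta>s)) * (norm (z - \<theta>s) + norm (x - \<theta>s))"
    by (simp add: power2_eq_square algebra_simps)
  also have "\<dots> \<le> \<bar>norm (z - \<theta>s) - norm (x - \<theta>s)\<bar> * (norm (z - \<theta>s) + norm (x - \<theta>s))"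
    by (intro mult_right_mono) auto
  also have "\<dots> \<le> (c * norm v) * (D + D)"
  proof (intro mult_mono add_mono)
    show "\<bar>norm (z - \<theta>s) - norm (x - \<theta>s)\<bar> \<le> c * norm v"
      using norm_triangle_ineq3[of "z - \<theta>s" "x - \<theta>s"] zx by simp
  qed (use zS x \<theta>s_in_S c in \<open>auto simp: D_def intro: dist_le_diameter\<close>)
  finally have 1: "(norm (z - \<theta>s))\<^sup>2 - (norm (x - \<theta>s))\<^sup>2 \<le> 2 * c * (D * norm v)" by (simp add: algebra_simps)
  \<comment> \<open>The linear bound must carry the inner product term as well; inserting it costs a
    second \<open>2 * c * D * norm v\<close>, whence the factor 4.\<close>
  have "- ((x - \<theta>s) \<bullet> v) \<le> norm (x - \<theta>s) * norm v"
    using Cauchy_Schwarz_ineq2[of "x - \<theta>s" v] by linarith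
  also have "\<dots> \<le> D * norm v"
    unfolding D_def using x \<theta>s_in_S by (intro mult_right_mono dist_le_diameter) auto
  finally have "2 * c * (- ((x - \<theta>s) \<bullet> v)) \<le> 2 * c * (D * norm v)"
    using c by (intro mult_left_mono) auto
  with 1 have linear: "(norm (z - \<theta>s))\<^sup>2 \<le> (norm (x - \<theta>s))\<^sup>2 + 2 * c * ((x - \<theta>s) \<bullet> v) + 4 * c * D * norm v"
    by (simp add: algebra_simps)
  have "step_remainder (\<beta>\<^sup>2) (4 * \<beta> * D) n (norm v) / real (Suc n) = min (c\<^sup>2 * (norm v)\<^sup>2) (4 * c * D * norm v)"
    unfolding step_remainder_def c_def
    by (simp add: min_divide_distrib_right power_divide power2_eq_square)
  then show ?thesis
    using quad linear unfolding z_def c_def D_def by (simp add: min_def)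
qed

text \<open>Multiplied by \<open>n + 1\<close>, the drift subtracts
  \<open>2 * \<beta> * K1 * a n\<close>, hence at least \<open>a n\<close>. What is left telescopes
  and bounds \<open>a n\<close> by the Cesaro mean of the expected remainders.\<close>

lemma projected_seq_L2_tendsto:
  assumes \<beta>: "0 \<le> \<beta>" and gain: "1 \<le> 2 * \<beta> * K1" and t0: "t0 \<in> S"
  shows "(\<lambda>n. \<integral>w. (norm (projected_seq \<beta> t0 n w - \<theta>s))\<^sup>2 \<partial>M) \<longlonglongrightarrow> 0"
proof -
  let ?X = "projected_seq \<beta> t0"
  let ?g = "\<lambda>n w. step_remainder (\<beta>\<^sup>2) (4 * \<beta> * diameter S) n (norm (\<psi> n (?X n w) w))"
  define a where "a n = (\<integral>w. (norm (?X n w - \<theta>s))\<^sup>2 \<partial>M)" for n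
  define \<eta> where "\<eta> n = (\<integral>w. ?g n w \<partial>M)" for n
  note X = projected_seq_parameter[OF t0, of _ \<beta>]
  have L: "0 \<le> 4 * \<beta> * diameter S" using \<beta> diameter_S_nonneg by simp
  have \<eta>: "\<eta> \<longlonglongrightarrow> 0"
    unfolding \<eta>_def by (rule step_remainder_parameter_tendsto[OF _ L X]) simp
  have gi: "integrable M (?g n)" for n
    by (rule step_remainder_score_integrable[OF _ L X]) simp
  have [measurable]: "?X n \<in> borel_measurable M" "(\<lambda>w. \<psi> n (?X n w) w) \<in> borel_measurable M" for n
    using parameter_measurable[OF X] parameter_score_measurable(1)[OF X] by auto
  note sq = parameter_sq_integrable[OF X]
  note inner = inner_score_integrable[OF X]
  have a0: "0 \<le> a n" for n unfolding a_def by simp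
  have step: "real (Suc n) * a (Suc n) \<le> real n * a n + \<eta> n" for n
  proof -
    have "a (Suc n) \<le> (\<integral>w. (norm (?X n w - \<theta>s))\<^sup>2
        + 2 * \<beta> / real (Suc n) * ((?X n w - \<theta>s) \<bullet> \<psi> n (?X n w) w) + ?g n w / real (Suc n) \<partial>M)"
      unfolding a_def
    proof (rule integral_mono)
      show "(norm (?X (Suc n) w - \<theta>s))\<^sup>2 \<le> (norm (?X n w - \<theta>s))\<^sup>2
        + 2 * \<beta> / real (Suc n) * ((?X n w - \<theta>s) \<bullet> \<psi> n (?X n w) w) + ?g n w / real (Suc n)" if "w \<in> space M" for w
        unfolding projected_seq.simps(2) by (rule projected_step_le[OF \<beta> parameter_in[OF X that]])
      show "integrable M (\<lambda>w. (norm (?X (Suc n) w - \<theta>s))\<^sup>2)" by (rule sq)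
    qed (intro Bochner_Integration.integrable_add integrable_mult_right integrable_divide sq inner gi)
    also have "\<dots> = a n + 2 * \<beta> / real (Suc n) * (\<integral>w. (?X n w - \<theta>s) \<bullet> \<psi> n (?X n w) w \<partial>M) + \<eta> n / real (Suc n)"
      unfolding a_def \<eta>_def using sq[of n] inner[of n] gi[of n]
      by (simp add: Bochner_Integration.integral_add del: of_nat_Suc)
    also have "\<dots> \<le> a n + 2 * \<beta> / real (Suc n) * (- K1 * a n) + \<eta> n / real (Suc n)"
      using score_drift_le[OF X, of n] \<beta> unfolding a_def
      by (intro add_mono mult_left_mono order_refl) auto
    finally have "real (Suc n) * a (Suc n) \<le>
        real (Suc n) * (a n + 2 * \<beta> / real (Suc n) * (- K1 * a n) + \<eta> n / real (Suc n))"
      by (intro mult_left_mono) auto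
    also have "\<dots> = real (Suc n) * a n - 2 * \<beta> * K1 * a n + \<eta> n"
      by (simp add: field_simps del: of_nat_Suc)
    also have "\<dots> \<le> real (Suc n) * a n - 1 * a n + \<eta> n"
      using mult_right_mono[OF gain a0[of n]] by simp
    finally show ?thesis by (simp add: algebra_simps)
  qed
  \<comment> \<open>At \<open>n = 0\<close> the left side is 0, so the initial error drops
    out.\<close>
  have sum: "real n * a n \<le> (\<Sum>k<n. \<eta> k)" for n
  proof (induction n)
    case (Suc n)
    then show ?case using step[of n] by simp
  qed simp
  have "a \<longlonglongrightarrow> 0"
  proof (rule Lim_null_comparison[OF _ cesaro_mean_tendsto_0[OF \<eta>]])
    show "\<forall>\<^sub>F n in sequentially. norm (a n) \<le> (\<Sum>k<n. \<eta> k) / real n"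
      using eventually_gt_at_top[of 0]
    proof eventually_elim
      case (elim n)
      then show ?case using sum[of n] a0[of n] by (simp add: field_simps)
    qed
  qed
  then show ?thesis unfolding a_def .
qed

text \<open>First moments follow from second ones by \<open>y \<le> e + y * y / e\<close>.\<close>

lemma projected_seq_L1_tendsto:
  assumes \<beta>: "0 \<le> \<beta>" and gain: "1 \<le> 2 * \<beta> * K1" and t0: "t0 \<in> S"
  shows "(\<lambda>n. \<integral>w. norm (projected_seq \<beta> t0 n w - \<theta>s) \<partial>M) \<longlonglongrightarrow> 0"
proof (rule tendsto_0_approx)
  let ?X = "projected_seq \<beta> t0"
  note X = projected_seq_parameter[OF t0, of _ \<beta>]
  have [measurable]: "?X n \<in> borel_measurable M" for n by (rule parameter_measurable[OF X])
  note sq = parameter_sq_integrable[OF X]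
  fix e :: real assume e: "0 < e"
  have "(\<integral>w. norm (?X n w - \<theta>s) \<partial>M) \<le> (\<integral>w. e + (norm (?X n w - \<theta>s))\<^sup>2 / e \<partial>M)" for n
  proof (rule integral_mono)
    show "integrable M (\<lambda>w. norm (?X n w - \<theta>s))"
      by (rule parameter_diff_integrable[OF X parameter_const[OF \<theta>s_in_S]])
    fix w
    have "2 * e * norm (?X n w - \<theta>s) \<le> e\<^sup>2 + (norm (?X n w - \<theta>s))\<^sup>2"
      using sum_squares_bound[of e "norm (?X n w - \<theta>s)"] by simp
    moreover have "0 \<le> e * norm (?X n w - \<theta>s)" using e by simp
    ultimately have "e * norm (?X n w - \<theta>s) \<le> e\<^sup>2 + (norm (?X n w - \<theta>s))\<^sup>2" by linarith
    then show "norm (?X n w - \<theta>s) \<le> e + (norm (?X n w - \<theta>s))\<^sup>2 / e"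
      using e by (simp add: field_simps power2_eq_square)
  qed (use sq in auto)
  then have "(\<integral>w. norm (?X n w - \<theta>s) \<partial>M) \<le> e + (\<integral>w. (norm (?X n w - \<theta>s))\<^sup>2 \<partial>M) / e" for n
    using sq by (simp add: Bochner_Integration.integral_add prob_space)
  moreover have "(\<lambda>n. (\<integral>w. (norm (?X n w - \<theta>s))\<^sup>2 \<partial>M) / e) \<longlonglongrightarrow> 0"
    using tendsto_divide_zero[OF projected_seq_L2_tendsto[OF assms], of e] by simp
  ultimately show "\<exists>b. b \<longlonglongrightarrow> 0 \<and> (\<forall>n. (\<integral>w. norm (?X n w - \<theta>s) \<partial>M) \<le> e + b n)"
    by blast
qed simp

text \<open>The value at the origin of the affine expansion of the score around \<open>t\<close>.
  These are the summands left after the summation by parts.\<close>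

definition linearized_score :: "nat \<Rightarrow> real^'d \<Rightarrow> 'a \<Rightarrow> real^'d" where
  "linearized_score n t w = \<psi> n t w - \<Psi> n t w *v t"

lemma linearized_score_measurable:
  assumes X: "parameter n X"
  shows "(\<lambda>w. linearized_score n (X w) w) \<in> borel_measurable M"
proof -
  show ?thesis
    unfolding linearized_score_def
    by (intro borel_measurable_diff borel_measurable_matrix_vector_mult
        parameter_score_measurable[OF X] parameter_measurable[OF X])
qed

text \<open>The difference splits into three: the score difference, the Jacobian difference applied
  to a bounded vector, and the Jacobian at \<open>\<theta>s\<close> applied to
  \<open>X n w - \<theta>s\<close>. In the last one neither factor is small by itself in a uniform
  sense, and uniform integrability is used.\<close>

lemma linearized_score_L1_tendsto:
  assumes X: "\<And>n. parameter n (X n)" and lim: "(\<lambda>n. \<integral>w. norm (X n w - \<theta>s) \<partial>M) \<longlonglongrightarrow> 0"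
  shows "integrable M (\<lambda>w. norm (linearized_score n (X n w) w - linearized_score n \<theta>s w))"
    and "(\<lambda>n. \<integral>w. norm (linearized_score n (X n w) w - linearized_score n \<theta>s w) \<partial>M) \<longlonglongrightarrow> 0"
proof -
  note c = parameter_const[OF \<theta>s_in_S]
  note [measurable] = parameter_measurable[OF X] parameter_score_measurable[OF X]
    \<Psi>_measurable[OF \<theta>s_in_S] linearized_score_measurable[OF X] linearized_score_measurable[OF c]
  obtain R where R: "0 \<le> R" "\<And>t. t \<in> S \<Longrightarrow> norm t \<le> R"
    using S_bounded \<theta>s_in_S norm_ge_zero order_trans unfolding bounded_iff by metis
  let ?d = "\<lambda>n w. norm (X n w - \<theta>s)"
  let ?A = "\<lambda>n w. norm (\<psi> n (X n w) w - \<psi> n \<theta>s w)"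
  let ?B = "\<lambda>n w. norm (\<Psi> n (X n w) w - \<Psi> n \<theta>s w)"
  let ?C = "\<lambda>n w. ?d n w * norm (\<Psi> n \<theta>s w)"
  have di: "integrable M (?d n)" for n by (rule parameter_diff_integrable[OF X c])
  have Ai: "integrable M (?A n)" for n by (rule score_diff_integrable[OF X c])
  have dd: "?d n w \<le> diameter S" if "w \<in> space M" for n w
    using parameter_in[OF X that] \<theta>s_in_S by (rule dist_le_diameter)
  have Bnn: "(\<integral>\<^sup>+w. ennreal (?B n w) \<partial>M) \<le> ennreal (K3 * (\<integral>w. ?d n w \<partial>M))" for n
    using nn_integral_jac_diff_le[OF X, of n] K3_nonneg di[of n]
    by (subst (asm) (2) nn_integral_eq_integral) auto
  have Bi: "integrable M (?B n)" for n
    using Bnn[of n] by (intro integrableI_bounded) (auto intro: le_less_trans)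
  have B: "(\<integral>w. ?B n w \<partial>M) \<le> K3 * (\<integral>w. ?d n w \<partial>M)" for n
    using Bnn[of n] K3_nonneg
    by (subst (asm) nn_integral_eq_integral[OF Bi]) (auto simp: ennreal_le_iff)
  have Ci: "integrable M (?C n)" for n
    by (rule Bochner_Integration.integrable_bound[of _ "\<lambda>w. diameter S * norm (\<Psi> n \<theta>s w)"])
      (use dd \<Psi>_integrable diameter_S_nonneg in \<open>auto simp: abs_mult intro!: AE_I2 mult_right_mono\<close>)
  have le: "norm (linearized_score n (X n w) w - linearized_score n \<theta>s w) \<le> ?A n w + (R * ?B n w + ?C n w)"
    if w: "w \<in> space M" for n w
  proof -
    have "linearized_score n (X n w) w - linearized_score n \<theta>s w = (\<psi> n (X n w) w - \<psi> n \<theta>s w)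
        + (- ((\<Psi> n (X n w) w - \<Psi> n \<theta>s w) *v X n w) + - (\<Psi> n \<theta>s w *v (X n w - \<theta>s)))"
      by (simp add: linearized_score_def matrix_vector_mult_diff_distrib matrix_vector_mult_diff_rdistrib)
    also have "norm \<dots> \<le> ?A n w + (?B n w * norm (X n w) + norm (\<Psi> n \<theta>s w) * ?d n w)"
      by (intro norm_triangle_mono) (auto simp: norm_matrix_vector_mult_le)
    also have "?B n w * norm (X n w) \<le> ?B n w * R"
      by (intro mult_left_mono R parameter_in[OF X w]) auto
    finally show ?thesis by (simp add: mult.commute)
  qed
  show i: "integrable M (\<lambda>w. norm (linearized_score n (X n w) w - linearized_score n \<theta>s w))" for n
    by (rule Bochner_Integration.integrable_bound[of _ "\<lambda>w. ?A n w + (R * ?B n w + ?C n w)"])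
      (use Ai Bi Ci le in \<open>auto intro!: AE_I2 intro: order_trans[OF _ abs_ge_self]\<close>)
  have bound: "(\<integral>w. norm (linearized_score n (X n w) w - linearized_score n \<theta>s w) \<partial>M) \<le>
      (\<integral>w. ?A n w \<partial>M) + (R * (K3 * (\<integral>w. ?d n w \<partial>M)) + (\<integral>w. ?C n w \<partial>M))" for n
  proof -
    have "(\<integral>w. norm (linearized_score n (X n w) w - linearized_score n \<theta>s w) \<partial>M) \<le>
        (\<integral>w. ?A n w + (R * ?B n w + ?C n w) \<partial>M)"
      by (rule integral_mono[OF i]) (use Ai Bi Ci le in auto)
    also have "\<dots> = (\<integral>w. ?A n w \<partial>M) + (R * (\<integral>w. ?B n w \<partial>M) + (\<integral>w. ?C n w \<partial>M))"
      using Ai[of n] Bi[of n] Ci[of n] by simp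
    also have "R * (\<integral>w. ?B n w \<partial>M) \<le> R * (K3 * (\<integral>w. ?d n w \<partial>M))"
      by (intro mult_left_mono B R)
    finally show ?thesis by simp
  qed
  have "(\<lambda>n. \<integral>w. ?A n w \<partial>M) \<longlonglongrightarrow> 0"
    using score_L1_tendsto[of "\<lambda>n. n" X "\<lambda>_ _. \<theta>s"] X c lim by simp
  moreover have "(\<lambda>n. \<integral>w. ?C n w \<partial>M) \<longlonglongrightarrow> 0"
    using weighted_jac_tendsto[of ?d] dd lim by simp
  ultimately have "(\<lambda>n. (\<integral>w. ?A n w \<partial>M) + (R * (K3 * (\<integral>w. ?d n w \<partial>M)) + (\<integral>w. ?C n w \<partial>M)))
      \<longlonglongrightarrow> 0 + (R * (K3 * 0) + 0)"
    by (intro tendsto_intros lim)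
  then have lim0: "(\<lambda>n. (\<integral>w. ?A n w \<partial>M) + (R * (K3 * (\<integral>w. ?d n w \<partial>M)) + (\<integral>w. ?C n w \<partial>M))) \<longlonglongrightarrow> 0"
    by simp
  show "(\<lambda>n. \<integral>w. norm (linearized_score n (X n w) w - linearized_score n \<theta>s w) \<partial>M) \<longlonglongrightarrow> 0"
    by (rule Lim_null_comparison[OF always_eventually lim0]) (use bound in simp)
qed

end

section \<open>The likelihood of a Markov transition density\<close>

lemma grad_on_has_derivative:
  assumes "f differentiable (at \<theta> within S)"
  shows "(f has_derivative (\<lambda>h. grad_on S f \<theta> \<bullet> h)) (at \<theta> within S)"
proof -
  let ?D = "frechet_derivative f (at \<theta> within S)"
  have D: "(f has_derivative ?D) (at \<theta> within S)"
    using assms by (simp add: frechet_derivative_works)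
  interpret D: bounded_linear ?D using D by (rule has_derivative_bounded_linear)
  have "?D h = grad_on S f \<theta> \<bullet> h" for h
  proof -
    have "?D h = ?D (\<Sum>i\<in>UNIV. h $ i *\<^sub>R axis i 1)"
      by (subst basis_expansion[of h, symmetric]) (simp add: scalar_mult_eq_scaleR)
    also have "\<dots> = grad_on S f \<theta> \<bullet> h"
      by (simp add: D.sum D.scaleR grad_on_def inner_vec_def mult.commute)
    finally show ?thesis .
  qed
  then have "?D = (\<lambda>h. grad_on S f \<theta> \<bullet> h)" by (rule ext)
  with D show ?thesis by (simp only:)
qed

lemma hess_on_has_derivative:
  "grad_on S f differentiable (at \<theta> within S) \<Longrightarrow>
    (grad_on S f has_derivative (\<lambda>h. hess_on S f \<theta> *v h)) (at \<theta> within S)"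
  unfolding hess_on_def by (simp add: jacobian_works)

text \<open>If no side degenerates, derivatives within the box are unique at boundary points too, so
  that \<open>grad_on\<close> and \<open>hess_on\<close> can be computed by the usual rules.\<close>

locale nondegenerate_box =
  fixes l u :: "real^'d"
  assumes l_less_u: "l $ i < u $ i"
begin

lemma derivative_unique:
  fixes f :: "real^'d \<Rightarrow> 'b::real_normed_vector"
  assumes "\<theta> \<in> cbox l u" "(f has_derivative f') (at \<theta> within cbox l u)" "(f has_derivative f'') (at \<theta> within cbox l u)"
  shows "f' = f''"
  using assms by (intro frechet_derivative_unique_within_closed_interval[of l u \<theta> f])
    (auto simp: Basis_vec_def inner_axis l_less_u)

lemma grad_on_eqI:
  assumes \<theta>: "\<theta> \<in> cbox l u" and f: "(f has_derivative (\<lambda>h. g \<bullet> h)) (at \<theta> within cbox l u)"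
  shows "grad_on (cbox l u) f \<theta> = g"
proof -
  have "(\<lambda>h. grad_on (cbox l u) f \<theta> \<bullet> h) = (\<lambda>h. g \<bullet> h)"
    using f by (intro derivative_unique[OF \<theta> grad_on_has_derivative f]) (auto simp: differentiable_def)
  then show ?thesis by (metis vector_eq_rdot)
qed

lemma jacobian_eqI:
  fixes f :: "real^'d \<Rightarrow> real^'n"
  assumes \<theta>: "\<theta> \<in> cbox l u" and f: "(f has_derivative (\<lambda>h. A *v h)) (at \<theta> within cbox l u)"
  shows "jacobian f (at \<theta> within cbox l u) = A"
proof -
  have "(f has_derivative (\<lambda>h. jacobian f (at \<theta> within cbox l u) *v h)) (at \<theta> within cbox l u)"
    using f unfolding jacobian_works[symmetric] differentiable_def by blast
  from derivative_unique[OF \<theta> this f] show ?thesis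
    by (simp add: fun_eq_iff matrix_eq)
qed

text \<open>Intended for the total mass of the transition density, which is known to be 1 only for
  parameters in the box.\<close>

lemma grad_on_const:
  assumes "\<And>t. t \<in> cbox l u \<Longrightarrow> f t = c" "\<theta> \<in> cbox l u"
  shows "grad_on (cbox l u) f \<theta> = 0"
proof (rule grad_on_eqI[OF assms(2)])
  show "(f has_derivative (\<lambda>h. 0 \<bullet> h)) (at \<theta> within cbox l u)"
    by (rule has_derivative_transform[OF assms(2) _ has_derivative_const[of c, THEN has_derivative_eq_rhs]])
      (use assms in auto)
qed

lemma hess_on_const:
  assumes "\<And>t. t \<in> cbox l u \<Longrightarrow> f t = c" "\<theta> \<in> cbox l u"
  shows "hess_on (cbox l u) f \<theta> = 0"
  unfolding hess_on_def
proof (rule jacobian_eqI[OF assms(2)])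
  show "(grad_on (cbox l u) f has_derivative (\<lambda>h. 0 *v h)) (at \<theta> within cbox l u)"
    by (rule has_derivative_transform[OF assms(2) _ has_derivative_const[of 0, THEN has_derivative_eq_rhs]])
      (use grad_on_const[OF assms(1)] in auto)
qed

context
  fixes q :: "real^'d \<Rightarrow> real"
  assumes q_pos: "\<theta> \<in> cbox l u \<Longrightarrow> 0 < q \<theta>" and q_diff: "thrice_differentiable_on q (cbox l u)"
begin

private abbreviation (input) "B \<equiv> cbox l u"

private lemma q_deriv: "\<theta> \<in> B \<Longrightarrow> (q has_derivative (\<lambda>h. grad_on B q \<theta> \<bullet> h)) (at \<theta> within B)"
  using q_diff unfolding thrice_differentiable_on_def twice_differentiable_on_def differentiable_on_def
  by (intro grad_on_has_derivative) auto

private lemma grad_deriv: "\<theta> \<in> B \<Longrightarrow> (grad_on B q has_derivative (\<lambda>h. hess_on B q \<theta> *v h)) (at \<theta> within B)"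
  using q_diff unfolding thrice_differentiable_on_def twice_differentiable_on_def differentiable_on_def
  by (intro hess_on_has_derivative) auto

lemma grad_on_ln:
  assumes \<theta>: "\<theta> \<in> B"
  shows "grad_on B (\<lambda>t. ln (q t)) \<theta> = (1 / q \<theta>) *\<^sub>R grad_on B q \<theta>"
proof (rule grad_on_eqI[OF \<theta>])
  show "((\<lambda>t. ln (q t)) has_derivative (\<lambda>h. ((1 / q \<theta>) *\<^sub>R grad_on B q \<theta>) \<bullet> h)) (at \<theta> within B)"
    using has_derivative_ln[OF q_pos[OF \<theta>] q_deriv[OF \<theta>]] by (simp add: divide_inverse mult.commute)
qed

lemma grad_on_ln_has_derivative:
  assumes \<theta>: "\<theta> \<in> B"
  shows "(grad_on B (\<lambda>t. ln (q t)) has_derivative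
    (\<lambda>h. ((1 / q \<theta>) *\<^sub>R hess_on B q \<theta> - outer (grad_on B (\<lambda>t. ln (q t)) \<theta>)) *v h)) (at \<theta> within B)"
proof (rule has_derivative_transform[OF \<theta>])
  show "grad_on B (\<lambda>t. ln (q t)) t = (1 / q t) *\<^sub>R grad_on B q t" if "t \<in> B" for t
    by (rule grad_on_ln[OF that])
  note q0 = less_imp_neq[OF q_pos[OF \<theta>], symmetric]
  \<comment> \<open>The rank-one matrix \<open>outer v\<close> arises from differentiating the
    factor \<open>1 / q\<close>.\<close>
  have out: "outer v *v h = (v \<bullet> h) *\<^sub>R v" for v h :: "real^'d"
    by (simp add: outer_def vec_eq_iff matrix_vector_mult_def inner_vec_def sum_distrib_right sum_distrib_left mult_ac)
  have "((\<lambda>t. inverse (q t) *\<^sub>R grad_on B q t) has_derivative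
      (\<lambda>h. inverse (q \<theta>) *\<^sub>R (hess_on B q \<theta> *v h)
        + (- (inverse (q \<theta>) * (grad_on B q \<theta> \<bullet> h) * inverse (q \<theta>))) *\<^sub>R grad_on B q \<theta>)) (at \<theta> within B)"
    by (intro has_derivative_scaleR Deriv.has_derivative_inverse q0 q_deriv grad_deriv \<theta>)
  then show "((\<lambda>t. (1 / q t) *\<^sub>R grad_on B q t) has_derivative
      (\<lambda>h. ((1 / q \<theta>) *\<^sub>R hess_on B q \<theta> - outer (grad_on B (\<lambda>t. ln (q t)) \<theta>)) *v h)) (at \<theta> within B)"
    by (simp add: grad_on_ln[OF \<theta>] matrix_vector_mult_diff_rdistrib scaleR_matrix_vector_assoc[symmetric]
        out inverse_eq_divide mult_ac)
qed

lemma hess_on_ln: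
  assumes \<theta>: "\<theta> \<in> B"
  shows "hess_on B (\<lambda>t. ln (q t)) \<theta> = (1 / q \<theta>) *\<^sub>R hess_on B q \<theta> - outer (grad_on B (\<lambda>t. ln (q t)) \<theta>)"
  unfolding hess_on_def[of _ "\<lambda>t. ln (q t)"]
  by (rule jacobian_eqI[OF \<theta> grad_on_ln_has_derivative[OF \<theta>]])

text \<open>Third-order differentiability provides continuity of the Hessian of \<open>q\<close>;
  the quotient formula transfers it to the logarithm.\<close>

lemma continuous_on_hess_on_ln: "continuous_on B (hess_on B (\<lambda>t. ln (q t)))"
proof (rule continuous_on_eq)
  have q: "continuous_on B q" and g: "continuous_on B (grad_on B q)" and h: "continuous_on B (hess_on B q)"
    using q_diff unfolding thrice_differentiable_on_def twice_differentiable_on_def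
    by (auto intro: differentiable_imp_continuous_on)
  have q0: "\<forall>\<theta>\<in>B. q \<theta> \<noteq> 0" using q_pos less_imp_neq by metis
  show "continuous_on B (\<lambda>\<theta>. (1 / q \<theta>) *\<^sub>R hess_on B q \<theta> - outer ((1 / q \<theta>) *\<^sub>R grad_on B q \<theta>))"
    unfolding outer_def by (intro continuous_intros q g h q0)
  show "(1 / q \<theta>) *\<^sub>R hess_on B q \<theta> - outer ((1 / q \<theta>) *\<^sub>R grad_on B q \<theta>) = hess_on B (\<lambda>t. ln (q t)) \<theta>" if "\<theta> \<in> B" for \<theta>
    by (simp add: hess_on_ln[OF that] grad_on_ln[OF that])
qed

end

end

section \<open>Histories, shifts and the law of the first two values\<close>

lemma space_history: "space (history n) = UNIV"
  by (simp add: history_def)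

lemma space_path_space: "space path_space = UNIV"
  by (simp add: path_space_def space_PiM)

lemma obs_measurable_path: "obs n \<in> path_space \<rightarrow>\<^sub>M borel"
  unfolding obs_def[abs_def] path_space_def by measurable

lemma obs_measurable_history: "i \<le> n \<Longrightarrow> obs i \<in> history n \<rightarrow>\<^sub>M borel"
  by (rule measurableI) (auto simp: history_def intro!: sigma_sets.Basic)

lemma sets_history: "sets (history n) \<subseteq> sets path_space"
proof -
  have "obs i -` A \<in> sets path_space" if "A \<in> sets borel" for i and A :: "real set"
    using measurable_sets[OF obs_measurable_path that, of i] by (simp add: space_path_space)
  then have "sigma_sets (space path_space) {obs i -` A | i A. i \<le> n \<and> A \<in> sets borel} \<subseteq> sets path_space"
    by (intro sets.sigma_sets_subset) auto
  then show ?thesis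
    by (simp add: history_def space_path_space)
qed

lemma sets_history_mono: "sets (history n) \<subseteq> sets (history (Suc n))"
  unfolding history_def by (subst (1 2) sets_measure_of) (auto intro!: sigma_sets_mono' le_SucI)

lemma shift_measurable: "shift \<in> path_space \<rightarrow>\<^sub>M path_space"
  unfolding path_space_def
  by (rule measurable_PiM_single') (auto simp: shift_def)

lemma shift_funpow: "(shift ^^ n) w k = w (k + n)"
  by (induction n arbitrary: k) (auto simp: shift_def)

text \<open>A measurable way to extend two values to a path. The score at time 1 depends on the
  first two values alone, so composing with this map carries its measurability from path space to
  the plane and to the histories.\<close>

definition two_step_path :: "real \<times> real \<Rightarrow> nat \<Rightarrow> real" where
  "two_step_path z k = (if k = 0 then fst z else snd z)"

lemma two_step_path_measurable: "two_step_path \<in> borel \<Otimes>\<^sub>M borel \<rightarrow>\<^sub>M path_space"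
  unfolding path_space_def two_step_path_def[abs_def]
  by (rule measurable_PiM_single') auto

lemma two_step_path_history:
  "(\<lambda>w. two_step_path (obs n w, obs (Suc n) w)) \<in> history (Suc n) \<rightarrow>\<^sub>M path_space"
  by (intro measurable_compose[OF _ two_step_path_measurable] measurable_Pair obs_measurable_history) auto

lemma score_Suc_eq:
  "score T p (Suc n) \<theta> w = score T p 1 \<theta> (two_step_path (obs n w, obs (Suc n) w))"
  "score_jac T p (Suc n) \<theta> w = score_jac T p 1 \<theta> (two_step_path (obs n w, obs (Suc n) w))"
  by (simp_all add: score_def score_jac_def log_lik_def obs_def two_step_path_def)

text \<open>The reading by shifts serves stationarity and ergodic averages, the one by
  \<open>two_step_path\<close> adaptedness.\<close>

lemma score_Suc_eq_shift:
  "score T p (Suc n) \<theta> w = score T p 1 \<theta> ((shift ^^ n) w)"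
  "score_jac T p (Suc n) \<theta> w = score_jac T p 1 \<theta> ((shift ^^ n) w)"
  by (simp_all add: score_def score_jac_def log_lik_def obs_def shift_funpow)

lemma homogeneous_markov_pair_law:
  assumes M: "prob_space M" "sets M = sets path_space"
    and q: "(\<lambda>(x, y). q x y) \<in> borel_measurable (borel \<Otimes>\<^sub>M borel)"
    and markov: "homogeneous_markov M (\<lambda>x. density lborel (\<lambda>y. ennreal (q x y)))"
  shows "distr M (borel \<Otimes>\<^sub>M borel) (\<lambda>w. (obs 0 w, obs 1 w)) =
    density (distr M borel (obs 0) \<Otimes>\<^sub>M lborel) (\<lambda>(x, y). ennreal (q x y))"
proof -
  interpret prob_space M by fact
  have sp: "space M = UNIV" using sets_eq_imp_space_eq[OF M(2)] by (simp add: space_path_space)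
  have [measurable]: "obs n \<in> borel_measurable M" for n
    using obs_measurable_path M(2) by (simp cong: measurable_cong_sets)
  have [measurable]: "(\<lambda>z. ennreal (q (fst z) (snd z))) \<in> borel_measurable (borel \<Otimes>\<^sub>M borel)"
    using q by (simp add: split_beta')
  let ?Q = "\<lambda>x. density lborel (\<lambda>y. ennreal (q x y))"
  interpret H: finite_measure_subalgebra M "history 0"
    using sets_history[of 0] M(2) by unfold_locales (auto simp: subalgebra_def sp space_history)
  have Qp: "prob_space (?Q x)" for x
    using markov measurable_space[of ?Q borel "prob_algebra borel" x]
    by (auto simp: homogeneous_markov_def space_prob_algebra)
  define N where "N = distr M borel (obs 0)"
  interpret N: prob_space N unfolding N_def by (rule prob_space_distr) measurable
  have [measurable_cong]: "sets N = sets borel" by (simp add: N_def)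
  interpret P: pair_sigma_finite N "lborel :: real measure" ..
  have rect: "emeasure (distr M (borel \<Otimes>\<^sub>M borel) (\<lambda>w. (obs 0 w, obs 1 w))) (A \<times> C) =
      emeasure (density (N \<Otimes>\<^sub>M lborel) (\<lambda>(x, y). ennreal (q x y))) (A \<times> C)"
    if A [measurable]: "A \<in> sets borel" and C [measurable]: "C \<in> sets borel" for A C
  proof -
    have qm [measurable]: "(\<lambda>y. ennreal (q x y)) \<in> borel_measurable borel" for x
      using measurable_compose[OF measurable_Pair1'[of x borel borel] q] by simp
    let ?A = "obs 0 -` A"
    have AH: "?A \<in> sets (history 0)"
      using measurable_sets[OF obs_measurable_history[of 0 0] A] by (simp add: space_history)
    then have AM [measurable]: "?A \<in> sets M" using sets_history[of 0] M(2) by blast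
    define k where "k x = (\<integral>\<^sup>+y. ennreal (q x y) * indicator C y \<partial>lborel)" for x
    have k: "k x = emeasure (?Q x) C" for x unfolding k_def by (subst emeasure_density) auto
    have k_measure: "k x = ennreal (measure (?Q x) C)" for x
      unfolding k using Qp by (simp add: finite_measure.emeasure_eq_measure prob_space_def)
    have [measurable]: "k \<in> borel_measurable borel"
    proof -
      have "(\<lambda>(x, y). ennreal (q (fst (x, y)) (snd (x, y))) * indicator C y) \<in> borel_measurable (borel \<Otimes>\<^sub>M (lborel :: real measure))"
        unfolding split_beta' by measurable
      then show ?thesis
        unfolding k_def[abs_def] by (intro lborel.borel_measurable_nn_integral) simp
    qed
    have [measurable]: "(\<lambda>x. measure (?Q x) C) \<in> borel_measurable borel"
    proof -
      have "(\<lambda>x. enn2real (k x)) \<in> borel_measurable borel" by measurable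
      then show ?thesis by (simp add: k_measure)
    qed
    have set: "{w. obs 0 w \<in> A \<and> obs 1 w \<in> C} \<in> sets M"
      using measurable_sets[of "\<lambda>w. (obs 0 w, obs 1 w)" M "borel \<Otimes>\<^sub>M borel" "A \<times> C"]
      by (simp add: sp vimage_def)
    have "measure M {w. obs 0 w \<in> A \<and> obs 1 w \<in> C} = (\<integral>w\<in>?A. indicator C (obs 1 w) \<partial>M)"
    proof -
      have "(\<integral>w\<in>?A. indicator C (obs 1 w) \<partial>M) = (\<integral>w. indicator {w. obs 0 w \<in> A \<and> obs 1 w \<in> C} w \<partial>M :: real)"
        unfolding set_lebesgue_integral_def
        by (intro Bochner_Integration.integral_cong) (auto simp: indicator_def)
      then show ?thesis by (simp add: sp)
    qed
    also have "\<dots> = (\<integral>w\<in>?A. real_cond_exp M (history 0) (\<lambda>w. indicator C (obs 1 w)) w \<partial>M)"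
      by (intro H.real_cond_exp_intA AH integrable_const_bound[where B = 1]) (auto simp: indicator_def)
    also have "\<dots> = (\<integral>w\<in>?A. measure (?Q (obs 0 w)) C \<partial>M)"
    proof -
      have "AE w in M. real_cond_exp M (history 0) (\<lambda>w. indicator C (obs (Suc 0) w)) w = measure (?Q (obs 0 w)) C"
        using markov C unfolding homogeneous_markov_def by blast
      then show ?thesis
        unfolding set_lebesgue_integral_def
        by (intro integral_cong_AE) auto
    qed
    finally have m: "measure M {w. obs 0 w \<in> A \<and> obs 1 w \<in> C} = (\<integral>w\<in>?A. measure (?Q (obs 0 w)) C \<partial>M)" .
    have "emeasure (distr M (borel \<Otimes>\<^sub>M borel) (\<lambda>w. (obs 0 w, obs 1 w))) (A \<times> C) =
        ennreal (measure M {w. obs 0 w \<in> A \<and> obs 1 w \<in> C})"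
      by (subst emeasure_distr) (auto simp: sp vimage_def emeasure_eq_measure)
    also have "\<dots> = (\<integral>\<^sup>+w. ennreal (indicator ?A w *\<^sub>R measure (?Q (obs 0 w)) C) \<partial>M)"
      unfolding m set_lebesgue_integral_def
    proof (rule nn_integral_eq_integral[symmetric])
      show "integrable M (\<lambda>w. indicator ?A w *\<^sub>R measure (?Q (obs 0 w)) C)"
        using prob_space.prob_le_1[OF Qp]
        by (intro integrable_const_bound[where B = 1]) (auto simp: indicator_def)
    qed auto
    also have "\<dots> = (\<integral>\<^sup>+w. k (obs 0 w) * indicator A (obs 0 w) \<partial>M)"
      by (intro nn_integral_cong) (auto simp: indicator_def k_measure)
    also have "\<dots> = (\<integral>\<^sup>+x. k x * indicator A x \<partial>N)"
      unfolding N_def by (subst nn_integral_distr) auto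
    also have "\<dots> = (\<integral>\<^sup>+x. (\<integral>\<^sup>+y. ennreal (q x y) * indicator (A \<times> C) (x, y) \<partial>lborel) \<partial>N)"
      by (intro nn_integral_cong) (auto simp: k_def indicator_def)
    also have "\<dots> = (\<integral>\<^sup>+z. (case z of (x, y) \<Rightarrow> ennreal (q x y)) * indicator (A \<times> C) z \<partial>(N \<Otimes>\<^sub>M lborel))"
      by (subst lborel.nn_integral_fst[symmetric]) (auto simp: split_beta')
    also have "\<dots> = emeasure (density (N \<Otimes>\<^sub>M lborel) (\<lambda>(x, y). ennreal (q x y))) (A \<times> C)"
      by (subst emeasure_density) (auto simp: split_beta')
    finally show ?thesis .
  qed
  show ?thesis
    unfolding N_def[symmetric]
  proof (rule measure_eqI_generator_eq[where \<Omega> = UNIV and A = "\<lambda>_. UNIV"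
        and E = "{a \<times> b | a b. a \<in> sets borel \<and> b \<in> sets (borel :: real measure)}"])
    show "Int_stable {a \<times> b | a b. a \<in> sets borel \<and> b \<in> sets (borel :: real measure)}"
      by (rule Int_stable_pair_measure_generator)
    show "sets (distr M (borel \<Otimes>\<^sub>M borel) (\<lambda>w. (obs 0 w, obs 1 w))) =
        sigma_sets UNIV {a \<times> b | a b. a \<in> sets borel \<and> b \<in> sets (borel :: real measure)}"
      by (simp add: sets_pair_measure)
    then show "sets (density (N \<Otimes>\<^sub>M lborel) (\<lambda>(x, y). ennreal (q x y))) =
        sigma_sets UNIV {a \<times> b | a b. a \<in> sets borel \<and> b \<in> sets (borel :: real measure)}"
      by (simp add: sets_pair_measure N_def)
    show "range (\<lambda>_::nat. UNIV) \<subseteq> {a \<times> b | a b. a \<in> sets borel \<and> b \<in> sets (borel :: real measure)}"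
      by (auto intro!: exI[of _ UNIV])
    show "emeasure (distr M (borel \<Otimes>\<^sub>M borel) (\<lambda>w. (obs 0 w, obs 1 w))) UNIV \<noteq> \<infinity>" for i :: nat
      using sets.top[of "borel \<Otimes>\<^sub>M borel :: (real \<times> real) measure"]
      by (subst emeasure_distr) (auto simp: emeasure_eq_measure space_pair_measure)
  qed (use rect in auto)
qed

text \<open>To be applied with \<open>h\<close> a first or second parameter derivative of the
  density divided by the density: then the product \<open>q x y * h x y\<close> is the derivative
  itself, whose integral over \<open>y\<close> is the derivative of a constant.\<close>

lemma homogeneous_markov_integral_zero:
  fixes h :: "real \<Rightarrow> real \<Rightarrow> real"
  assumes M: "prob_space M" "sets M = sets path_space"
    and q: "(\<lambda>(x, y). q x y) \<in> borel_measurable (borel \<Otimes>\<^sub>M borel)" and q_pos: "\<And>x y. 0 < q x y"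
    and markov: "homogeneous_markov M (\<lambda>x. density lborel (\<lambda>y. ennreal (q x y)))"
    and h: "(\<lambda>(x, y). h x y) \<in> borel_measurable (borel \<Otimes>\<^sub>M borel)"
    and int: "integrable M (\<lambda>w. h (obs 0 w) (obs 1 w))"
    and zero: "\<And>x. (\<integral>y. q x y * h x y \<partial>lborel) = 0"
  shows "(\<integral>w. h (obs 0 w) (obs 1 w) \<partial>M) = 0"
proof -
  interpret prob_space M by fact
  have [measurable]: "obs n \<in> borel_measurable M" for n
    using obs_measurable_path M(2) by (simp cong: measurable_cong_sets)
  define N where "N = distr M borel (obs 0)"
  interpret N: prob_space N unfolding N_def by (rule prob_space_distr) measurable
  have [measurable_cong]: "sets N = sets borel" by (simp add: N_def)
  interpret P: pair_sigma_finite N "lborel :: real measure" ..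
  have hm [measurable]: "(\<lambda>z. h (fst z) (snd z)) \<in> borel_measurable (borel \<Otimes>\<^sub>M borel)"
    using h by (simp add: split_beta')
  have qm [measurable]: "(\<lambda>z. q (fst z) (snd z)) \<in> borel_measurable (borel \<Otimes>\<^sub>M borel)"
    using q by (simp add: split_beta')
  note law = homogeneous_markov_pair_law[OF M q markov, folded N_def]
  have "integrable (distr M (borel \<Otimes>\<^sub>M borel) (\<lambda>w. (obs 0 w, obs 1 w))) (\<lambda>z. h (fst z) (snd z))"
    using int by (subst integrable_distr_eq) auto
  then have int': "integrable (N \<Otimes>\<^sub>M lborel) (\<lambda>z. q (fst z) (snd z) * h (fst z) (snd z))"
    unfolding law split_beta' using q_pos
    by (subst (asm) integrable_density) (auto simp: less_imp_le)
  have "(\<integral>w. h (obs 0 w) (obs 1 w) \<partial>M) =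
      (\<integral>z. h (fst z) (snd z) \<partial>distr M (borel \<Otimes>\<^sub>M borel) (\<lambda>w. (obs 0 w, obs 1 w)))"
    by (subst integral_distr) auto
  also have "\<dots> = (\<integral>z. q (fst z) (snd z) * h (fst z) (snd z) \<partial>(N \<Otimes>\<^sub>M lborel))"
    unfolding law split_beta' using q_pos by (subst integral_density) (auto simp: less_imp_le)
  also have "\<dots> = (\<integral>x. (\<integral>y. q x y * h x y \<partial>lborel) \<partial>N)"
    using P.integral_fst'[OF int'] by simp
  finally show ?thesis by (simp add: zero)
qed

section \<open>The estimators\<close>

lemma (in finite_measure_subalgebra) vec_cond_exp_inner:
  fixes X :: "'a \<Rightarrow> real^'d"
  assumes X: "integrable M X" and A: "A \<in> sets F"
  shows "integrable M (\<lambda>w. v \<bullet> vec_cond_exp M F X w)"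
    and "(\<integral>w\<in>A. v \<bullet> X w \<partial>M) = (\<integral>w\<in>A. v \<bullet> vec_cond_exp M F X w \<partial>M)"
proof -
  have AM: "A \<in> sets M" using A subalg by (auto simp: subalgebra_def)
  have Xi: "integrable M (\<lambda>w. X w $ i)" for i
    using integrable_inner_left[OF X, of "axis i 1"] by (simp add: inner_axis)
  have Ci: "integrable M (\<lambda>w. real_cond_exp M F (\<lambda>w. X w $ i) w)" for i
    by (rule real_cond_exp_int(1)[OF Xi])
  show "integrable M (\<lambda>w. v \<bullet> vec_cond_exp M F X w)"
    unfolding inner_vec_def vec_cond_exp_def using Ci by simp
  have split: "(\<integral>w\<in>A. (\<Sum>i\<in>UNIV. v $ i * Y i w) \<partial>M) = (\<Sum>i\<in>UNIV. v $ i * (\<integral>w\<in>A. Y i w \<partial>M))"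
    if Y: "\<And>i. integrable M (Y i)" for Y :: "'d \<Rightarrow> 'a \<Rightarrow> real"
  proof -
    have "(\<integral>w\<in>A. (\<Sum>i\<in>UNIV. v $ i * Y i w) \<partial>M) = (\<integral>w. (\<Sum>i\<in>UNIV. v $ i * (indicator A w *\<^sub>R Y i w)) \<partial>M)"
      unfolding set_lebesgue_integral_def
      by (intro Bochner_Integration.integral_cong) (auto simp: sum_distrib_left mult_ac)
    also have "\<dots> = (\<Sum>i\<in>UNIV. v $ i * (\<integral>w\<in>A. Y i w \<partial>M))"
      unfolding set_lebesgue_integral_def
      using integrable_mult_indicator[OF AM Y]
      by (subst Bochner_Integration.integral_sum) auto
    finally show ?thesis .
  qed
  have "(\<integral>w\<in>A. v \<bullet> X w \<partial>M) = (\<Sum>i\<in>UNIV. v $ i * (\<integral>w\<in>A. X w $ i \<partial>M))"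
    using split[OF Xi] by (simp add: inner_vec_def)
  also have "\<dots> = (\<Sum>i\<in>UNIV. v $ i * (\<integral>w\<in>A. real_cond_exp M F (\<lambda>w. X w $ i) w \<partial>M))"
    using real_cond_exp_intA[OF Xi A] by simp
  also have "\<dots> = (\<integral>w\<in>A. v \<bullet> vec_cond_exp M F X w \<partial>M)"
    using split[OF Ci] by (simp add: inner_vec_def vec_cond_exp_def)
  finally show "(\<integral>w\<in>A. v \<bullet> X w \<partial>M) = (\<integral>w\<in>A. v \<bullet> vec_cond_exp M F X w \<partial>M)" .
qed

lemma (in finite_measure_subalgebra) set_integral_inner_le:
  fixes X :: "'a \<Rightarrow> real^'d"
  assumes X: "integrable M X" and A: "A \<in> sets F"
    and le: "AE w in M. v \<bullet> vec_cond_exp M F X w \<le> c"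
  shows "(\<integral>w\<in>A. v \<bullet> X w \<partial>M) \<le> c * measure M A"
proof -
  have AM: "A \<in> sets M" using A subalg by (auto simp: subalgebra_def)
  have "(\<integral>w\<in>A. v \<bullet> X w \<partial>M) = (\<integral>w\<in>A. v \<bullet> vec_cond_exp M F X w \<partial>M)"
    by (rule vec_cond_exp_inner(2)[OF X A])
  also have "\<dots> \<le> (\<integral>w\<in>A. c \<partial>M)"
    unfolding set_lebesgue_integral_def
  proof (rule integral_mono_AE)
    show "integrable M (\<lambda>w. indicator A w *\<^sub>R (v \<bullet> vec_cond_exp M F X w))"
      by (rule integrable_mult_indicator[OF AM vec_cond_exp_inner(1)[OF X A]])
    show "integrable M (\<lambda>w. indicator A w *\<^sub>R c)"
      by (rule integrable_mult_indicator[OF AM]) simp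
    show "AE w in M. indicator A w *\<^sub>R (v \<bullet> vec_cond_exp M F X w) \<le> indicator A w *\<^sub>R c"
      using le by eventually_elim (auto simp: indicator_def)
  qed
  also have "\<dots> = c * measure M A"
    using AM by (simp add: set_lebesgue_integral_def mult.commute)
  finally show ?thesis .
qed

lemma (in finite_measure_subalgebra) set_nn_integral_le:
  assumes f: "f \<in> borel_measurable M" and A: "A \<in> sets F" and le: "AE w in M. nn_cond_exp M F f w \<le> c"
  shows "(\<integral>\<^sup>+w\<in>A. f w \<partial>M) \<le> c * emeasure M A"
proof -
  have AM: "A \<in> sets M" using A subalg by (auto simp: subalgebra_def)
  have "(\<integral>\<^sup>+w\<in>A. f w \<partial>M) = (\<integral>\<^sup>+w. indicator A w * nn_cond_exp M F f w \<partial>M)"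
    using A f by (subst nn_cond_exp_intg) (auto simp: mult.commute)
  also have "\<dots> \<le> (\<integral>\<^sup>+w. c * indicator A w \<partial>M)"
    using le by (intro nn_integral_mono_AE) (auto simp: indicator_def elim!: eventually_mono)
  also have "\<dots> = c * emeasure M A" using AM by (simp add: nn_integral_cmult_indicator)
  finally show ?thesis .
qed

section \<open>Algebra of the recursions\<close>

lemma base_est_Suc:
  assumes "0 < \<beta>"
  shows "base_est T p \<beta> t0 (Suc n) w = closest_point T
    (base_est T p \<beta> t0 n w + (\<beta> / real (Suc n)) *\<^sub>R score T p (Suc n) (base_est T p \<beta> t0 n w) w)"
  using assms by (simp add: projection_term_def Let_def)

text \<open>Summation by parts removes the projection terms: with \<open>\<beta> (\<psi>\<^sub>i + J\<^sub>i)\<close> being \<open>i\<close> times the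
  increment of the base estimate, \<open>\<Gamma>\<^sub>n\<close> telescopes against \<open>n I\<^sub>n\<close>.\<close>

lemma gamma_info_seq_eq:
  assumes \<beta>: "\<beta> \<noteq> 0"
  shows "real n *\<^sub>R (gamma_seq T p \<beta> t0 n w - info_seq T p \<beta> t0 n w *v base_est T p \<beta> t0 n w) =
    (\<Sum>k<n. score T p (Suc k) (base_est T p \<beta> t0 k w) w
      - score_jac T p (Suc k) (base_est T p \<beta> t0 k w) w *v base_est T p \<beta> t0 k w)"
proof (induction n)
  case (Suc n)
  define x where "x = base_est T p \<beta> t0 n w"
  define x' where "x' = base_est T p \<beta> t0 (Suc n) w"
  define s where "s = score T p (Suc n) x w"
  define J where "J = projection_term T p \<beta> (Suc n) x w"
  define H where "H = score_jac T p (Suc n) x w"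
  define I where "I = info_seq T p \<beta> t0 n w"
  define I' where "I' = info_seq T p \<beta> t0 (Suc n) w"
  define G where "G = gamma_seq T p \<beta> t0 n w"
  define G' where "G' = gamma_seq T p \<beta> t0 (Suc n) w"
  let ?m = "real (Suc n)"
  have m: "?m \<noteq> 0" by simp
  have x': "x' = x + (\<beta> / ?m) *\<^sub>R s + (\<beta> / ?m) *\<^sub>R J"
    by (simp add: x'_def x_def s_def J_def)
  have I': "I' = (real n / ?m) *\<^sub>R I + (1 / ?m) *\<^sub>R H"
    by (simp add: I'_def I_def H_def x_def)
  have G': "G' = (real n / ?m) *\<^sub>R G + (1 / ?m) *\<^sub>R ((mat 1 + \<beta> *\<^sub>R I') *v s) + (\<beta> / ?m) *\<^sub>R (I' *v J)"
    by (simp add: G'_def G_def I'_def s_def J_def x_def)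
  have "?m *\<^sub>R G' = real n *\<^sub>R G + ((mat 1 + \<beta> *\<^sub>R I') *v s) + \<beta> *\<^sub>R (I' *v J)"
    using m by (simp add: G' scaleR_add_right del: of_nat_Suc)
  also have "(mat 1 + \<beta> *\<^sub>R I') *v s = s + \<beta> *\<^sub>R (I' *v s)"
    by (simp add: matrix_vector_mult_add_rdistrib scaleR_matrix_vector_assoc[symmetric])
  finally have mG: "?m *\<^sub>R G' = real n *\<^sub>R G + s + (\<beta> *\<^sub>R (I' *v s) + \<beta> *\<^sub>R (I' *v J))" by (simp add: add.assoc)
  \<comment> \<open>The increment of the base estimate contributes the same \<open>\<beta>\<close>
    terms here as in \<open>mG\<close>; they cancel in the difference, projection included, and only
    \<open>s\<close> and \<open>H *v x\<close> are new.\<close>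
  have mI: "?m *\<^sub>R (I' *v x') = ?m *\<^sub>R (I' *v x) + (\<beta> *\<^sub>R (I' *v s) + \<beta> *\<^sub>R (I' *v J))"
    using m by (simp add: x' matrix_vector_right_distrib matrix_vector_mult_scaleR scaleR_add_right add.assoc del: of_nat_Suc)
  have "?m *\<^sub>R (I' *v x) = (?m *\<^sub>R I') *v x" by (simp add: scaleR_matrix_vector_assoc del: of_nat_Suc)
  also have "?m *\<^sub>R I' = real n *\<^sub>R I + H" using m by (simp add: I' scaleR_add_right del: of_nat_Suc)
  finally have "?m *\<^sub>R (I' *v x) = real n *\<^sub>R (I *v x) + H *v x"
    by (simp add: matrix_vector_mult_add_rdistrib scaleR_matrix_vector_assoc)
  then have "?m *\<^sub>R (G' - I' *v x') = real n *\<^sub>R (G - I *v x) + (s - H *v x)"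
    by (simp add: scaleR_diff_right mG mI del: of_nat_Suc)
  with Suc show ?case
    by (simp add: x'_def[symmetric] G'_def[symmetric] I'_def[symmetric] x_def s_def H_def I_def G_def
        del: of_nat_Suc gamma_seq.simps info_seq.simps base_est.simps)
qed simp

lemma estimator_eq:
  assumes "\<beta> \<noteq> 0"
  shows "estimator P T p \<beta> t0 n w = matrix_inv (fisher P T p (base_est T p \<beta> t0 n w)) *v
    ((1 / real n) *\<^sub>R (\<Sum>k<n. score T p (Suc k) (base_est T p \<beta> t0 k w) w
      - score_jac T p (Suc k) (base_est T p \<beta> t0 k w) w *v base_est T p \<beta> t0 k w))"
\<comment> \<open>At \<open>n = 0\<close> both sides are 0: all sums are empty, and division by 0
  yields 0.\<close>
proof (cases "n = 0")
  case True
  then show ?thesis by (simp add: estimator_def Let_def)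
next
  case False
  then have "gamma_seq T p \<beta> t0 n w - info_seq T p \<beta> t0 n w *v base_est T p \<beta> t0 n w =
      (1 / real n) *\<^sub>R (real n *\<^sub>R (gamma_seq T p \<beta> t0 n w - info_seq T p \<beta> t0 n w *v base_est T p \<beta> t0 n w))"
    by simp
  then show ?thesis
    unfolding gamma_info_seq_eq[OF assms]
    by (simp add: estimator_def Let_def matrix_vector_mult_diff_distrib[symmetric])
qed

lemma integral_vec_nth:
  fixes f :: "'a \<Rightarrow> real^'n"
  shows "integrable M f \<Longrightarrow> (\<integral>x. f x $ i \<partial>M) = (\<integral>x. f x \<partial>M) $ i"
  by (rule integral_bounded_linear[OF bounded_linear_vec_nth])

lemma integral_vec_nth_nth:
  fixes f :: "'a \<Rightarrow> real^'n^'m"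
  shows "integrable M f \<Longrightarrow> (\<integral>x. f x $ i $ j \<partial>M) = (\<integral>x. f x \<partial>M) $ i $ j"
  by (rule integral_bounded_linear[OF bounded_linear_compose[OF bounded_linear_vec_nth bounded_linear_vec_nth]])

lemma score_eq: "score T p (Suc n) \<theta> w = grad_on T (\<lambda>t. ln (p t (obs n w) (obs (Suc n) w))) \<theta>"
  and score_jac_eq: "score_jac T p (Suc n) \<theta> w = hess_on T (\<lambda>t. ln (p t (obs n w) (obs (Suc n) w))) \<theta>"
  by (simp_all add: score_def score_jac_def log_lik_def)

section \<open>Mean score and information identity\<close>

context nondegenerate_box
begin

context
  fixes p :: "real^'d \<Rightarrow> real \<Rightarrow> real \<Rightarrow> real"
  assumes p_pos: "\<And>\<theta> x y. \<theta> \<in> cbox l u \<Longrightarrow> 0 < p \<theta> x y"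
    and p_diff: "\<And>x y. thrice_differentiable_on (\<lambda>\<theta>. p \<theta> x y) (cbox l u)"
begin

lemma score_has_derivative:
  assumes "\<theta> \<in> cbox l u"
  shows "((\<lambda>t. score (cbox l u) p (Suc n) t w) has_derivative (\<lambda>h. score_jac (cbox l u) p (Suc n) \<theta> w *v h))
    (at \<theta> within cbox l u)"
  unfolding score_eq score_jac_eq
  using grad_on_ln_has_derivative[of "\<lambda>t. p t (obs n w) (obs (Suc n) w)", OF p_pos p_diff assms]
    hess_on_ln[of "\<lambda>t. p t (obs n w) (obs (Suc n) w)", OF p_pos p_diff assms]
  by simp

lemma continuous_on_score_jac: "continuous_on (cbox l u) (\<lambda>t. score_jac (cbox l u) p (Suc n) t w)"
  unfolding score_jac_eq by (rule continuous_on_hess_on_ln) (use p_pos p_diff in auto)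

context
  fixes P :: "real^'d \<Rightarrow> (nat \<Rightarrow> real) measure" and \<theta> :: "real^'d"
  assumes \<theta>: "\<theta> \<in> cbox l u"
    and P: "prob_space (P \<theta>)" "sets (P \<theta>) = sets path_space"
    and p_meas: "\<And>t. t \<in> cbox l u \<Longrightarrow> (\<lambda>(x, y). p t x y) \<in> borel_measurable (borel \<Otimes>\<^sub>M borel)"
    and kernel: "\<And>t. t \<in> cbox l u \<Longrightarrow> (\<lambda>x. density lborel (\<lambda>y. ennreal (p t x y))) \<in> borel \<rightarrow>\<^sub>M prob_algebra borel"
    and markov: "homogeneous_markov (P \<theta>) (\<lambda>x. density lborel (\<lambda>y. ennreal (p \<theta> x y)))"
    and score_int: "integrable (P \<theta>) (score (cbox l u) p 1 \<theta>)"
begin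

text \<open>Normalization is read off from the kernel taking values in the probability
  measures.\<close>

private lemma density_integral: "t \<in> cbox l u \<Longrightarrow> (\<integral>y. p t x y \<partial>lborel) = 1"
proof -
  assume t: "t \<in> cbox l u"
  have qm: "(\<lambda>y. p t x y) \<in> borel_measurable borel"
    using measurable_compose[OF measurable_Pair1'[of x borel borel] p_meas[OF t]] by simp
  have "prob_space (density lborel (\<lambda>y. ennreal (p t x y)))"
    using measurable_space[OF kernel[OF t], of x] by (auto simp: space_prob_algebra)
  then have "(\<integral>\<^sup>+y. ennreal (p t x y) \<partial>lborel) = 1"
    using prob_space.emeasure_space_1 qm by (fastforce simp: emeasure_density)
  then show ?thesis
    using qm p_pos[OF t] by (subst integral_eq_nn_integral) (auto simp: less_imp_le)
qed

private lemma score_pair_measurable: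
  fixes f :: "(nat \<Rightarrow> real) \<Rightarrow> 'c::topological_space"
  assumes "f \<in> borel_measurable (P \<theta>)"
  shows "(\<lambda>z. f (two_step_path z)) \<in> borel_measurable (borel \<Otimes>\<^sub>M borel)"
  using assms P(2) by (intro measurable_compose[OF two_step_path_measurable]) (simp cong: measurable_cong_sets)

text \<open>The density times the score is the gradient of the density, so integrating over the next
  value and interchanging leaves the gradient of the constant total mass.\<close>

lemma expected_score_eq_0:
  assumes grad_int: "\<And>x. integrable lborel (\<lambda>y. grad_on (cbox l u) (\<lambda>t. p t x y) \<theta>)"
    and interchange: "\<And>x. grad_on (cbox l u) (\<lambda>t. \<integral>y. p t x y \<partial>lborel) \<theta>
      = (\<integral>y. grad_on (cbox l u) (\<lambda>t. p t x y) \<theta> \<partial>lborel)"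
  shows "(\<integral>w. score (cbox l u) p 1 \<theta> w \<partial>P \<theta>) = 0"
proof -
  let ?s = "score (cbox l u) p 1 \<theta>"
  have "(\<integral>w. ?s w $ i \<partial>P \<theta>) = 0" for i
  proof -
    let ?h = "\<lambda>x y. ?s (two_step_path (x, y)) $ i"
    have eq: "?h (obs 0 w) (obs 1 w) = ?s w $ i" for w
      using score_Suc_eq(1)[of "cbox l u" p 0 \<theta> w] by simp
    have "(\<integral>w. ?h (obs 0 w) (obs 1 w) \<partial>P \<theta>) = 0"
    proof (rule homogeneous_markov_integral_zero[OF P p_meas[OF \<theta>] p_pos[OF \<theta>] markov])
      have "(\<lambda>z. ?s (two_step_path z) $ i) \<in> borel_measurable (borel \<Otimes>\<^sub>M borel)"
        using score_int by (intro measurable_compose[OF score_pair_measurable]) auto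
      then show "(\<lambda>(x, y). ?h x y) \<in> borel_measurable (borel \<Otimes>\<^sub>M borel)" by (simp add: split_beta')
      show "integrable (P \<theta>) (\<lambda>w. ?h (obs 0 w) (obs 1 w))"
        unfolding eq by (rule integrable_bounded_linear[OF bounded_linear_vec_nth score_int])
      show "(\<integral>y. p \<theta> x y * ?h x y \<partial>lborel) = 0" for x
      proof -
        have "p \<theta> x y * ?h x y = grad_on (cbox l u) (\<lambda>t. p t x y) \<theta> $ i" for y
          using grad_on_ln[of "\<lambda>t. p t x y", OF p_pos p_diff \<theta>] p_pos[OF \<theta>, of x y]
          by (simp add: score_eq[of _ _ 0, simplified] obs_def two_step_path_def)
        then show ?thesis
          using integral_vec_nth[OF grad_int, of x i]
          by (simp add: interchange[symmetric] grad_on_const[OF density_integral \<theta>])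
      qed
    qed
    then show ?thesis unfolding eq .
  qed
  then show ?thesis
    unfolding vec_eq_iff integral_vec_nth[OF score_int, symmetric] by simp
qed

text \<open>Adding the outer product of the score to its Jacobian cancels the quadratic term of the
  logarithm: the density times the sum is the Hessian of the density, which integrates to the
  Hessian of a constant.\<close>

lemma expected_score_jac_eq:
  assumes hess_int: "\<And>x. integrable lborel (\<lambda>y. hess_on (cbox l u) (\<lambda>t. p t x y) \<theta>)"
    and interchange: "\<And>x. hess_on (cbox l u) (\<lambda>t. \<integral>y. p t x y \<partial>lborel) \<theta>
      = (\<integral>y. hess_on (cbox l u) (\<lambda>t. p t x y) \<theta> \<partial>lborel)"
    and jac_int: "integrable (P \<theta>) (score_jac (cbox l u) p 1 \<theta>)"
    and outer_int: "integrable (P \<theta>) (\<lambda>w. outer (score (cbox l u) p 1 \<theta> w))"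
  shows "(\<integral>w. score_jac (cbox l u) p 1 \<theta> w \<partial>P \<theta>) = - fisher P (cbox l u) p \<theta>"
proof -
  let ?f = "\<lambda>w. score_jac (cbox l u) p 1 \<theta> w + outer (score (cbox l u) p 1 \<theta> w)"
  have f_int: "integrable (P \<theta>) ?f" using jac_int outer_int by simp
  have "(\<integral>w. ?f w $ i $ j \<partial>P \<theta>) = 0" for i j
  proof -
    let ?h = "\<lambda>x y. ?f (two_step_path (x, y)) $ i $ j"
    have eq: "?h (obs 0 w) (obs 1 w) = ?f w $ i $ j" for w
      using score_Suc_eq[of "cbox l u" p 0 \<theta> w] by simp
    have "(\<integral>w. ?h (obs 0 w) (obs 1 w) \<partial>P \<theta>) = 0"
    proof (rule homogeneous_markov_integral_zero[OF P p_meas[OF \<theta>] p_pos[OF \<theta>] markov])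
      have "(\<lambda>z. ?f (two_step_path z)) \<in> borel_measurable (borel \<Otimes>\<^sub>M borel)"
        using f_int by (intro score_pair_measurable[of ?f]) auto
      then have "(\<lambda>z. ?f (two_step_path z) $ i $ j) \<in> borel_measurable (borel \<Otimes>\<^sub>M borel)"
        by (rule measurable_compose) (intro borel_measurable_continuous_onI continuous_intros)
      then show "(\<lambda>(x, y). ?h x y) \<in> borel_measurable (borel \<Otimes>\<^sub>M borel)" by (simp add: split_beta')
      show "integrable (P \<theta>) (\<lambda>w. ?h (obs 0 w) (obs 1 w))"
        unfolding eq
        by (rule integrable_bounded_linear[OF bounded_linear_compose[OF bounded_linear_vec_nth bounded_linear_vec_nth] f_int])
      show "(\<integral>y. p \<theta> x y * ?h x y \<partial>lborel) = 0" for x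
      proof -
        have "p \<theta> x y * ?h x y = hess_on (cbox l u) (\<lambda>t. p t x y) \<theta> $ i $ j" for y
          using hess_on_ln[of "\<lambda>t. p t x y", OF p_pos p_diff \<theta>] p_pos[OF \<theta>, of x y]
          by (simp add: score_eq[of _ _ 0, simplified] score_jac_eq[of _ _ 0, simplified] obs_def two_step_path_def)
        then show ?thesis
          using integral_vec_nth_nth[OF hess_int, of x i j]
          by (simp add: interchange[symmetric] hess_on_const[OF density_integral \<theta>])
      qed
    qed
    then show ?thesis unfolding eq .
  qed
  then have "(\<integral>w. ?f w \<partial>P \<theta>) = 0"
    using integral_vec_nth_nth[OF f_int] by (simp add: vec_eq_iff)
  moreover have "(\<integral>w. ?f w \<partial>P \<theta>) = (\<integral>w. score_jac (cbox l u) p 1 \<theta> w \<partial>P \<theta>) + fisher P (cbox l u) p \<theta>"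
    using jac_int outer_int by (simp add: fisher_def)
  ultimately show ?thesis by (simp add: eq_neg_iff_add_eq_0)
qed

end

end

end

section \<open>Consistency of the extreme points\<close>

theorem proposition4p3:
  fixes l u :: "real^('d::{finite,linorder})"
    and \<Theta> :: "(real^('d::{finite,linorder})) set"
    and \<theta>s t0 :: "real^('d::{finite,linorder})"
    and P :: "real^('d::{finite,linorder}) \<Rightarrow> (nat \<Rightarrow> real) measure"
    and p :: "real^('d::{finite,linorder}) \<Rightarrow> real \<Rightarrow> real \<Rightarrow> real"
    and \<beta> K1 K2 K3 K4 \<alpha> \<kappa> :: real
  assumes box: "\<Theta> = cbox l u" "\<Theta> \<noteq> {}"
    and true_param: "\<theta>s \<in> interior \<Theta>"
    and laws: "\<And>\<theta>. \<theta> \<in> \<Theta> \<Longrightarrow> prob_space (P \<theta>)"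
      "\<And>\<theta>. \<theta> \<in> \<Theta> \<Longrightarrow> sets (P \<theta>) = sets path_space"
    and p_pos: "\<And>\<theta> x y. \<theta> \<in> \<Theta> \<Longrightarrow> 0 < p \<theta> x y"
    and p_meas: "\<And>\<theta>. \<theta> \<in> \<Theta> \<Longrightarrow> (\<lambda>(x, y). p \<theta> x y) \<in> borel_measurable (borel \<Otimes>\<^sub>M borel)"
    and markov: "\<And>\<theta>. \<theta> \<in> \<Theta> \<Longrightarrow>
      homogeneous_markov (P \<theta>) (\<lambda>x. density lborel (\<lambda>y. ennreal (p \<theta> x y)))"
    and ergodic: "stationary_ergodic (P \<theta>s)"
    and b_cont: "\<And>\<theta> n. \<theta> \<in> \<Theta> \<Longrightarrow> n \<ge> 1 \<Longrightarrow>
      \<exists>g. continuous_on UNIV g \<and>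
          (AE \<omega> in P \<theta>s. cond_score (P \<theta>s) \<Theta> p n \<theta> \<omega> = g (obs (n - 1) \<omega>))"
    and R0: "\<And>\<theta>. \<theta> \<in> \<Theta> \<Longrightarrow> integrable (P \<theta>s) (log_lik p 1 \<theta>)"
    and R1_diff: "\<And>x y. thrice_differentiable_on (\<lambda>\<theta>. p \<theta> x y) \<Theta>"
    and R1_integrable:
      "\<And>\<theta> x. \<theta> \<in> \<Theta> \<Longrightarrow> integrable lborel (\<lambda>y. grad_on \<Theta> (\<lambda>t. p t x y) \<theta>)"
      "\<And>\<theta> x. \<theta> \<in> \<Theta> \<Longrightarrow> integrable lborel (\<lambda>y. hess_on \<Theta> (\<lambda>t. p t x y) \<theta>)"
    and R1_interchange:
      "\<And>\<theta> x. \<theta> \<in> \<Theta> \<Longrightarrow> grad_on \<Theta> (\<lambda>t. \<integral>y. p t x y \<partial>lborel) \<theta>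
                        = (\<integral>y. grad_on \<Theta> (\<lambda>t. p t x y) \<theta> \<partial>lborel)"
      "\<And>\<theta> x. \<theta> \<in> \<Theta> \<Longrightarrow> hess_on \<Theta> (\<lambda>t. \<integral>y. p t x y \<partial>lborel) \<theta>
                        = (\<integral>y. hess_on \<Theta> (\<lambda>t. p t x y) \<theta> \<partial>lborel)"
    and R2_integrable:
      "\<And>\<theta>. \<theta> \<in> \<Theta> \<Longrightarrow> integrable (P \<theta>s) (score \<Theta> p 1 \<theta>)"
      "\<And>\<theta>. \<theta> \<in> \<Theta> \<Longrightarrow> integrable (P \<theta>s) (score_jac \<Theta> p 1 \<theta>)"
    and R2_diff: "twice_differentiable_on (\<lambda>t. \<integral>\<omega>. log_lik p 1 t \<omega> \<partial>P \<theta>s) \<Theta>"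
    and R2_interchange:
      "\<And>\<theta>. \<theta> \<in> \<Theta> \<Longrightarrow> grad_on \<Theta> (\<lambda>t. \<integral>\<omega>. log_lik p 1 t \<omega> \<partial>P \<theta>s) \<theta>
                      = (\<integral>\<omega>. score \<Theta> p 1 \<theta> \<omega> \<partial>P \<theta>s)"
      "\<And>\<theta>. \<theta> \<in> \<Theta> \<Longrightarrow> hess_on \<Theta> (\<lambda>t. \<integral>\<omega>. log_lik p 1 t \<omega> \<partial>P \<theta>s) \<theta>
                      = (\<integral>\<omega>. score_jac \<Theta> p 1 \<theta> \<omega> \<partial>P \<theta>s)"
    and R3_boundary:
      "\<nexists>\<theta>. boundary_stationary l u (\<lambda>t. \<integral>\<omega>. score \<Theta> p 1 t \<omega> \<partial>P \<theta>s) \<theta>"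
    and R3_unique: "\<exists>!t. t \<in> \<Theta> \<and> (\<integral>\<omega>. score \<Theta> p 1 t \<omega> \<partial>P \<theta>s) = 0"
    and K_pos: "0 < K1" "0 < K2" "0 < K3" "0 < K4"
    and R4_drift: "\<And>\<theta> n. \<theta> \<in> \<Theta> \<Longrightarrow> n \<ge> 1 \<Longrightarrow>
      AE \<omega> in P \<theta>s. (\<theta> - \<theta>s) \<bullet> cond_score (P \<theta>s) \<Theta> p n \<theta> \<omega> \<le> - K1 * (norm (\<theta> - \<theta>s))\<^sup>2"
    and R4_Lipschitz: "\<And>\<theta>1 \<theta>2 n. \<theta>1 \<in> \<Theta> \<Longrightarrow> \<theta>2 \<in> \<Theta> \<Longrightarrow> n \<ge> 1 \<Longrightarrow>
      AE \<omega> in P \<theta>s. norm (cond_score (P \<theta>s) \<Theta> p n \<theta>1 \<omega> - cond_score (P \<theta>s) \<Theta> p n \<theta>2 \<omega>)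
                     \<le> K2 * norm (\<theta>1 - \<theta>2)"
    and R4_jac_Lipschitz: "\<And>\<theta>1 \<theta>2 n. \<theta>1 \<in> \<Theta> \<Longrightarrow> \<theta>2 \<in> \<Theta> \<Longrightarrow> n \<ge> 1 \<Longrightarrow>
      AE \<omega> in P \<theta>s. nn_cond_exp (P \<theta>s) (history (n - 1))
          (\<lambda>\<omega>. ennreal (norm (score_jac \<Theta> p n \<theta>1 \<omega> - score_jac \<Theta> p n \<theta>2 \<omega>))) \<omega>
        \<le> ennreal (K3 * norm (\<theta>1 - \<theta>2))"
    and R5: "\<And>\<theta> n. \<theta> \<in> \<Theta> \<Longrightarrow> n \<ge> 1 \<Longrightarrow>
      AE \<omega> in P \<theta>s. nn_cond_exp (P \<theta>s) (history (n - 1))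
          (\<lambda>\<omega>. ennreal (norm (score_hess \<Theta> p n \<theta> \<omega>))) \<omega> \<le> ennreal K4"
    and R6: "\<And>n. n \<ge> 1 \<Longrightarrow>
      (SUP \<theta>\<in>\<Theta>. \<integral>\<^sup>+\<omega>. ennreal ((norm (score \<Theta> p n \<theta> \<omega> - cond_score (P \<theta>s) \<Theta> p n \<theta> \<omega>))\<^sup>2)
                 \<partial>P \<theta>s) < \<infinity>"
    and R7_exists: "\<And>\<theta>. \<theta> \<in> \<Theta> \<Longrightarrow> integrable (P \<theta>) (\<lambda>\<omega>. outer (score \<Theta> p 1 \<theta> \<omega>))"
    and R7_posdef: "\<And>\<theta>. \<theta> \<in> \<Theta> \<Longrightarrow> positive_definite (fisher P \<Theta> p \<theta>)"
    and R7_cont: "continuous_on \<Theta> (fisher P \<Theta> p)"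
    and R8: "(\<lambda>n. \<integral>\<^sup>+\<omega>. (SUP i\<in>{1..n}. ennreal (\<Sum>j\<in>UNIV.
                     \<bar>((1 / sqrt (real n)) *\<^sub>R score \<Theta> p i \<theta>s \<omega>) $ j\<bar>)) \<partial>P \<theta>s) \<longlonglongrightarrow> 0"
    and gain: "0 < \<beta>" "\<beta> * K1 > 1 / 2"
    and start: "t0 \<in> \<Theta>"
    and level: "0 < \<alpha>" "\<alpha> < 1"
    and quantile: "measure (chi_squared CARD('d)) {..<\<kappa>} = 1 - \<alpha>"
  shows "\<forall>k \<in> {1..2 * CARD('d)}.
    tendsto_in_probability (P \<theta>s) (\<lambda>n. extreme_point P \<Theta> p \<beta> t0 \<kappa> n k) \<theta>s"
proof
  fix k assume "k \<in> {1..2 * CARD('d)}"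
  let ?M = "P \<theta>s"
  have \<theta>s: "\<theta>s \<in> \<Theta>" using true_param interior_subset by blast
  \<comment> \<open>A point in the interior forces every side of the box to be
    nondegenerate.\<close>
  have "\<theta>s \<in> box l u" using true_param by (simp add: box(1))
  then have "l $ i < u $ i" for i by (auto simp: mem_box_cart intro: less_trans)
  then interpret nondegenerate_box l u by unfold_locales
  interpret M: prob_space ?M by (rule laws(1)[OF \<theta>s])
  note sets_M = laws(2)[OF \<theta>s]
  have space_M: "space ?M = UNIV" using sets_eq_imp_space_eq[OF sets_M] by (simp add: space_path_space)
  interpret E: ergodic_map ?M shift
  proof
    show "shift \<in> ?M \<rightarrow>\<^sub>M ?M" using shift_measurable sets_M by (simp cong: measurable_cong_sets)
    show "distr ?M ?M shift = ?M" using ergodic by (simp add: stationary_ergodic_def)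
    show "measure ?M A = 0 \<or> measure ?M A = 1" if "A \<in> sets ?M" "shift -` A \<inter> space ?M = A" for A
      using ergodic that by (simp add: stationary_ergodic_def space_M)
  qed
  have sub: "subalgebra ?M (history n)" for n
    using sets_history[of n] sets_M by (simp add: subalgebra_def space_history space_M)
  interpret H: finite_measure_subalgebra ?M "history n" for n
    by unfold_locales (rule sub)
  have p_pos': "0 < p \<theta> x y" if "\<theta> \<in> cbox l u" for \<theta> x y using p_pos that box by simp
  have p_diff': "thrice_differentiable_on (\<lambda>\<theta>. p \<theta> x y) (cbox l u)" for x y using R1_diff box by simp
  have \<psi>1: "integrable ?M (score \<Theta> p 1 t)" "integrable ?M (score_jac \<Theta> p 1 t)" if "t \<in> \<Theta>" for t
    using R2_integrable[OF that] .
  have path_meas: "score \<Theta> p 1 t \<in> borel_measurable path_space" "score_jac \<Theta> p 1 t \<in> borel_measurable path_space"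
    if "t \<in> \<Theta>" for t
    using \<psi>1[OF that, THEN borel_measurable_integrable] sets_M by (simp_all cong: measurable_cong_sets)
  have adapted: "score \<Theta> p (Suc n) t \<in> borel_measurable (history (Suc n))"
    "score_jac \<Theta> p (Suc n) t \<in> borel_measurable (history (Suc n))" if "t \<in> \<Theta>" for n t
    unfolding score_Suc_eq[abs_def, of \<Theta> p n]
    using measurable_compose[OF two_step_path_history path_meas(1)[OF that]]
      measurable_compose[OF two_step_path_history path_meas(2)[OF that]] by auto
  have shifted: "score \<Theta> p (Suc n) t = (\<lambda>w. score \<Theta> p 1 t ((shift ^^ n) w))"
    "score_jac \<Theta> p (Suc n) t = (\<lambda>w. score_jac \<Theta> p 1 t ((shift ^^ n) w))" for n t
    by (rule ext, rule score_Suc_eq_shift)+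
  have stat_int: "integrable ?M (\<lambda>w. f ((shift ^^ n) w))" if "integrable ?M f"
    for f :: "(nat \<Rightarrow> real) \<Rightarrow> 'v::euclidean_space" and n
    using that integrable_distr_eq[OF E.funpow_T_measurable, of f n] by (auto simp: E.distr_funpow)
  have stat_distr: "distr ?M borel (\<lambda>w. f ((shift ^^ n) w)) = distr ?M borel f" if "f \<in> borel_measurable ?M"
    for f :: "(nat \<Rightarrow> real) \<Rightarrow> 'v::euclidean_space" and n
    using distr_distr[OF that E.funpow_T_measurable[of n]] by (simp add: E.distr_funpow comp_def)
  interpret SP: score_process ?M history \<Theta> \<theta>s "\<lambda>n. score \<Theta> p (Suc n)" "\<lambda>n. score_jac \<Theta> p (Suc n)" K1 K3
  proof
    fix n :: nat and t t1 t2 :: "real^('d::{finite,linorder})" and w :: "nat \<Rightarrow> real" and A :: "(nat \<Rightarrow> real) set"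
    show "subalgebra ?M (history n)" by (rule sub)
    show "sets (history n) \<subseteq> sets (history (Suc n))" by (rule sets_history_mono)
    show "compact \<Theta>" "convex \<Theta>" "\<theta>s \<in> \<Theta>" using \<theta>s by (auto simp: box(1))
    show "0 \<le> K1" "0 \<le> K3" using K_pos by auto
    show "continuous_on \<Theta> (\<lambda>t. score_jac \<Theta> p (Suc n) t w)"
      unfolding box(1) by (rule continuous_on_score_jac[OF p_pos' p_diff'])
    show "integrable ?M (score_jac \<Theta> p (Suc n) \<theta>s)"
      unfolding shifted by (rule stat_int[OF \<psi>1(2)[OF \<theta>s]])
    show "distr ?M borel (score_jac \<Theta> p (Suc n) \<theta>s) = distr ?M borel (score_jac \<Theta> p (Suc 0) \<theta>s)"
      unfolding shifted by (simp only: stat_distr[OF borel_measurable_integrable[OF \<psi>1(2)[OF \<theta>s]]])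
    {
      assume t: "t \<in> \<Theta>"
      show "score \<Theta> p (Suc n) t \<in> borel_measurable (history (Suc n))"
        "score_jac \<Theta> p (Suc n) t \<in> borel_measurable (history (Suc n))" by (rule adapted[OF t])+
      show "((\<lambda>t. score \<Theta> p (Suc n) t w) has_derivative (\<lambda>h. score_jac \<Theta> p (Suc n) t w *v h)) (at t within \<Theta>)"
        using score_has_derivative[of p, OF p_pos' p_diff'] t unfolding box(1) by blast
      show int: "integrable ?M (score \<Theta> p (Suc n) t)"
        unfolding shifted by (rule stat_int[OF \<psi>1(1)[OF t]])
      show "distr ?M borel (score \<Theta> p (Suc n) t) = distr ?M borel (score \<Theta> p (Suc 0) t)"
        unfolding shifted by (simp only: stat_distr[OF borel_measurable_integrable[OF \<psi>1(1)[OF t]]])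
      show "(\<integral>w\<in>A. (t - \<theta>s) \<bullet> score \<Theta> p (Suc n) t w \<partial>?M) \<le> - K1 * (norm (t - \<theta>s))\<^sup>2 * measure ?M A"
        if "A \<in> sets (history n)"
        using R4_drift[OF t, of "Suc n"] by (intro H.set_integral_inner_le[OF int that]) (simp add: cond_score_def)
    }
    show "(\<integral>\<^sup>+w\<in>A. ennreal (norm (score_jac \<Theta> p (Suc n) t1 w - score_jac \<Theta> p (Suc n) t2 w)) \<partial>?M)
        \<le> ennreal (K3 * norm (t1 - t2)) * emeasure ?M A"
      if t: "t1 \<in> \<Theta>" "t2 \<in> \<Theta>" and A: "A \<in> sets (history n)"
    proof (rule H.set_nn_integral_le[OF _ A])
      have [measurable]: "score_jac \<Theta> p (Suc n) t1 \<in> borel_measurable ?M" "score_jac \<Theta> p (Suc n) t2 \<in> borel_measurable ?M"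
        using adapted(2) t by (auto intro: measurable_from_subalg[OF sub])
      show "(\<lambda>w. ennreal (norm (score_jac \<Theta> p (Suc n) t1 w - score_jac \<Theta> p (Suc n) t2 w))) \<in> borel_measurable ?M"
        by measurable
    qed (use R4_jac_Lipschitz[OF t, of "Suc n"] in simp)
  qed
  let ?x = "base_est \<Theta> p \<beta> t0"
  \<comment> \<open>The correction by the projection term is exactly the displacement to the nearest
    point, so the base estimate is the projected sequence.\<close>
  have base: "?x n = SP.projected_seq \<beta> t0 n" for n
  proof (induction n)
    case (Suc n)
    show ?case
      using Suc by (auto simp: base_est_Suc[OF gain(1)] fun_eq_iff simp del: base_est.simps(2))
  qed (simp add: fun_eq_iff)
  have x: "SP.parameter n (?x n)" for n unfolding base by (rule SP.projected_seq_parameter[OF start])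
  have xm [measurable]: "?x n \<in> borel_measurable ?M" for n by (rule SP.parameter_measurable[OF x])
  have xL1: "(\<lambda>n. \<integral>w. norm (?x n w - \<theta>s) \<partial>?M) \<longlonglongrightarrow> 0"
    unfolding base using gain start by (intro SP.projected_seq_L1_tendsto) (auto simp: mult.assoc)
  have x_lim: "tendsto_in_probability ?M ?x \<theta>s"
  proof (rule M.tendsto_in_probability_L1[OF xm])
    have "(\<integral>\<^sup>+w. ennreal (dist (?x n w) \<theta>s) \<partial>?M) = ennreal (\<integral>w. norm (?x n w - \<theta>s) \<partial>?M)" for n
      unfolding dist_norm
      by (intro nn_integral_eq_integral SP.parameter_diff_integrable[OF x SP.parameter_const[OF \<theta>s]]) auto
    then show "(\<lambda>n. \<integral>\<^sup>+w. ennreal (dist (?x n w) \<theta>s) \<partial>?M) \<longlonglongrightarrow> 0"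
      using tendsto_ennrealI[OF xL1] by simp
  qed
  let ?L = "SP.linearized_score" and ?I = "fisher P \<Theta> p"
  let ?S = "\<lambda>n w. (1 / real n) *\<^sub>R (\<Sum>k<n. ?L k (?x k w) w)"
  let ?A = "\<lambda>n w. (1 / real n) *\<^sub>R (\<Sum>k<n. ?L k \<theta>s w)"
  have Lm [measurable]: "(\<lambda>w. ?L n (?x n w) w) \<in> borel_measurable ?M" "(\<lambda>w. ?L n \<theta>s w) \<in> borel_measurable ?M" for n
    using SP.linearized_score_measurable[OF x] SP.linearized_score_measurable[OF SP.parameter_const[OF \<theta>s]] by auto
  \<comment> \<open>The mean error of the average is at most the Cesaro mean of the L1 errors of its
    summands.\<close>
  have S_diff: "tendsto_in_probability ?M (\<lambda>n w. ?S n w - ?A n w) 0"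
  proof (rule M.tendsto_in_probability_L1)
    let ?d = "\<lambda>n w. norm (?L n (?x n w) w - ?L n \<theta>s w)"
    note di = SP.linearized_score_L1_tendsto[OF x xL1]
    have "(\<integral>\<^sup>+w. ennreal (dist (?S n w - ?A n w) 0) \<partial>?M) \<le> ennreal ((\<Sum>k<n. \<integral>w. ?d k w \<partial>?M) / real n)" for n
    proof -
      have "(\<integral>\<^sup>+w. ennreal (dist (?S n w - ?A n w) 0) \<partial>?M) \<le> (\<integral>\<^sup>+w. ennreal ((\<Sum>k<n. ?d k w) / real n) \<partial>?M)"
      proof (intro nn_integral_mono ennreal_leI)
        fix w
        have "?S n w - ?A n w = (1 / real n) *\<^sub>R (\<Sum>k<n. ?L k (?x k w) w - ?L k \<theta>s w)"
          by (simp only: sum_subtractf scaleR_diff_right)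
        then have "dist (?S n w - ?A n w) 0 = norm (\<Sum>k<n. ?L k (?x k w) w - ?L k \<theta>s w) / real n" by simp
        also have "\<dots> \<le> (\<Sum>k<n. ?d k w) / real n" by (intro divide_right_mono norm_sum) auto
        finally show "dist (?S n w - ?A n w) 0 \<le> (\<Sum>k<n. ?d k w) / real n" .
      qed
      also have "\<dots> = ennreal (\<integral>w. (\<Sum>k<n. ?d k w) / real n \<partial>?M)"
        using di(1) by (intro nn_integral_eq_integral) (auto intro!: sum_nonneg divide_nonneg_nonneg)
      also have "(\<integral>w. (\<Sum>k<n. ?d k w) / real n \<partial>?M) = (\<Sum>k<n. \<integral>w. ?d k w \<partial>?M) / real n"
        using di(1) by (simp add: Bochner_Integration.integral_sum)
      finally show ?thesis .
    qed
    moreover have "(\<lambda>n. ennreal ((\<Sum>k<n. \<integral>w. ?d k w \<partial>?M) / real n)) \<longlonglongrightarrow> 0"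
      using tendsto_ennrealI[OF cesaro_mean_tendsto_0[OF di(2)]] by simp
    ultimately show "(\<lambda>n. \<integral>\<^sup>+w. ennreal (dist (?S n w - ?A n w) 0) \<partial>?M) \<longlonglongrightarrow> 0"
      by (rule tendsto_sandwich[OF always_eventually[OF allI, OF zero_le] always_eventually[OF allI] tendsto_const])
  qed measurable
  have kernel: "(\<lambda>x. density lborel (\<lambda>y. ennreal (p t x y))) \<in> borel \<rightarrow>\<^sub>M prob_algebra borel" if "t \<in> cbox l u" for t
    using markov[of t] that box by (simp add: homogeneous_markov_def)
  have mean_score: "(\<integral>w. score \<Theta> p 1 \<theta>s w \<partial>?M) = 0"
    unfolding box(1)
    by (rule expected_score_eq_0[of p \<theta>s P])
      (use p_pos' p_diff' \<theta>s laws \<psi>1(1) p_meas kernel markov R1_integrable(1) R1_interchange(1) box(1) in auto)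
  have mean_jac: "(\<integral>w. score_jac \<Theta> p 1 \<theta>s w \<partial>?M) = - ?I \<theta>s"
    unfolding box(1)
    by (rule expected_score_jac_eq[of p \<theta>s P])
      (use p_pos' p_diff' \<theta>s laws \<psi>1 p_meas kernel markov R1_integrable(2) R1_interchange(2) R7_exists box(1) in auto)
  have S0_lim: "AE w in ?M. (\<lambda>n. ?A n w) \<longlonglongrightarrow> ?I \<theta>s *v \<theta>s"
  proof -
    let ?f = "\<lambda>w. score \<Theta> p 1 \<theta>s w - score_jac \<Theta> p 1 \<theta>s w *v \<theta>s"
    have bl: "bounded_linear (\<lambda>A :: real^('d::{finite,linorder})^('d::{finite,linorder}). A *v \<theta>s)"
      unfolding linear_conv_bounded_linear[symmetric]
      by (intro linearI) (simp_all add: matrix_vector_mult_add_rdistrib scaleR_matrix_vector_assoc[symmetric])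
    have f_int: "integrable ?M ?f"
      by (intro Bochner_Integration.integrable_diff \<psi>1 \<theta>s integrable_bounded_linear[OF bl])
    have "(\<integral>w. ?f w \<partial>?M) = - ((\<integral>w. score_jac \<Theta> p 1 \<theta>s w \<partial>?M) *v \<theta>s)"
      using integral_bounded_linear[OF bl \<psi>1(2)[OF \<theta>s]] mean_score
        \<psi>1[OF \<theta>s] integrable_bounded_linear[OF bl \<psi>1(2)[OF \<theta>s]]
      by (subst Bochner_Integration.integral_diff) auto
    \<comment> \<open>The minus sign of the information identity cancels the one in the linearized
      score.\<close>
    also have "\<dots> = ?I \<theta>s *v \<theta>s"
      unfolding mean_jac by (simp add: vec_eq_iff matrix_vector_mult_def sum_negf)
    finally have mean: "(\<integral>w. ?f w \<partial>?M) = ?I \<theta>s *v \<theta>s" .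
    have av: "AE w in ?M. \<forall>i\<in>UNIV. (\<lambda>n. E.ergodic_sum (\<lambda>w. ?f w $ i) n w / real n) \<longlonglongrightarrow> (?I \<theta>s *v \<theta>s) $ i"
    proof (intro AE_finite_allI)
      fix i
      show "AE w in ?M. (\<lambda>n. E.ergodic_sum (\<lambda>w. ?f w $ i) n w / real n) \<longlonglongrightarrow> (?I \<theta>s *v \<theta>s) $ i"
        using E.AE_ergodic_average[OF integrable_bounded_linear[OF bounded_linear_vec_nth[of i] f_int]]
        unfolding integral_vec_nth[OF f_int] mean .
    qed simp
    have L_shifted: "?L k \<theta>s w = ?f ((shift ^^ k) w)" for k w
      unfolding SP.linearized_score_def score_Suc_eq_shift[of \<Theta> p k \<theta>s w] ..
    from av show ?thesis
    proof eventually_elim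
      case (elim w)
      show ?case
      proof (rule vec_tendstoI)
        fix i
        have eq: "?A n w $ i = E.ergodic_sum (\<lambda>w. ?f w $ i) n w / real n" for n
          by (simp add: E.ergodic_sum_def L_shifted)
        show "(\<lambda>n. ?A n w $ i) \<longlonglongrightarrow> (?I \<theta>s *v \<theta>s) $ i"
          unfolding eq using elim by blast
      qed
    qed
  qed
  have S_lim: "tendsto_in_probability ?M ?S (?I \<theta>s *v \<theta>s)"
  proof -
    have "tendsto_in_probability ?M ?A (?I \<theta>s *v \<theta>s)"
      by (rule M.tendsto_in_probability_AE[OF _ S0_lim]) measurable
    from M.tendsto_in_probability_add[OF S_diff this] show ?thesis by simp
  qed
  let ?c = "\<lambda>n. (if odd k then - 1 else 1) * sqrt (\<kappa> / real n)"
  \<comment> \<open>A deterministic null sequence, treated as random so that it can be paired with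
    the other two.\<close>
  have c_lim: "tendsto_in_probability ?M (\<lambda>n _. ?c n) 0"
  proof (rule M.tendsto_in_probability_AE)
    have "(\<lambda>n. sqrt (\<kappa> / real n)) \<longlonglongrightarrow> sqrt 0" by (intro tendsto_real_sqrt lim_const_over_n)
    then show "AE w in ?M. ?c \<longlonglongrightarrow> 0" by (intro AE_I2 tendsto_mult_right_zero) simp
  qed simp
  let ?R = "\<lambda>t. matrix_inv (?I t)" and ?W = "\<lambda>t. matrix_inv (transpose (cholesky (?I t)))"
  let ?e = "axis (coord_index ((k + 1) div 2)) 1 :: real^('d::{finite,linorder})"
  \<comment> \<open>The extreme point as one function of the base estimate, the averaged linearized
    score and the signed radius. It is continuous over \<open>\<Theta>\<close>, so convergence of
    the triple suffices, and at the limit the information matrix cancels against its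
    inverse.\<close>
  let ?g = "\<lambda>((t, v), c). ?R t *v v + c *\<^sub>R (?W t *v ?e)"
  have R_cont: "continuous_on \<Theta> ?R"
    by (intro continuous_on_matrix_inv R7_cont positive_definite_invertible R7_posdef)
  have W_cont: "continuous_on \<Theta> ?W"
  proof (intro continuous_on_matrix_inv continuous_on_transpose continuous_on_cholesky R7_cont R7_posdef)
    show "compact \<Theta>" by (simp add: box(1))
    show "invertible (transpose (cholesky (?I t)))" if "t \<in> \<Theta>" for t
      using is_cholesky_invertible[OF is_cholesky_cholesky[OF R7_posdef[OF that]]] by (simp add: invertible_det_nz det_transpose)
  qed
  have g_cont: "continuous_on ((\<Theta> \<times> UNIV) \<times> UNIV) ?g"
    unfolding split_beta' matrix_vector_mult_def
    by (intro continuous_intros continuous_on_compose2[OF R_cont] continuous_on_compose2[OF W_cont]) auto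
  have "tendsto_in_probability ?M (\<lambda>n w. ?g ((?x n w, ?S n w), ?c n)) (?g ((\<theta>s, ?I \<theta>s *v \<theta>s), 0))"
    using M.tendsto_in_probability_Pair[OF M.tendsto_in_probability_Pair[OF x_lim S_lim] c_lim]
    by (rule M.tendsto_in_probability_continuous[OF _ _ _ g_cont])
      (use \<theta>s SP.parameter_in[OF x] in auto)
  moreover have "?g ((\<theta>s, ?I \<theta>s *v \<theta>s), 0) = \<theta>s"
  proof -
    have "invertible (?I \<theta>s)" by (rule positive_definite_invertible[OF R7_posdef[OF \<theta>s]])
    then have "matrix_inv (?I \<theta>s) ** ?I \<theta>s = mat 1"
      unfolding matrix_inv_def invertible_def by (rule someI2_ex) simp
    then show ?thesis by (simp add: matrix_vector_mul_assoc)
  qed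
  moreover have "?g ((?x n w, ?S n w), ?c n) = extreme_point P \<Theta> p \<beta> t0 \<kappa> n k w" for n w
    using gain(1) by (simp add: extreme_point_def estimator_eq SP.linearized_score_def)
  ultimately show "tendsto_in_probability ?M (\<lambda>n. extreme_point P \<Theta> p \<beta> t0 \<kappa> n k) \<theta>s"
    by simp
qed

end
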